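(* Let $\varphi\in\mathcal F_{\mu,\beta}(L)$ with $\mu,L>0$ and $\beta>2$. Let the noise assumption given in the context hold and let $\mathcal Z=\mathcal X\times\mathcal Y$ be a convex compact subset of $\mathbb R^n$. Put $$\tau_k=\left(\frac{3\kappa\sigma^2n}{2(\beta-1)(\kappa_\beta L)^2}\right)^{\frac1{2\beta}}k^{-\frac1{2\beta}},\qquad\gamma_k=\frac2{\mu k},\qquad k=1,\dots,N,$$ and let $\varphi$ be $M$-Lipschitz on the Euclidean $\tau_1$-neighbourhood of $\mathcal Z$. Then the zero-order stochastic projected gradient algorithm described in the context, run with these parameters, satisfies $$\mathbb E\left[\varphi(\overline x_N,y^* )-\varphi(x^*,\overline y_N)\right]\le\max_{y\in\mathcal Y}\mathbb E\left[\varphi(\overline x_N,y)\right]-\min_{x\in\mathcal X}\mathbb E\left[\varphi(x,\overline y_N)\right]\le\frac1\mu\left(n^{2-\frac1\beta}\frac{A_1}{N^{\frac{\beta-1}\beta}}+A_2\frac{n(1+\ln N)}{N}\right),$$ where $\overline z_N=(\overline x_N,\overline y_N)=\frac1N\sum_{k=1}^Nz_k$, $(x^*,y^* )$ is the solution of the saddle-point problem, $A_1=3\beta(\kappa\sigma^2)^{\frac{\beta-1}\beta}(\kappa_\beta L)^{\frac2\beta}$, $A_2=9\kappa M^2$, and $\kappa_\beta,\kappa$ are the constants, depending only on $\beta$, defined in the context.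
   Context: Problem: $\min_{x\in\mathcal X}\max_{y\in\mathcal Y}\varphi(x,y)$ with $\mathcal X\subset\mathbb R^{n_x}$, $\mathcal Y\subset\mathbb R^{n_y}$ compact convex, $\mathcal Z=\mathcal X\times\mathcal Y$, $n=n_x+n_y$, $z=(x,y)$, $\varphi(z)=\varphi(x,y)$. All norms are Euclidean. Function classes: let $l$ be the maximal integer strictly less than $\beta$. $\mathcal F_\beta(L)$ is the set of all functions $\varphi:\mathbb R^n\to\mathbb R$ that are differentiable $l$ times and for all $z,w\in U_{\varepsilon_0}(\mathcal Z)$ (an $\varepsilon_0$-neighbourhood of $\mathcal Z$) satisfy the Hölder condition $$\left|\varphi(z)-\sum_{0\le|m|\le l}\frac1{m!}D^m\varphi(w)(z-w)^m\right|\le L\|z-w\|^\beta,$$ where the sum is over multi-indices $m=(m_1,\dots,m_n)$ of nonnegative integers, $m!=m_1!\cdots m_n!$, $|m|=m_1+\dots+m_n$ and $D^m\varphi(w)z^m=\frac{\partial^{|m|}\varphi(w)}{\partial^{m_1}z_1\cdots\partial^{m_n}z_n}z_1^{m_1}\cdots z_n^{m_n}$. $\mathcal F_{\mu,\beta}(L)$ is the set of $\mu$-strongly-convex-strongly-concave functions $\varphi\in\mathcal F_\beta(L)$: $\varphi(\cdot,y)$ is $\mu$-strongly convex for all $y$ and $\varphi(x,\cdot)$ is $\mu$-strongly concave for all $x$, with respect to the Euclidean norm on $\mathcal Z$ ($f$ is $\mu$-strongly convex if it is continuously differentiable and $f(v)\ge f(u)+\langle\nabla f(u),v-u\rangle+\frac\mu2\|v-u\|^2$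 for all $u,v$; $f$ is $\mu$-strongly concave if $-f$ is $\mu$-strongly convex). Kernel: $K:[-1,1]\to\mathbb R$ satisfies, for $r$ uniformly distributed on $[-1,1]$, $\mathbb E[K(r)]=0$, $\mathbb E[rK(r)]=1$, $\mathbb E[r^jK(r)]=0$ for $j=2,\dots,l$, and $\mathbb E[|r|^\beta|K(r)|]<\infty$. Set $\kappa_\beta=\int|u|^\beta|K(u)|\,du$ and $\kappa=\int K^2(u)\,du$; these do not depend on $n$, only on $\beta$. Algorithm: generate scalars $r_1,\dots,r_N$ uniformly on $[-1,1]$ and vectors $e_1,\dots,e_N$ uniformly on the Euclidean unit sphere of $\mathbb R^n$, $e_k=((e_k)_x,(e_k)_y)$. Starting from $z_1\in\mathcal Z$, for $k=1,\dots,N$: (1) observe $\tilde\varphi_k^+=\varphi(z_k+\tau_kr_ke_k)+\xi_k^+$ and $\tilde\varphi_k^-=\varphi(z_k-\tau_kr_ke_k)+\xi_k^-$; (2) set $\tilde g_k=\frac n{2\tau_k}(\tilde\varphi_k^+-\tilde\varphi_k^-)\begin{pmatrix}(e_k)_x\\-(e_k)_y\end{pmatrix}K(r_k)$; (3) update $z_{k+1}=\Pi_{\mathcal Z}(z_k-\gamma_k\tilde g_k)$, where $\Pi_{\mathcal Z}$ is the Euclidean projection onto $\mathcal Z$. Noise assumption: for all $k=1,\dots,N$, (i) $\mathbb E[(\xi_k^+)^2]\le\sigma^2$ and $\mathbb E[(\xi_k^-)^2]\le\sigma^2$, where $\sigma\ge0$; (ii) the random variables $\xi_k^+$ and $\xi_k^-$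 are independent from $e_k$ and $r_k$, and the random variables $e_k$ and $r_k$ are independent. Neither zero mean nor the i.i.d. property of the noises is assumed.
   Formalization: Formal version assumes σ>0 (for σ=0, τ_k=0 and the algorithm divides by 0), τ_1≤ε_0 so the Hölder condition covers all queries, and that (e_k,r_k) is independent of the current noise jointly with the whole past; without these the claim is undefined or false. *)

theory Defs
  imports "HOL-Probability.Probability"
begin

text \<open>
  The product type \<open>'a \<times> 'b\<close> carries the Euclidean norm, so \<open>z = (x, y)\<close> of type \<open>'a \<times> 'b\<close> stands for a
  point of \<open>\<real>\<^sup>n\<close> with \<open>n = n\<^sub>x + n\<^sub>y\<close>, \<open>n\<^sub>x = DIM('a)\<close>, \<open>n\<^sub>y = DIM('b)\<close>.
\<close>

section \<open>Higher-order smoothness\<close>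

definition neighbourhood :: "real \<Rightarrow> 'a::metric_space set \<Rightarrow> 'a set" where
  "neighbourhood \<epsilon> S = (\<Union>z\<in>S. ball z \<epsilon>)"

definition partial_deriv :: "'a::euclidean_space \<Rightarrow> ('a \<Rightarrow> real) \<Rightarrow> 'a \<Rightarrow> real" where
  "partial_deriv i f z = deriv (\<lambda>t. f (z + t *\<^sub>R i)) 0"

text \<open>Frechet differentiability, iterated: the total derivative of \<open>f\<close> is \<open>k\<close> times differentiable
  iff all its components, the partial derivatives, are.\<close>

primrec times_differentiable :: "nat \<Rightarrow> ('a::euclidean_space \<Rightarrow> real) \<Rightarrow> bool" where
  "times_differentiable 0 f \<longleftrightarrow> True"
| "times_differentiable (Suc k) f \<longleftrightarrow>
     (\<forall>z. f differentiable (at z)) \<and> (\<forall>i\<in>Basis. times_differentiable k (partial_deriv i f))"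

text \<open>A multi-index is a function on the basis, extended by zero.\<close>

definition multi_indices :: "nat \<Rightarrow> ('a::euclidean_space \<Rightarrow> nat) set" where
  "multi_indices l = {m. (\<forall>i. i \<notin> Basis \<longrightarrow> m i = 0) \<and> (\<Sum>i\<in>Basis. m i) \<le> l}"

text \<open>A fixed enumeration of the coordinates. Up to order \<open>l\<close> the mixed partial derivatives of an
  \<open>l\<close> times differentiable function do not depend on it.\<close>

definition basis_enum :: "'a::euclidean_space list" where
  "basis_enum = (SOME bs. distinct bs \<and> set bs = Basis)"

definition multi_deriv :: "('a::euclidean_space \<Rightarrow> nat) \<Rightarrow> ('a \<Rightarrow> real) \<Rightarrow> 'a \<Rightarrow> real" where
  "multi_deriv m f = foldr (\<lambda>i. partial_deriv i ^^ m i) basis_enum f"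

definition taylor_poly :: "nat \<Rightarrow> ('a::euclidean_space \<Rightarrow> real) \<Rightarrow> 'a \<Rightarrow> 'a \<Rightarrow> real" where
  "taylor_poly l f w z =
     (\<Sum>m\<in>multi_indices l.
        1 / (\<Prod>i\<in>Basis. fact (m i)) * multi_deriv m f w * (\<Prod>i\<in>Basis. ((z - w) \<bullet> i) ^ m i))"

text \<open>The largest integer strictly less than \<open>\<beta>\<close> (for \<open>\<beta> > 0\<close>).\<close>

definition smoothness_order :: "real \<Rightarrow> nat" where
  "smoothness_order \<beta> = nat (\<lceil>\<beta>\<rceil> - 1)"

definition holder_class ::
    "real \<Rightarrow> 'a::euclidean_space set \<Rightarrow> real \<Rightarrow> real \<Rightarrow> ('a \<Rightarrow> real) set" where
  "holder_class \<epsilon>\<^sub>0 Z \<beta> L =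
     {\<phi>. times_differentiable (smoothness_order \<beta>) \<phi> \<and>
         (\<forall>z\<in>neighbourhood \<epsilon>\<^sub>0 Z. \<forall>w\<in>neighbourhood \<epsilon>\<^sub>0 Z.
            \<bar>\<phi> z - taylor_poly (smoothness_order \<beta>) \<phi> w z\<bar> \<le> L * norm (z - w) powr \<beta>)}"

definition strongly_convex_on :: "real \<Rightarrow> 'a::euclidean_space set \<Rightarrow> ('a \<Rightarrow> real) \<Rightarrow> bool" where
  "strongly_convex_on \<mu> S f \<longleftrightarrow>
     (\<exists>g. continuous_on S g \<and> (\<forall>u\<in>S. GDERIV f u :> g u) \<and>
          (\<forall>u\<in>S. \<forall>v\<in>S. f v \<ge> f u + g u \<bullet> (v - u) + \<mu> / 2 * (norm (v - u))\<^sup>2))"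

definition strongly_concave_on :: "real \<Rightarrow> 'a::euclidean_space set \<Rightarrow> ('a \<Rightarrow> real) \<Rightarrow> bool" where
  "strongly_concave_on \<mu> S f \<longleftrightarrow> strongly_convex_on \<mu> S (\<lambda>x. - f x)"

definition saddle_holder_class ::
    "real \<Rightarrow> 'a::euclidean_space set \<Rightarrow> 'b::euclidean_space set \<Rightarrow> real \<Rightarrow> real \<Rightarrow> real
      \<Rightarrow> ('a \<times> 'b \<Rightarrow> real) set" where
  "saddle_holder_class \<epsilon>\<^sub>0 X Y \<mu> \<beta> L =
     {\<phi> \<in> holder_class \<epsilon>\<^sub>0 (X \<times> Y) \<beta> L.
        (\<forall>y\<in>Y. strongly_convex_on \<mu> X (\<lambda>x. \<phi> (x, y))) \<and>
        (\<forall>x\<in>X. strongly_concave_on \<mu> Y (\<lambda>y. \<phi> (x, y)))}"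

definition saddle_point :: "('a \<times> 'b \<Rightarrow> real) \<Rightarrow> 'a set \<Rightarrow> 'b set \<Rightarrow> 'a \<Rightarrow> 'b \<Rightarrow> bool" where
  "saddle_point \<phi> X Y x\<^sub>s y\<^sub>s \<longleftrightarrow>
     x\<^sub>s \<in> X \<and> y\<^sub>s \<in> Y \<and> (\<forall>y\<in>Y. \<phi> (x\<^sub>s, y) \<le> \<phi> (x\<^sub>s, y\<^sub>s)) \<and> (\<forall>x\<in>X. \<phi> (x\<^sub>s, y\<^sub>s) \<le> \<phi> (x, y\<^sub>s))"

section \<open>Random directions, kernel and noise\<close>

definition uniform_interval :: "real measure" where
  "uniform_interval = uniform_measure lborel {-1..1}"

text \<open>Normalised surface measure on the unit sphere, as the law of the direction of a uniformly
  distributed point of the unit ball (\<open>sgn z = z /\<^sub>R norm z\<close>).\<close>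

definition uniform_sphere :: "'a::euclidean_space measure" where
  "uniform_sphere = distr (uniform_measure lborel (ball 0 1)) borel sgn"

text \<open>The kernel is a function on \<open>[-1,1]\<close>; the values of \<open>K\<close> elsewhere are irrelevant. The integrability of
  \<open>K\<^sup>2\<close> says that the constant \<open>\<kappa>\<close> is finite, and makes all the moments below exist.\<close>

definition smoothing_kernel :: "real \<Rightarrow> (real \<Rightarrow> real) \<Rightarrow> bool" where
  "smoothing_kernel \<beta> K \<longleftrightarrow>
     K \<in> borel_measurable borel \<and>
     integrable uniform_interval (\<lambda>u. (K u)\<^sup>2) \<and>
     (\<integral>u. K u \<partial>uniform_interval) = 0 \<and>
     (\<integral>u. u * K u \<partial>uniform_interval) = 1 \<and>
     (\<forall>j\<in>{2..smoothness_order \<beta>}. (\<integral>u. u ^ j * K u \<partial>uniform_interval) = 0) \<and>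
     integrable uniform_interval (\<lambda>u. \<bar>u\<bar> powr \<beta> * \<bar>K u\<bar>)"

text \<open>The constants use Lebesgue measure \<open>du\<close>, not the uniform probability measure.\<close>

definition kernel_kappa_beta :: "real \<Rightarrow> (real \<Rightarrow> real) \<Rightarrow> real" where
  "kernel_kappa_beta \<beta> K = (LBINT u:{-1..1}. \<bar>u\<bar> powr \<beta> * \<bar>K u\<bar>)"

definition kernel_kappa :: "(real \<Rightarrow> real) \<Rightarrow> real" where
  "kernel_kappa K = (LBINT u:{-1..1}. (K u)\<^sup>2)"

definition uniform_draws ::
    "'w measure \<Rightarrow> nat \<Rightarrow> (nat \<Rightarrow> 'w \<Rightarrow> 'a::euclidean_space) \<Rightarrow> (nat \<Rightarrow> 'w \<Rightarrow> real) \<Rightarrow> bool" where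
  "uniform_draws P N e r \<longleftrightarrow>
     (\<forall>k\<in>{1..N}.
        e k \<in> borel_measurable P \<and> distr P borel (e k) = uniform_sphere \<and>
        r k \<in> borel_measurable P \<and> distr P borel (r k) = uniform_interval)"

text \<open>Independence of two random variables with possibly different value types
  (\<open>prob_space.indep_var\<close> needs equal types).\<close>

definition indep_rv ::
    "'w measure \<Rightarrow> 'c measure \<Rightarrow> ('w \<Rightarrow> 'c) \<Rightarrow> 'd measure \<Rightarrow> ('w \<Rightarrow> 'd) \<Rightarrow> bool" where
  "indep_rv P S U T V \<longleftrightarrow>
     U \<in> measurable P S \<and> V \<in> measurable P T \<and>
     prob_space.indep_set P
       (sets (vimage_algebra (space P) U S)) (sets (vimage_algebra (space P) V T))"

text \<open>Step \<open>k\<close> draws \<open>e k\<close> and \<open>r k\<close> afresh: they are independent of each other, and the pair is independent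
  of the present noise together with everything that happened before step \<open>k\<close>. The noises may depend on the
  past in any way; neither zero mean nor independence among them is required.\<close>

definition noise_model ::
    "'w measure \<Rightarrow> nat \<Rightarrow> real \<Rightarrow> (nat \<Rightarrow> 'w \<Rightarrow> 'a::euclidean_space) \<Rightarrow> (nat \<Rightarrow> 'w \<Rightarrow> real)
      \<Rightarrow> (nat \<Rightarrow> 'w \<Rightarrow> real) \<Rightarrow> (nat \<Rightarrow> 'w \<Rightarrow> real) \<Rightarrow> bool" where
  "noise_model P N \<sigma> e r \<xi>p \<xi>m \<longleftrightarrow>
     (\<forall>k\<in>{1..N}.
        \<xi>p k \<in> borel_measurable P \<and> \<xi>m k \<in> borel_measurable P \<and>
        integrable P (\<lambda>\<omega>. (\<xi>p k \<omega>)\<^sup>2) \<and> (\<integral>\<omega>. (\<xi>p k \<omega>)\<^sup>2 \<partial>P) \<le> \<sigma>\<^sup>2 \<and>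
        integrable P (\<lambda>\<omega>. (\<xi>m k \<omega>)\<^sup>2) \<and> (\<integral>\<omega>. (\<xi>m k \<omega>)\<^sup>2 \<partial>P) \<le> \<sigma>\<^sup>2 \<and>
        indep_rv P borel (e k) borel (r k) \<and>
        indep_rv P
          borel (\<lambda>\<omega>. (e k \<omega>, r k \<omega>))
          ((\<Pi>\<^sub>M j\<in>{1..<k}. borel) \<Otimes>\<^sub>M borel)
          (\<lambda>\<omega>. (\<lambda>j\<in>{1..<k}. (e j \<omega>, r j \<omega>, \<xi>p j \<omega>, \<xi>m j \<omega>), (\<xi>p k \<omega>, \<xi>m k \<omega>))))"

section \<open>The algorithm\<close>

definition zo_gradient ::
    "('a::euclidean_space \<times> 'b::euclidean_space \<Rightarrow> real) \<Rightarrow> (real \<Rightarrow> real) \<Rightarrow> real \<Rightarrow> 'a \<times> 'b \<Rightarrow> 'a \<times> 'b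
      \<Rightarrow> real \<Rightarrow> real \<Rightarrow> real \<Rightarrow> 'a \<times> 'b" where
  "zo_gradient \<phi> K t z e r \<xi>p \<xi>m =
     (let \<phi>p = \<phi> (z + (t * r) *\<^sub>R e) + \<xi>p;
          \<phi>m = \<phi> (z - (t * r) *\<^sub>R e) + \<xi>m
      in (real DIM('a \<times> 'b) / (2 * t) * (\<phi>p - \<phi>m) * K r) *\<^sub>R (fst e, - snd e))"

definition zo_iterates ::
    "'w measure \<Rightarrow> nat \<Rightarrow> ('a::euclidean_space \<times> 'b::euclidean_space \<Rightarrow> real) \<Rightarrow> ('a \<times> 'b) set
      \<Rightarrow> (real \<Rightarrow> real) \<Rightarrow> (nat \<Rightarrow> real) \<Rightarrow> (nat \<Rightarrow> real)
      \<Rightarrow> (nat \<Rightarrow> 'w \<Rightarrow> 'a \<times> 'b) \<Rightarrow> (nat \<Rightarrow> 'w \<Rightarrow> real) \<Rightarrow> (nat \<Rightarrow> 'w \<Rightarrow> real) \<Rightarrow> (nat \<Rightarrow> 'w \<Rightarrow> real)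
      \<Rightarrow> 'a \<times> 'b \<Rightarrow> (nat \<Rightarrow> 'w \<Rightarrow> 'a \<times> 'b) \<Rightarrow> bool" where
  "zo_iterates P N \<phi> Z K \<tau> \<gamma> e r \<xi>p \<xi>m z\<^sub>1 z \<longleftrightarrow>
     (\<forall>\<omega>\<in>space P. z 1 \<omega> = z\<^sub>1 \<and>
        (\<forall>k\<in>{1..N}. z (Suc k) \<omega> =
           closest_point Z
             (z k \<omega> - \<gamma> k *\<^sub>R zo_gradient \<phi> K (\<tau> k) (z k \<omega>) (e k \<omega>) (r k \<omega>) (\<xi>p k \<omega>) (\<xi>m k \<omega>))))"

definition zo_average :: "nat \<Rightarrow> (nat \<Rightarrow> 'w \<Rightarrow> 'a::real_vector) \<Rightarrow> 'w \<Rightarrow> 'a" where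
  "zo_average N z \<omega> = (1 / real N) *\<^sub>R (\<Sum>k=1..N. z k \<omega>)"

end

theory Submission
  imports Defs
begin

text \<open>
  Strong convexity and concavity bound the gap \<open>\<phi>(x\<^sub>k, y) - \<phi>(x, y\<^sub>k)\<close> by the inner product of the
  saddle gradient at \<open>z\<^sub>k\<close> with \<open>z\<^sub>k - (x, y)\<close>, minus a quadratic term that absorbs the bias of the estimate.
  The kernel annihilates all Taylor monomials except the linear ones, so the bias is of order
  \<open>\<surd>n L \<tau>\<^sup>\<beta>\<^sup>-\<^sup>1\<close>. The second moment grows only linearly in \<open>n\<close>, up to the noise, because the symmetric
  difference of \<open>\<phi>\<close> is an odd Lipschitz function of the direction \<open>e\<close>, whose variance on the sphere is
  of order \<open>1/n\<close>. This is shown for a pair \<open>(x, y)\<close> uniform in the unit ball of twice the dimension: rotating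
  \<open>x\<close> to \<open>- x\<close> through \<open>cos \<theta> x + sin \<theta> y\<close> expresses an odd function by its derivatives in the
  direction \<open>y\<close>, which is isotropic given \<open>x\<close>. Stepsizes \<open>2 / (\<mu> k)\<close> make the distances telescope.
\<close>


section \<open>Isotropy and polar decomposition of Lebesgue measure\<close>

text \<open>The obstacle is the dimension factor of the Lipschitz term. The pointwise bound
  \<open>2 * M * \<tau> k\<close> on the symmetric difference gives a second moment of order n^2,
  while the claim allows only n. What is missing is the spherical Poincare inequality for odd
  functions. Its usual proof by spherical harmonics is replaced by one that needs only Lebesgue
  measure: rotations that mix the components of a pair are products of shears, and shears preserve
  Lebesgue measure by Fubini. The constants are not sharp: \<open>pi\<close> is replaced by 4, the
  degree-one extension to the whole space doubles the Lipschitz constant, and so does the symmetric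
  difference. The variance bound becomes 64 M^2 s^2 / n, which ends as 8 n kappa M^2, below the 9 of
  \<open>A\<^sub>2\<close>. Noise of nonzero mean does not harm the bias: it is frozen while the
  fresh draw is integrated out, and the kernel has mean zero.\<close>

lemma lborel_distr_permute:
  assumes p: "p permutes (Basis :: 'a::euclidean_space set)"
  shows "distr lborel borel (\<lambda>x::'a. \<Sum>b\<in>Basis. (x \<bullet> p b) *\<^sub>R b) = lborel" (is "distr _ _ ?T = _")
proof (rule lborel_eqI[symmetric])
  fix l u :: 'a assume lu: "\<And>b. b \<in> Basis \<Longrightarrow> l \<bullet> b \<le> u \<bullet> b"
  let ?q = "inv_into UNIV p"
  let ?S = "\<lambda>x::'a. \<Sum>b\<in>Basis. (x \<bullet> ?q b) *\<^sub>R b"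
  have q: "?q permutes Basis" using p by (rule permutes_inv)
  have inT: "?T x \<bullet> b = x \<bullet> p b" if "b \<in> Basis" for x b using that by simp
  have inS: "?S x \<bullet> b = x \<bullet> ?q b" if "b \<in> Basis" for x b using that by simp
  have qb: "?q b \<in> Basis" "p b \<in> Basis" if "b \<in> Basis" for b
    using that permutes_in_image[OF p] permutes_in_image[OF q] by auto
  \<comment> \<open>The preimage of a box is the box with permuted corners, whose edge lengths have
    the same product.\<close>
  have "x \<in> ?T -` box l u \<longleftrightarrow> x \<in> box (?S l) (?S u)" for x
  proof -
    have "x \<in> ?T -` box l u \<longleftrightarrow> (\<forall>b\<in>Basis. l \<bullet> b < x \<bullet> p b \<and> x \<bullet> p b < u \<bullet> b)"
      by (simp add: mem_box inT del: inner_sum_left)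
    also have "\<dots> \<longleftrightarrow> (\<forall>b\<in>Basis. l \<bullet> ?q b < x \<bullet> b \<and> x \<bullet> b < u \<bullet> ?q b)"
    proof (intro iffI ballI)
      fix b :: 'a assume *: "\<forall>b\<in>Basis. l \<bullet> b < x \<bullet> p b \<and> x \<bullet> p b < u \<bullet> b" "b \<in> Basis"
      then show "l \<bullet> ?q b < x \<bullet> b \<and> x \<bullet> b < u \<bullet> ?q b"
        using qb(1)[OF *(2)] permutes_inverses(1)[OF p, of b] by (metis (no_types))
    next
      fix b :: 'a assume *: "\<forall>b\<in>Basis. l \<bullet> ?q b < x \<bullet> b \<and> x \<bullet> b < u \<bullet> ?q b" "b \<in> Basis"
      then show "l \<bullet> b < x \<bullet> p b \<and> x \<bullet> p b < u \<bullet> b"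
        using qb(2)[OF *(2)] permutes_inverses(2)[OF p, of b] by (metis (no_types))
    qed
    also have "\<dots> \<longleftrightarrow> x \<in> box (?S l) (?S u)"
      by (simp add: mem_box inS del: inner_sum_left)
    finally show ?thesis .
  qed
  then have "?T -` box l u = box (?S l) (?S u)" by blast
  then have "emeasure (distr lborel borel ?T) (box l u) = emeasure lborel (box (?S l) (?S u))"
    by (subst emeasure_distr) auto
  also have "\<dots> = (\<Prod>b\<in>Basis. (?S u - ?S l) \<bullet> b)"
    by (rule emeasure_lborel_box) (simp add: inS lu qb del: inner_sum_left)
  also have "(\<Prod>b\<in>Basis. (?S u - ?S l) \<bullet> b) = (\<Prod>b\<in>Basis. (u - l) \<bullet> ?q b)"
    by (intro prod.cong refl) (simp add: inS inner_diff_left del: inner_sum_left)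
  also have "\<dots> = (\<Prod>b\<in>Basis. (u - l) \<bullet> b)"
    using prod.permute[OF q, of "\<lambda>b. (u - l) \<bullet> b"] by (simp add: comp_def)
  finally show "emeasure (distr lborel borel ?T) (box l u) = (\<Prod>b\<in>Basis. (u - l) \<bullet> b)" .
qed simp

lemma lborel_distr_sign_change:
  assumes c: "\<And>b. b \<in> Basis \<Longrightarrow> \<bar>c b\<bar> = 1"
  shows "distr lborel borel (\<lambda>x::'a::euclidean_space. \<Sum>b\<in>Basis. (c b * (x \<bullet> b)) *\<^sub>R b) = lborel"
  using lborel_affine_euclidean[of c "0::'a"] c by (fastforce simp: density_1)

lemma integral_lborel_distr_eq:
  fixes f :: "'a::euclidean_space \<Rightarrow> real"
  assumes "distr lborel borel T = lborel" "T \<in> borel_measurable borel" "f \<in> borel_measurable borel"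
  shows "(\<integral>x. f (T x) \<partial>lborel) = (\<integral>x. f x \<partial>lborel)"
  using integral_distr[of T lborel borel f] assms by simp

lemma nn_integral_lborel_distr_eq:
  fixes f :: "'a::euclidean_space \<Rightarrow> ennreal"
  assumes "distr lborel borel T = lborel" "T \<in> borel_measurable borel" "f \<in> borel_measurable borel"
  shows "(\<integral>\<^sup>+x. f (T x) \<partial>lborel) = (\<integral>\<^sup>+x. f x \<partial>lborel)"
  using nn_integral_distr[of T lborel borel f] assms by simp

lemma linear_functional_inner:
  fixes D :: "'a::euclidean_space \<Rightarrow> real"
  assumes "linear D"
  shows "D y = y \<bullet> (\<Sum>b\<in>Basis. D b *\<^sub>R b)"
proof -
  have "D y = D (\<Sum>b\<in>Basis. (y \<bullet> b) *\<^sub>R b)" by (simp add: euclidean_representation)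
  also have "\<dots> = (\<Sum>b\<in>Basis. (y \<bullet> b) * D b)"
    by (simp add: linear_sum[OF assms] linear_scale[OF assms])
  finally show ?thesis by (simp add: inner_sum_right mult.commute)
qed

lemma has_derivative_along_line:
  fixes f :: "'a::real_normed_vector \<Rightarrow> real"
  assumes "(f has_derivative D) (at z)"
  shows "((\<lambda>t. f (z + t *\<^sub>R v)) has_field_derivative D v) (at 0)"
proof -
  have linD: "linear D" using assms has_derivative_linear by blast
  have "((\<lambda>t. f (z + t *\<^sub>R v)) has_derivative (\<lambda>t. D (t *\<^sub>R v))) (at 0)"
    by (rule has_derivative_compose[where f="\<lambda>t. z + t *\<^sub>R v" and g=f])
       (auto intro!: derivative_eq_intros assms)
  then show ?thesis
    by (simp add: has_field_derivative_def linear_scale[OF linD] mult.commute[of _ "D v"])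
qed

lemma norm_eq_sum_coords: "(norm (x::'a::euclidean_space))\<^sup>2 = (\<Sum>b\<in>Basis. (x \<bullet> b)\<^sup>2)"
  unfolding power2_norm_eq_inner by (subst euclidean_inner) (simp add: power2_eq_square)

text \<open>Coordinate permutations and sign changes suffice here: negating coordinate
  \<open>i\<close> shows that a mixed moment equals its own negative, and transposing
  \<open>i\<close> and \<open>k\<close> identifies two diagonal moments. Both maps preserve the
  norm, hence the weight.\<close>

lemma radial_second_moment_Basis:
  fixes g :: "real \<Rightarrow> real"
  assumes [measurable]: "g \<in> borel_measurable borel"
    and ij: "i \<in> Basis" "j \<in> (Basis :: 'a::euclidean_space set)" and k: "k \<in> Basis"
  shows "(\<integral>y. g (norm y) * ((y \<bullet> i) * (y \<bullet> j)) \<partial>lborel)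
    = (if i = j then \<integral>y. g (norm (y::'a)) * (y \<bullet> k)\<^sup>2 \<partial>lborel else 0)"
proof (cases "i = j")
  case True
  define p where "p = Transposition.transpose i k"
  have p: "p permutes (Basis :: 'a set)" unfolding p_def using ij k by (simp add: permutes_swap_id)
  let ?T = "\<lambda>x::'a. \<Sum>b\<in>Basis. (x \<bullet> p b) *\<^sub>R b"
  have inT: "?T x \<bullet> b = x \<bullet> p b" if "b \<in> Basis" for x b using that by simp
  have nT: "norm (?T x) = norm x" for x
  proof -
    have "(norm (?T x))\<^sup>2 = (\<Sum>b\<in>Basis. (x \<bullet> p b)\<^sup>2)"
      unfolding norm_eq_sum_coords by (intro sum.cong refl) (simp add: inT del: inner_sum_left)
    also have "\<dots> = (norm x)\<^sup>2"
      unfolding norm_eq_sum_coords using sum.permute[OF p, of "\<lambda>b. (x \<bullet> b)\<^sup>2"] by (simp add: comp_def)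
    finally show ?thesis by simp
  qed
  have [measurable]: "?T \<in> borel_measurable borel" by measurable
  have "(\<integral>y. g (norm y) * (y \<bullet> k)\<^sup>2 \<partial>lborel) = (\<integral>y. g (norm (?T y)) * (?T y \<bullet> k)\<^sup>2 \<partial>lborel)"
    by (rule integral_lborel_distr_eq[OF lborel_distr_permute[OF p], symmetric]) measurable
  also have "\<dots> = (\<integral>y. g (norm y) * (y \<bullet> i)\<^sup>2 \<partial>lborel)"
    unfolding nT inT[OF k] by (simp add: p_def)
  finally show ?thesis using True by (simp add: power2_eq_square)
next
  case False
  define c where "c = (\<lambda>b. if b = i then -1 else 1 :: real)"
  let ?T = "\<lambda>x::'a. \<Sum>b\<in>Basis. (c b * (x \<bullet> b)) *\<^sub>R b"
  have inT: "?T x \<bullet> b = c b * (x \<bullet> b)" if "b \<in> Basis" for x b using that by simp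
  have nT: "norm (?T x) = norm x" for x
  proof -
    have "(norm (?T x))\<^sup>2 = (norm x)\<^sup>2"
      unfolding norm_eq_sum_coords
      by (intro sum.cong refl) (simp add: inT c_def del: inner_sum_left)
    then show ?thesis by simp
  qed
  have [measurable]: "?T \<in> borel_measurable borel" by measurable
  have "(\<integral>y. g (norm y) * ((y \<bullet> i) * (y \<bullet> j)) \<partial>lborel)
      = (\<integral>y. g (norm (?T y)) * ((?T y \<bullet> i) * (?T y \<bullet> j)) \<partial>lborel)"
    by (rule integral_lborel_distr_eq[symmetric]) (auto simp: c_def intro!: lborel_distr_sign_change)
  also have "\<dots> = (\<integral>y. - (g (norm y) * ((y \<bullet> i) * (y \<bullet> j))) \<partial>lborel)"
    unfolding nT inT[OF ij(1)] inT[OF ij(2)] using False by (simp add: c_def)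
  also have "\<dots> = - (\<integral>y. g (norm y) * ((y \<bullet> i) * (y \<bullet> j)) \<partial>lborel)" by simp
  finally show ?thesis using False by simp
qed

text \<open>The moment matrix of a radial weight is a multiple \<open>s\<close> of the identity, and
  its trace is the integral of \<open>g (norm y) * (norm y)\<^sup>2\<close>; the factor
  \<open>1 / DIM('a)\<close> is this trace spread over the diagonal. The dimensional gains in the
  bias and in the second moment both come from it.\<close>

lemma radial_second_moment:
  fixes g :: "real \<Rightarrow> real" and u v :: "'a::euclidean_space"
  assumes [measurable]: "g \<in> borel_measurable borel"
    and int: "integrable lborel (\<lambda>y::'a. g (norm y) * (norm y)\<^sup>2)"
  shows "integrable lborel (\<lambda>y. g (norm y) * ((y \<bullet> u) * (y \<bullet> v)))"
    and "(\<integral>y. g (norm y) * ((y \<bullet> u) * (y \<bullet> v)) \<partial>lborel)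
      = (u \<bullet> v) / DIM('a) * (\<integral>y. g (norm (y::'a)) * (norm y)\<^sup>2 \<partial>lborel)"
proof -
  have I: "integrable lborel (\<lambda>y. g (norm y) * ((y \<bullet> u) * (y \<bullet> v)))" for u v :: 'a
  proof (rule Bochner_Integration.integrable_bound)
    show "integrable lborel (\<lambda>y::'a. (norm u * norm v) * (g (norm y) * (norm y)\<^sup>2))"
      using int by simp
    have "\<bar>g (norm y)\<bar> * (\<bar>y \<bullet> u\<bar> * \<bar>y \<bullet> v\<bar>) \<le> \<bar>g (norm y)\<bar> * ((norm y * norm u) * (norm y * norm v))" for y
      by (intro mult_left_mono mult_mono Cauchy_Schwarz_ineq2) auto
    then show "AE y in lborel. norm (g (norm y) * ((y \<bullet> u) * (y \<bullet> v)))
        \<le> norm ((norm u * norm v) * (g (norm y) * (norm y)\<^sup>2))"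
      by (simp add: abs_mult power2_eq_square mult_ac)
  qed measurable
  show "integrable lborel (\<lambda>y. g (norm y) * ((y \<bullet> u) * (y \<bullet> v)))" by (rule I)
  obtain k :: 'a where k: "k \<in> Basis" using nonempty_Basis by blast
  define s where "s = (\<integral>y. g (norm y) * (y \<bullet> k)\<^sup>2 \<partial>lborel)"
  have s: "(\<integral>y. g (norm (y::'a)) * ((y \<bullet> i) * (y \<bullet> j)) \<partial>lborel) = (if i = j then s else 0)"
    if "i \<in> Basis" "j \<in> Basis" for i j
    unfolding s_def using radial_second_moment_Basis[OF assms(1) that k] by simp
  have "(\<integral>y. g (norm (y::'a)) * (norm y)\<^sup>2 \<partial>lborel) = (\<integral>y. (\<Sum>i\<in>Basis. g (norm (y::'a)) * ((y \<bullet> i) * (y \<bullet> i))) \<partial>lborel)"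
    by (subst norm_eq_sum_coords) (simp add: sum_distrib_left power2_eq_square)
  also have "\<dots> = (\<Sum>i\<in>Basis. (\<integral>y. g (norm (y::'a)) * ((y \<bullet> i) * (y \<bullet> i)) \<partial>lborel))"
    by (rule Bochner_Integration.integral_sum) (rule I)
  also have "\<dots> = DIM('a) * s" by (simp add: s)
  finally have N: "(\<integral>y. g (norm (y::'a)) * (norm y)\<^sup>2 \<partial>lborel) = DIM('a) * s" .
  have "(\<integral>y. g (norm y) * ((y \<bullet> u) * (y \<bullet> v)) \<partial>lborel)
      = (\<integral>y. (\<Sum>i\<in>Basis. \<Sum>j\<in>Basis. (u \<bullet> i) * (v \<bullet> j) * (g (norm y) * ((y \<bullet> i) * (y \<bullet> j)))) \<partial>lborel)"
  proof (intro Bochner_Integration.integral_cong refl)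
    fix y :: 'a
    have "(y \<bullet> u) * (y \<bullet> v) = (\<Sum>i\<in>Basis. (y \<bullet> i) * (u \<bullet> i)) * (\<Sum>j\<in>Basis. (y \<bullet> j) * (v \<bullet> j))"
      by (simp add: euclidean_inner[of y u] euclidean_inner[of y v])
    also have "\<dots> = (\<Sum>i\<in>Basis. \<Sum>j\<in>Basis. ((y \<bullet> i) * (u \<bullet> i)) * ((y \<bullet> j) * (v \<bullet> j)))"
      by (rule sum_product)
    finally show "g (norm y) * ((y \<bullet> u) * (y \<bullet> v))
      = (\<Sum>i\<in>Basis. \<Sum>j\<in>Basis. (u \<bullet> i) * (v \<bullet> j) * (g (norm y) * ((y \<bullet> i) * (y \<bullet> j))))"
      by (simp only: sum_distrib_left) (simp add: mult_ac)
  qed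
  also have "\<dots> = (\<Sum>i\<in>Basis. \<Sum>j\<in>Basis. (u \<bullet> i) * (v \<bullet> j) * (\<integral>y. g (norm (y::'a)) * ((y \<bullet> i) * (y \<bullet> j)) \<partial>lborel))"
    by (subst Bochner_Integration.integral_sum, intro Bochner_Integration.integrable_sum integrable_mult_right I,
        intro sum.cong refl, subst Bochner_Integration.integral_sum, intro integrable_mult_right I) simp
  also have "\<dots> = (\<Sum>i\<in>Basis. \<Sum>j\<in>Basis. if i = j then (u \<bullet> i) * (v \<bullet> j) * s else 0)"
    by (intro sum.cong refl) (simp add: s)
  also have "\<dots> = (u \<bullet> v) * s"
    by (simp add: euclidean_inner[of u v] sum_distrib_right)
  finally show "(\<integral>y. g (norm y) * ((y \<bullet> u) * (y \<bullet> v)) \<partial>lborel)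
      = (u \<bullet> v) / DIM('a) * (\<integral>y. g (norm (y::'a)) * (norm y)\<^sup>2 \<partial>lborel)"
    unfolding N by simp
qed

text \<open>Dilation multiplies the mass of a ball by the same power of \<open>R\<close> for every
  function \<open>G\<close> of the direction alone. So the radius has the same law however
  directions are weighted, which is what \<open>nn_integral_polar\<close> exploits.\<close>

lemma nn_integral_lborel_ball_scale:
  fixes G :: "'a::euclidean_space \<Rightarrow> ennreal"
  assumes [measurable]: "G \<in> borel_measurable borel" and R: "R > 0"
    and hom: "\<And>c x. c > 0 \<Longrightarrow> G (c *\<^sub>R x) = G x"
  shows "(\<integral>\<^sup>+x. G x * indicator (ball 0 R) x \<partial>lborel)
    = ennreal (R ^ DIM('a)) * (\<integral>\<^sup>+x. G x * indicator (ball 0 1) x \<partial>lborel)"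
proof -
  have "(\<integral>\<^sup>+x. G x * indicator (ball 0 R) x \<partial>lborel)
      = (\<integral>\<^sup>+x. G x * indicator (ball 0 R) x
          \<partial>density (distr lborel borel (\<lambda>x. 0 + R *\<^sub>R x)) (\<lambda>_. \<bar>R\<bar> ^ DIM('a)))"
    using R lborel_affine[of R "0::'a"] by simp
  also have "\<dots> = (\<integral>\<^sup>+x. ennreal (\<bar>R\<bar> ^ DIM('a)) * (G x * indicator (ball 0 R) x)
          \<partial>distr lborel borel (\<lambda>x. 0 + R *\<^sub>R x))"
    by (rule nn_integral_density) (measurable, simp)
  also have "\<dots> = (\<integral>\<^sup>+x. ennreal (\<bar>R\<bar> ^ DIM('a)) * (G (0 + R *\<^sub>R x) * indicator (ball 0 R) (0 + R *\<^sub>R x)) \<partial>lborel)"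
    by (rule nn_integral_distr) (measurable, simp)
  also have "\<dots> = (\<integral>\<^sup>+x. ennreal (R ^ DIM('a)) * (G x * indicator (ball 0 1) x) \<partial>lborel)"
    using R by (intro nn_integral_cong) (auto simp: hom indicator_def)
  also have "\<dots> = ennreal (R ^ DIM('a)) * (\<integral>\<^sup>+x. G x * indicator (ball 0 1) x \<partial>lborel)"
    by (rule nn_integral_cmult) (measurable, simp)
  finally show ?thesis .
qed

text \<open>Polar integration without surface measure. Lebesgue measure and the measure with density
  \<open>F (sgn x)\<close> give proportional masses to all balls around 0, so their images under
  \<open>norm\<close> are proportional. Each image is scaled by the other's mass of the unit ball,
  which avoids quotients in \<open>ennreal\<close>.\<close>

lemma nn_integral_polar:
  fixes F :: "'a::euclidean_space \<Rightarrow> ennreal" and w :: "real \<Rightarrow> ennreal"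
  assumes [measurable]: "F \<in> borel_measurable borel" "w \<in> borel_measurable borel"
    and fin: "(\<integral>\<^sup>+x. F (sgn x) * indicator (ball 0 1) x \<partial>lborel) < \<infinity>"
  shows "(\<integral>\<^sup>+x. w (norm x) * F (sgn x) \<partial>lborel) * emeasure lborel (ball (0::'a) 1)
    = (\<integral>\<^sup>+x. w (norm (x::'a)) \<partial>lborel) * (\<integral>\<^sup>+x. F (sgn x) * indicator (ball 0 1) x \<partial>lborel)"
proof -
  let ?c = "\<integral>\<^sup>+x. F (sgn x) * indicator (ball 0 1) x \<partial>lborel"
  let ?v = "emeasure lborel (ball (0::'a) 1)"
  define M where "M = scale_measure ?v (distr (density lborel (\<lambda>x. F (sgn x))) borel (norm :: 'a \<Rightarrow> real))"
  define N where "N = scale_measure ?c (distr lborel borel (norm :: 'a \<Rightarrow> real))"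
  have hom: "F (sgn (c *\<^sub>R x)) = F (sgn x)" if "c > 0" for c x using that by (simp add: sgn_scaleR)
  have v: "?v < \<infinity>" by (rule emeasure_lborel_ball_finite)
  have eM: "emeasure M {..<R} = ?v * (ennreal (R ^ DIM('a)) * ?c)" if "R > 0" for R
  proof -
    have "norm -` {..<R} = ball (0::'a) R" by auto
    then show ?thesis unfolding M_def
      using nn_integral_lborel_ball_scale[of "\<lambda>x. F (sgn x)" R] that hom
      by (simp add: emeasure_distr emeasure_density)
  qed
  have eN: "emeasure N {..<R} = ?c * (ennreal (R ^ DIM('a)) * ?v)" if "R > 0" for R
  proof -
    have "norm -` {..<R} = ball (0::'a) R" by auto
    then show ?thesis unfolding N_def
      using nn_integral_lborel_ball_scale[of "\<lambda>x::'a. 1" R] that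
      by (simp add: emeasure_distr)
  qed
  have sets_borel_Iio: "sets (borel :: real measure) = sigma_sets UNIV (range lessThan)"
    by (subst borel_Iio) (rule sets_measure_of, simp)
  have "M = N"
  proof (rule measure_eqI_generator_eq[where E="range lessThan" and \<Omega>=UNIV and A="\<lambda>i. {..<real (Suc i)}"])
    show "Int_stable (range (lessThan :: real \<Rightarrow> _))"
      unfolding Int_stable_def
    proof safe
      fix a b :: real
      have "{..<a} \<inter> {..<b} = {..<min a b}" by auto
      then show "{..<a} \<inter> {..<b} \<in> range lessThan" by blast
    qed
    show "emeasure M A = emeasure N A" if A: "A \<in> range lessThan" for A
    proof -
      obtain R where R: "A = {..<R}" using A by auto
      show ?thesis
      proof (cases "R > 0")
        case True then show ?thesis unfolding R by (simp add: eM eN mult_ac)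
      next
        case False
        have "\<not> norm x < R" for x :: 'a using norm_ge_zero[of x] False by linarith
        then have "norm -` {..<R} = ({} :: 'a set)" by auto
        then show ?thesis unfolding R M_def N_def by (simp add: emeasure_distr)
      qed
    qed
    show "sets M = sigma_sets UNIV (range lessThan)" "sets N = sigma_sets UNIV (range lessThan)"
      unfolding M_def N_def using sets_borel_Iio by simp_all
    show "(\<Union>i. {..<real (Suc i)}) = UNIV"
    proof safe
      fix t :: real
      obtain i where "t < real i" using reals_Archimedean2 by blast
      then show "t \<in> (\<Union>i. {..<real (Suc i)})" by (auto intro!: exI[of _ i])
    qed simp
    show "emeasure M {..<real (Suc i)} \<noteq> \<infinity>" for i
      using v fin by (subst eM) (auto simp: ennreal_mult_eq_top_iff)
  qed auto
  then have "(\<integral>\<^sup>+t. w t \<partial>M) = (\<integral>\<^sup>+t. w t \<partial>N)" by simp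
  then show ?thesis unfolding M_def N_def
    by (simp add: nn_integral_scale_measure nn_integral_distr nn_integral_density mult_ac)
qed

section \<open>Rotations of pairs of points\<close>

lemma nn_integral_lborel_translate:
  fixes f :: "'a::euclidean_space \<Rightarrow> ennreal"
  assumes "f \<in> borel_measurable borel"
  shows "(\<integral>\<^sup>+x. f (x + t) \<partial>lborel) = (\<integral>\<^sup>+x. f x \<partial>lborel)"
proof (rule nn_integral_lborel_distr_eq)
  show "distr lborel borel (\<lambda>x. x + t) = (lborel :: 'a measure)"
    using lborel_affine[of 1 t] by (simp add: density_1 add.commute)
qed (use assms in measurable)

text \<open>For a fixed second component a shear is a translation of the first, so Fubini reduces
  the claim to translation invariance.\<close>

lemma shear_left_nn_integral:
  fixes f :: "'a::euclidean_space \<times> 'a \<Rightarrow> ennreal"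
  assumes f: "f \<in> borel_measurable borel"
  shows "(\<integral>\<^sup>+p. f (fst p + a *\<^sub>R snd p, snd p) \<partial>lborel) = (\<integral>\<^sup>+p. f p \<partial>lborel)"
proof -
  have [measurable]: "f \<in> borel_measurable (borel \<Otimes>\<^sub>M borel)" using f by (simp add: borel_prod)
  have "(\<lambda>p. f (fst p + a *\<^sub>R snd p, snd p)) \<in> borel_measurable borel"
    by (intro measurable_compose[OF _ f] borel_measurable_continuous_onI continuous_intros)
  then have [measurable]: "(\<lambda>p. f (fst p + a *\<^sub>R snd p, snd p)) \<in> borel_measurable (lborel \<Otimes>\<^sub>M lborel)"
    by (simp add: lborel_prod)
  have "(\<integral>\<^sup>+p. f (fst p + a *\<^sub>R snd p, snd p) \<partial>(lborel \<Otimes>\<^sub>M lborel))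
      = (\<integral>\<^sup>+y. \<integral>\<^sup>+x. f (x + a *\<^sub>R y, y) \<partial>lborel \<partial>lborel)"
    by (subst lborel_pair.nn_integral_snd[symmetric]) (simp_all del: borel_prod)
  also have "\<dots> = (\<integral>\<^sup>+y. \<integral>\<^sup>+x. f (x, y) \<partial>lborel \<partial>lborel)"
    by (intro nn_integral_cong nn_integral_lborel_translate[where f="\<lambda>x. f (x, _)"]) measurable
  also have "\<dots> = (\<integral>\<^sup>+p. f p \<partial>(lborel \<Otimes>\<^sub>M lborel))"
    by (subst lborel_pair.nn_integral_snd[symmetric]) (simp_all add: lborel_prod f)
  finally show ?thesis by (simp add: lborel_prod)
qed

lemma shear_right_nn_integral:
  fixes f :: "'a::euclidean_space \<times> 'a \<Rightarrow> ennreal"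
  assumes f: "f \<in> borel_measurable borel"
  shows "(\<integral>\<^sup>+p. f (fst p, snd p + a *\<^sub>R fst p) \<partial>lborel) = (\<integral>\<^sup>+p. f p \<partial>lborel)"
proof -
  have [measurable]: "f \<in> borel_measurable (borel \<Otimes>\<^sub>M borel)" using f by (simp add: borel_prod)
  have "(\<lambda>p. f (fst p, snd p + a *\<^sub>R fst p)) \<in> borel_measurable borel"
    by (intro measurable_compose[OF _ f] borel_measurable_continuous_onI continuous_intros)
  then have [measurable]: "(\<lambda>p. f (fst p, snd p + a *\<^sub>R fst p)) \<in> borel_measurable (lborel \<Otimes>\<^sub>M lborel)"
    by (simp add: lborel_prod)
  have "(\<integral>\<^sup>+p. f (fst p, snd p + a *\<^sub>R fst p) \<partial>(lborel \<Otimes>\<^sub>M lborel))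
      = (\<integral>\<^sup>+x. \<integral>\<^sup>+y. f (x, y + a *\<^sub>R x) \<partial>lborel \<partial>lborel)"
    by (subst lborel.nn_integral_fst[symmetric]) (simp_all del: borel_prod)
  also have "\<dots> = (\<integral>\<^sup>+x. \<integral>\<^sup>+y. f (x, y) \<partial>lborel \<partial>lborel)"
    by (intro nn_integral_cong nn_integral_lborel_translate[where f="\<lambda>y. f (_, y)"]) measurable
  also have "\<dots> = (\<integral>\<^sup>+p. f p \<partial>(lborel \<Otimes>\<^sub>M lborel))"
    by (subst lborel.nn_integral_fst[symmetric]) (simp_all add: lborel_prod f)
  finally show ?thesis by (simp add: lborel_prod)
qed

text \<open>For \<open>c\<close> and \<open>s\<close> the cosine and sine of an angle this turns
  each plane spanned by corresponding coordinates of the two components by that same angle.\<close>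

definition rot :: "real \<Rightarrow> real \<Rightarrow> 'a::real_vector \<times> 'a \<Rightarrow> 'a \<times> 'a" where
  "rot c s p = (c *\<^sub>R fst p + s *\<^sub>R snd p, c *\<^sub>R snd p - s *\<^sub>R fst p)"

lemma measurable_rot [measurable]: "rot c s \<in> borel_measurable (borel :: ('a::euclidean_space \<times> 'a) measure)"
  unfolding rot_def by (intro borel_measurable_continuous_onI continuous_intros)

lemma norm_rot:
  fixes p :: "'a::euclidean_space \<times> 'a"
  assumes "c\<^sup>2 + s\<^sup>2 = 1"
  shows "norm (rot c s p) = norm p"
proof -
  obtain x y where p: "p = (x, y)" by (cases p)
  have "(norm (rot c s p))\<^sup>2 = (c\<^sup>2 + s\<^sup>2) * (x \<bullet> x) + (c\<^sup>2 + s\<^sup>2) * (y \<bullet> y)"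
    unfolding power2_norm_eq_inner p rot_def
    by (simp add: inner_Pair algebra_simps inner_commute power2_eq_square)
  also have "\<dots> = (norm p)\<^sup>2"
    unfolding power2_norm_eq_inner p assms by (simp add: inner_Pair)
  finally show ?thesis by simp
qed

text \<open>A rotation by theta is the product of three shears with factors tan (theta / 2), - sin
  theta and tan (theta / 2). The half turn \<open>c = -1\<close> is excluded because the tangent
  \<open>s / (1 + c)\<close> is infinite there.\<close>

lemma distr_rot:
  assumes cs: "c\<^sup>2 + s\<^sup>2 = 1" "c \<noteq> -1"
  shows "distr lborel borel (rot c s) = (lborel :: ('a::euclidean_space \<times> 'a) measure)"
proof (rule measure_eqI)
  fix A :: "('a \<times> 'a) set" assume "A \<in> sets (distr lborel borel (rot c s))"
  then have [measurable]: "A \<in> sets borel" by simp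
  define t where "t = s / (1 + c)"
  have c1: "1 + c \<noteq> 0" using cs(2) by linarith
  have t1: "t * (1 + c) = s" using c1 by (simp add: t_def)
  have s2: "s * s = (1 - c) * (1 + c)" using cs(1) by (simp add: power2_eq_square algebra_simps)
  have t2: "t * s = 1 - c" unfolding t_def using s2 c1 by (simp add: field_simps)
  define f :: "'a \<times> 'a \<Rightarrow> ennreal" where "f = indicator A"
  have [measurable]: "f \<in> borel_measurable borel" unfolding f_def by measurable
  define S where "S = (\<lambda>p::'a \<times> 'a. (fst p + t *\<^sub>R snd p, snd p))"
  define T where "T = (\<lambda>p::'a \<times> 'a. (fst p, snd p + (-s) *\<^sub>R fst p))"
  have [measurable]: "S \<in> borel_measurable borel" "T \<in> borel_measurable borel"
    unfolding S_def T_def by (intro borel_measurable_continuous_onI continuous_intros)+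
  have rot: "rot c s p = S (T (S p))" for p
  proof -
    obtain x y where p: "p = (x, y)" by (cases p)
    have t2y: "(t * 2) *\<^sub>R y = t *\<^sub>R y + t *\<^sub>R y" by (simp flip: scaleR_left_distrib)
    have "S (T (S p)) = ((1 - t * s) *\<^sub>R x + (t + t * (1 - t * s)) *\<^sub>R y, (1 - t * s) *\<^sub>R y - s *\<^sub>R x)"
      unfolding S_def T_def p using t2y by (simp add: scaleR_left_distrib scaleR_right_distrib scaleR_left_diff_distrib scaleR_right_diff_distrib right_diff_distrib mult_ac)
    also have "\<dots> = rot c s p" unfolding t2 using t1 by (simp add: rot_def p algebra_simps)
    finally show ?thesis by simp
  qed
  have m1: "(\<lambda>p. f (S (T p))) \<in> borel_measurable borel" and m2: "(\<lambda>p. f (S p)) \<in> borel_measurable borel"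
    by measurable
  have "emeasure (distr lborel borel (rot c s)) A = (\<integral>\<^sup>+p. f (rot c s p) \<partial>lborel)"
    unfolding f_def by (subst nn_integral_indicator[symmetric], simp, subst nn_integral_distr) auto
  also have "\<dots> = (\<integral>\<^sup>+p. f (S (T (S p))) \<partial>lborel)" by (simp only: rot)
  also have "\<dots> = (\<integral>\<^sup>+p. f (S (T p)) \<partial>lborel)"
    using shear_left_nn_integral[OF m1, of t] by (simp add: S_def)
  also have "\<dots> = (\<integral>\<^sup>+p. f (S p) \<partial>lborel)"
    using shear_right_nn_integral[OF m2, of "-s"] by (simp add: T_def)
  also have "\<dots> = (\<integral>\<^sup>+p. f p \<partial>lborel)"
    using shear_left_nn_integral[of "\<lambda>p. f p" t] by (simp add: S_def)
  also have "\<dots> = emeasure lborel A" unfolding f_def by simp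
  finally show "emeasure (distr lborel borel (rot c s)) A = emeasure lborel A" .
qed simp

section \<open>The uniform distribution on the unit ball and its behaviour under rotations\<close>

abbreviation unif_ball :: "'a::euclidean_space measure" where
  "unif_ball \<equiv> uniform_measure lborel (ball 0 1)"

lemma emeasure_unit_ball:
  "emeasure lborel (ball (0::'a::euclidean_space) 1) \<noteq> 0" "emeasure lborel (ball (0::'a::euclidean_space) 1) \<noteq> \<infinity>"
proof -
  show "emeasure lborel (ball (0::'a) 1) \<noteq> \<infinity>" using emeasure_lborel_ball_finite[of "0::'a" 1] by simp
  have "measure lborel (ball (0::'a) 1) > 0" using content_ball_pos[of 1 "0::'a"] by simp
  then show "emeasure lborel (ball (0::'a) 1) \<noteq> 0" by (auto simp: measure_def)
qed

lemma integral_uniform_measure: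
  fixes f :: "'a \<Rightarrow> real"
  assumes [measurable]: "f \<in> borel_measurable M" "A \<in> sets M" and A: "emeasure M A \<noteq> 0" "emeasure M A \<noteq> \<infinity>"
  shows "(\<integral>x. f x \<partial>uniform_measure M A) = (\<integral>x. indicator A x * f x \<partial>M) / measure M A"
proof -
  have e: "emeasure M A = ennreal (measure M A)" using A(2) by (intro emeasure_eq_ennreal_measure) auto
  then have v: "measure M A > 0" using A(1) by (metis ennreal_0 less_eq_real_def measure_nonneg)
  have "indicator A x / emeasure M A = ennreal (indicator A x / measure M A)" for x
    unfolding e using v by (auto simp: indicator_def divide_ennreal[symmetric])
  then have "(\<integral>x. f x \<partial>uniform_measure M A) = (\<integral>x. (indicator A x / measure M A) * f x \<partial>M)"
    unfolding uniform_measure_def by (simp, subst integral_density) (auto simp: indicator_def)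
  then show ?thesis by simp
qed

lemma integrable_indicator_unit_ball: "integrable lborel (indicator (ball (0::'a::euclidean_space) 1) :: 'a \<Rightarrow> real)"
  using emeasure_lborel_ball_finite[of "0::'a" 1] by (intro integrable_real_indicator) auto

lemma prob_space_unif_ball: "prob_space (unif_ball :: 'a::euclidean_space measure)"
  by (rule prob_space_uniform_measure) (use emeasure_unit_ball in auto)

lemma AE_unif_ballI:
  assumes "AE x in lborel. norm x < 1 \<longrightarrow> Q x"
  shows "AE x in (unif_ball :: 'a::euclidean_space measure). Q x"
  by (rule AE_uniform_measureI) (use assms in auto)

lemma distr_unif_ball:
  fixes T :: "'a::euclidean_space \<Rightarrow> 'a"
  assumes T: "distr lborel borel T = lborel" and [measurable]: "T \<in> borel_measurable borel"
    and n: "\<And>x. norm (T x) = norm x"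
  shows "distr unif_ball borel T = unif_ball"
proof (rule measure_eqI)
  fix A assume "A \<in> sets (distr unif_ball borel T)"
  then have [measurable]: "A \<in> sets borel" by simp
  have [simp]: "T -` A \<in> sets borel" by (rule measurable_sets_borel[of T borel]) measurable
  have "emeasure (distr unif_ball borel T) A = emeasure lborel (ball 0 1 \<inter> T -` A) / emeasure lborel (ball (0::'a) 1)"
    by (subst emeasure_distr) auto
  also have "ball 0 1 \<inter> T -` A = T -` (ball 0 1 \<inter> A)" using n by auto
  also have "emeasure lborel (T -` (ball 0 1 \<inter> A)) = emeasure (distr lborel borel T) (ball 0 1 \<inter> A)"
    by (subst emeasure_distr) auto
  finally show "emeasure (distr unif_ball borel T) A = emeasure unif_ball A"
    unfolding T by simp
qed simp

lemma distr_unif_ball_rot: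
  assumes cs: "c\<^sup>2 + s\<^sup>2 = 1" "c \<noteq> -1"
  shows "distr unif_ball borel (rot c s) = (unif_ball :: ('a::euclidean_space \<times> 'a) measure)"
  using cs by (intro distr_unif_ball distr_rot norm_rot measurable_rot)

lemma AE_lborel_nonzero: "AE x in (lborel :: 'a::euclidean_space measure). x \<noteq> 0"
  by (rule AE_I[where N="{0}"]) auto

text \<open>To first order the curve \<open>cos t *\<^sub>R x + sin t *\<^sub>R y\<close> leaves
  \<open>x\<close> in direction \<open>y\<close>, so \<open>m\<close> times the increment over the
  angle \<open>pi / m\<close> tends to \<open>pi\<close> times a directional derivative. One vector
  \<open>v\<close> serves all \<open>y\<close>, which later makes the squared limit a quadratic form
  in \<open>y\<close>.\<close>

lemma rotation_difference_quotient:
  fixes H :: "'a::euclidean_space \<Rightarrow> real"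
  assumes diff: "H differentiable (at x)" and lip: "\<And>x y. \<bar>H x - H y\<bar> \<le> C * norm (x - y)" and C: "C \<ge> 0"
  obtains v where "norm v \<le> C"
    "\<And>y. (\<lambda>m. real m * (H (cos (pi / m) *\<^sub>R x + sin (pi / m) *\<^sub>R y) - H x)) \<longlonglongrightarrow> pi * (y \<bullet> v)"
proof -
  obtain D where D: "(H has_derivative D) (at x)" using diff by (auto simp: differentiable_def)
  have linD: "linear D" using D has_derivative_linear by blast
  define v where "v = (\<Sum>b\<in>Basis. D b *\<^sub>R b)"
  have Dv: "D y = y \<bullet> v" for y
    unfolding v_def by (rule linear_functional_inner[OF linD])
  have bd: "\<bar>D y\<bar> \<le> C * norm y" for y
  proof -
    have "((\<lambda>t. H (x + t *\<^sub>R y)) has_field_derivative D y) (at 0)"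
      by (rule has_derivative_along_line[OF D])
    then have "((\<lambda>t. (H (x + t *\<^sub>R y) - H x) / t) \<longlongrightarrow> D y) (at 0)"
      by (simp add: DERIV_def)
    then have "((\<lambda>t. \<bar>(H (x + t *\<^sub>R y) - H x) / t\<bar>) \<longlongrightarrow> \<bar>D y\<bar>) (at 0)" by (rule tendsto_rabs)
    moreover have "\<forall>\<^sub>F t in at 0. \<bar>(H (x + t *\<^sub>R y) - H x) / t\<bar> \<le> C * norm y"
      unfolding eventually_at_filter abs_divide
    proof (rule always_eventually)
      show "\<forall>t. t \<noteq> 0 \<longrightarrow> t \<in> UNIV \<longrightarrow> \<bar>H (x + t *\<^sub>R y) - H x\<bar> / \<bar>t\<bar> \<le> C * norm y"
      proof (intro allI impI)
        fix t :: real assume "t \<noteq> 0"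
        then show "\<bar>H (x + t *\<^sub>R y) - H x\<bar> / \<bar>t\<bar> \<le> C * norm y"
          using lip[of "x + t *\<^sub>R y" x] by (simp add: divide_le_eq mult_ac)
      qed
    qed
    ultimately show ?thesis by (rule tendsto_upperbound) simp
  qed
  have nv: "norm v \<le> C"
  proof (cases "v = 0")
    case False
    \<comment> \<open>The bound on the functional is tested on \<open>v\<close> itself, where its
      value is \<open>(norm v)\<^sup>2\<close>.\<close>
    have "norm v * norm v \<le> C * norm v" using bd[of v] by (simp add: Dv dot_square_norm power2_eq_square)
    then show ?thesis using False by simp
  qed (use C in simp)
  have "(\<lambda>m. real m * (H (cos (pi / m) *\<^sub>R x + sin (pi / m) *\<^sub>R y) - H x)) \<longlonglongrightarrow> pi * (y \<bullet> v)" for y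
  proof -
    let ?q = "\<lambda>t. H (cos t *\<^sub>R x + sin t *\<^sub>R y)"
    have "((\<lambda>t. cos t *\<^sub>R x + sin t *\<^sub>R y) has_derivative (\<lambda>t. t *\<^sub>R y)) (at 0)"
      by (auto intro!: derivative_eq_intros simp: fun_eq_iff)
    then have "(?q has_derivative (\<lambda>t. D (t *\<^sub>R y))) (at 0)"
      by (rule has_derivative_compose) (simp add: D)
    then have "(?q has_field_derivative D y) (at 0)"
      by (simp add: has_field_derivative_def linear_scale[OF linD] mult.commute[of _ "D y"])
    then have "((\<lambda>t. (?q t - H x) / t) \<longlongrightarrow> D y) (at 0)"
      by (simp add: DERIV_def)
    moreover have "filterlim (\<lambda>m. pi / real m) (at 0) sequentially"
    proof (rule filterlim_atI)
      show "(\<lambda>m. pi / real m) \<longlonglongrightarrow> 0" by (rule lim_const_over_n)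
      show "\<forall>\<^sub>F m in sequentially. pi / real m \<noteq> 0"
        using eventually_gt_at_top[of 0] by eventually_elim simp
    qed
    ultimately have "(\<lambda>m. (?q (pi / real m) - H x) / (pi / real m)) \<longlonglongrightarrow> D y"
      by (rule filterlim_compose)
    then have "(\<lambda>m. pi * ((?q (pi / real m) - H x) / (pi / real m))) \<longlonglongrightarrow> pi * D y"
      by (rule tendsto_mult_left)
    then show ?thesis by (simp add: Dv mult.commute)
  qed
  with nv show ?thesis by (rule that)
qed

lemma rot_compose: "rot (cos a) (sin a) (rot (cos b) (sin b) p) = rot (cos (a + b)) (sin (a + b)) p"
  by (simp add: rot_def cos_add sin_add algebra_simps)

lemma AE_unif_ball_fst_nonzero:
  "AE p in (unif_ball :: ('a::euclidean_space \<times> 'b::euclidean_space) measure). fst p \<noteq> 0 \<and> norm p < 1"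
proof (rule AE_unif_ballI)
  obtain b :: 'a where b: "b \<in> Basis" using nonempty_Basis by blast
  then have "(b, 0::'b) \<in> Basis" by (simp add: Basis_prod_def)
  from AE_lborel_inner_neq[OF this, of 0] show "AE p in lborel. norm p < 1 \<longrightarrow> fst p \<noteq> (0::'a) \<and> norm (p :: 'a \<times> 'b) < 1"
    by eventually_elim (auto simp: inner_prod_def)
qed

lemma integrable_unif_ball_bounded:
  fixes f :: "'a::euclidean_space \<Rightarrow> real"
  assumes "f \<in> borel_measurable borel" "\<And>x. norm x < 1 \<Longrightarrow> \<bar>f x\<bar> \<le> B"
  shows "integrable unif_ball f"
proof -
  interpret prob_space "unif_ball :: 'a measure" by (rule prob_space_unif_ball)
  show ?thesis
    by (rule integrable_const_bound[where B=B]) (use assms in \<open>auto intro!: AE_unif_ballI\<close>)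
qed

lemma integral_unif_ball_rot:
  fixes f :: "'a::euclidean_space \<times> 'a \<Rightarrow> real"
  assumes "c\<^sup>2 + s\<^sup>2 = 1" "c \<noteq> -1" "f \<in> borel_measurable borel"
  shows "(\<integral>p. f (rot c s p) \<partial>unif_ball) = (\<integral>p. f p \<partial>unif_ball)"
proof -
  have "distr unif_ball borel (rot c s) = (unif_ball :: ('a \<times> 'a) measure)"
    by (rule distr_unif_ball_rot) (fact assms)+
  then show ?thesis using integral_distr[of "rot c s" unif_ball borel f] assms(3) by simp
qed

lemma lipschitz_imp_borel_measurable:
  fixes H :: "'a::euclidean_space \<Rightarrow> real"
  assumes "\<And>x y. \<bar>H x - H y\<bar> \<le> C * norm (x - y)" "C \<ge> 0"
  shows "H \<in> borel_measurable borel"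
proof (rule borel_measurable_continuous_onI)
  have "C-lipschitz_on UNIV H" using assms by (intro lipschitz_onI) (auto simp: dist_norm)
  then show "continuous_on UNIV H" by (rule lipschitz_on_continuous_on)
qed

text \<open>An odd function changes sign along the half turn of the pair \<open>(x, y)\<close>; the half turn is cut into
  \<open>m\<close> equal rotations, each of which preserves the uniform distribution.\<close>

lemma odd_function_rotation_bound:
  fixes H :: "'a::euclidean_space \<Rightarrow> real"
  assumes odd: "\<And>x. H (- x) = - H x"
    and lip: "\<And>x y. \<bar>H x - H y\<bar> \<le> C * norm (x - y)" and C: "C \<ge> 0" and m: "m \<ge> 1"
  shows "4 * (\<integral>p. (H (fst (p :: 'a \<times> 'a)))\<^sup>2 \<partial>unif_ball)
    \<le> (\<integral>p. (real m * (H (cos (pi / m) *\<^sub>R fst p + sin (pi / m) *\<^sub>R snd p) - H (fst p)))\<^sup>2 \<partial>unif_ball)"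
proof -
  define \<theta> where "\<theta> = pi / m"
  define R where "R = (\<lambda>j. rot (cos (real j * \<theta>)) (sin (real j * \<theta>)) :: 'a \<times> 'a \<Rightarrow> _)"
  define d where "d = (\<lambda>p. H (fst (R 1 p)) - H (fst p))"
  have [measurable]: "H \<in> borel_measurable borel" by (rule lipschitz_imp_borel_measurable[OF lip C])
  have R_meas [measurable]: "R j \<in> borel_measurable borel" for j unfolding R_def by measurable
  have fst_meas [measurable]: "fst \<in> borel_measurable (borel :: ('a \<times> 'a) measure)"
    by (intro borel_measurable_continuous_onI continuous_intros)
  have [measurable]: "d \<in> borel_measurable borel" unfolding d_def by measurable
  have H0: "H 0 = 0" using odd[of 0] by simp
  have Hb: "\<bar>H x\<bar> \<le> C * norm x" for x using lip[of x 0] H0 by simp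
  have fstn: "norm (fst p) \<le> norm p" for p :: "'a \<times> 'a" using norm_fst_le[of "fst p" "snd p"] by simp
  have Hfb: "\<bar>H (fst p)\<bar> \<le> C" if "norm p < 1" for p :: "'a \<times> 'a"
  proof -
    have "\<bar>H (fst p)\<bar> \<le> C * norm (fst p)" by (rule Hb)
    also have "\<dots> \<le> C * 1" using C that fstn[of p] by (intro mult_left_mono) auto
    finally show ?thesis by simp
  qed
  have Rn: "norm (R j p) = norm p" for j p unfolding R_def by (rule norm_rot) simp
  have db: "\<bar>d p\<bar> \<le> 2 * C" if "norm p < 1" for p :: "'a \<times> 'a"
    using Hfb[OF that] Hfb[of "R 1 p"] that unfolding d_def Rn by linarith
  have R1: "R 1 (R j p) = R (Suc j) p" for j p
    unfolding R_def using rot_compose[of "1 * \<theta>" "real j * \<theta>" p] by (simp add: algebra_simps)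
  have dj: "d (R j p) = H (fst (R (Suc j) p)) - H (fst (R j p))" for j p unfolding d_def R1 ..
  have m\<theta>: "real m * \<theta> = pi" using m by (simp add: \<theta>_def)
  have Rm: "H (fst (R m p)) = - H (fst p)" for p
    unfolding R_def m\<theta> by (simp add: rot_def odd)
  have R0: "R 0 p = p" for p unfolding R_def by (simp add: rot_def)
  \<comment> \<open>The \<open>m\<close> increments along the half turn sum to
    \<open>- 2 * H (fst p)\<close>; Cauchy-Schwarz costs a factor \<open>m\<close>.\<close>
  have pw: "4 * (H (fst p))\<^sup>2 \<le> real m * (\<Sum>j<m. (d (R j p))\<^sup>2)" for p
  proof -
    have "(\<Sum>j<m. d (R j p)) = - 2 * H (fst p)"
      unfolding dj using sum_lessThan_telescope[of "\<lambda>j. H (fst (R j p))" m] by (simp add: Rm R0)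
    then have "4 * (H (fst p))\<^sup>2 = (\<Sum>j<m. d (R j p))\<^sup>2" by (simp add: power_mult_distrib)
    also have "\<dots> \<le> (\<Sum>j<m. (d (R j p))\<^sup>2) * card {..<m}" by (rule sum_squared_le_sum_of_squares) 
    finally show ?thesis by (simp add: mult.commute)
  qed
  have int_d: "integrable unif_ball (\<lambda>p. (d (R j p))\<^sup>2)" for j
  proof (rule integrable_unif_ball_bounded[where B="(2 * C)\<^sup>2"])
    show "\<bar>(d (R j p))\<^sup>2\<bar> \<le> (2 * C)\<^sup>2" if "norm p < 1" for p :: "'a \<times> 'a"
      using db[of "R j p"] abs_le_square_iff[of "d (R j p)" "2 * C"] that C by (simp add: Rn)
  qed measurable
  have "4 * (\<integral>p. (H (fst (p :: 'a \<times> 'a)))\<^sup>2 \<partial>unif_ball) = (\<integral>p. 4 * (H (fst (p :: 'a \<times> 'a)))\<^sup>2 \<partial>unif_ball)" by simp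
  also have "\<dots> \<le> (\<integral>p. real m * (\<Sum>j<m. (d (R j p))\<^sup>2) \<partial>unif_ball)"
  proof (rule integral_mono[OF _ _ pw])
    have "integrable unif_ball (\<lambda>p::'a \<times> 'a. (H (fst p))\<^sup>2)"
    proof (rule integrable_unif_ball_bounded[where B="C\<^sup>2"])
      show "\<bar>(H (fst p))\<^sup>2\<bar> \<le> C\<^sup>2" if "norm p < 1" for p :: "'a \<times> 'a"
        using Hfb[OF that] C by (simp add: abs_le_square_iff[symmetric])
    qed measurable
    then show "integrable unif_ball (\<lambda>p::'a \<times> 'a. 4 * (H (fst p))\<^sup>2)" by simp
    show "integrable unif_ball (\<lambda>p. real m * (\<Sum>j<m. (d (R j p))\<^sup>2))"
      by (intro integrable_mult_right Bochner_Integration.integrable_sum int_d)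
  qed
  also have "\<dots> = real m * (\<Sum>j<m. \<integral>p. (d (R j p))\<^sup>2 \<partial>unif_ball)"
    by (simp add: Bochner_Integration.integral_sum int_d)
  also have "\<dots> = real m * (\<Sum>j<m. \<integral>p. (d p)\<^sup>2 \<partial>unif_ball)"
  proof -
    have "(\<integral>p. (d (R j p))\<^sup>2 \<partial>unif_ball) = (\<integral>p. (d p)\<^sup>2 \<partial>unif_ball)" if "j < m" for j
      unfolding R_def
    proof (rule integral_unif_ball_rot)
      \<comment> \<open>For \<open>j < m\<close> the angle stays strictly below \<open>pi\<close>,
        so the half turn that the shear decomposition misses never occurs.\<close>
      have "0 \<le> real j * \<theta>" "real j * \<theta> < pi"
        using that m by (auto simp: \<theta>_def divide_less_eq field_simps)
      then have "cos pi < cos (real j * \<theta>)" by (intro cos_monotone_0_pi) auto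
      then show "cos (real j * \<theta>) \<noteq> - 1" by simp
    qed (simp, measurable)
    then show ?thesis by simp
  qed
  \<comment> \<open>One factor \<open>m\<close> stems from Cauchy-Schwarz, the other from the
    \<open>m\<close> equal summands; together they turn the increment into a difference
    quotient.\<close>
  also have "\<dots> = (\<integral>p. (real m * d p)\<^sup>2 \<partial>unif_ball)"
    by (simp add: power_mult_distrib power2_eq_square[of "real m"])
  finally show ?thesis unfolding d_def R_def \<theta>_def by (simp add: rot_def)
qed

section \<open>A Poincare inequality for odd functions on the sphere\<close>

text \<open>The indicator describes the fibre of the unit ball of pairs over an \<open>x\<close>
  with \<open>a = (norm x)\<^sup>2\<close>. This fibre is a centred ball, so its indicator is a
  radial weight and \<open>radial_second_moment\<close> yields the factor
  \<open>1 / DIM('a)\<close>.\<close>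

lemma radial_square_integral:
  fixes v :: "'a::euclidean_space"
  assumes a: "a > (0::real)"
  shows "(\<integral>\<^sup>+y. ennreal ((pi * (y \<bullet> v))\<^sup>2) * indicator {y. a + (norm y)\<^sup>2 < 1} y \<partial>lborel)
    = ennreal (pi\<^sup>2 * (norm v)\<^sup>2 / DIM('a)) *
      (\<integral>\<^sup>+y. ennreal ((norm y)\<^sup>2) * indicator {y. a + (norm (y::'a))\<^sup>2 < 1} y \<partial>lborel)"
proof -
  define g where "g = (\<lambda>t::real. if a + t\<^sup>2 < 1 then 1 else 0 :: real)"
  have [measurable]: "g \<in> borel_measurable borel" unfolding g_def by measurable
  have gi: "g (norm y) = indicator {y. a + (norm y)\<^sup>2 < 1} y" for y :: 'a
    by (simp add: g_def indicator_def)
  have int: "integrable lborel (\<lambda>y::'a. g (norm y) * (norm y)\<^sup>2)"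
  proof (rule Bochner_Integration.integrable_bound)
    show "integrable lborel (indicator (ball (0::'a) 1) :: 'a \<Rightarrow> real)"
      by (rule integrable_indicator_unit_ball)
    have "g (norm y) * (norm y)\<^sup>2 \<le> indicator (ball 0 1) y" for y :: 'a
    proof (cases "a + (norm y)\<^sup>2 < 1")
      case True
      then have "(norm y)\<^sup>2 < 1\<^sup>2" using a by simp
      then have "norm y < 1" by (rule power2_less_imp_less) simp
      then show ?thesis using True a by (simp add: g_def)
    qed (simp add: g_def)
    then show "AE y in lborel. norm (g (norm (y::'a)) * (norm y)\<^sup>2) \<le> norm (indicator (ball 0 1) y :: real)"
      by (auto simp: g_def)
  qed measurable
  have "(\<integral>\<^sup>+y. ennreal ((pi * (y \<bullet> v))\<^sup>2) * indicator {y. a + (norm y)\<^sup>2 < 1} y \<partial>lborel)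
     = (\<integral>\<^sup>+y. ennreal (pi\<^sup>2) * ennreal (g (norm y) * ((y \<bullet> v) * (y \<bullet> v))) \<partial>lborel)"
    by (intro nn_integral_cong) (auto simp: g_def indicator_def ennreal_mult[symmetric] power2_eq_square mult_ac)
  also have "\<dots> = ennreal (pi\<^sup>2) * (\<integral>\<^sup>+y. ennreal (g (norm y) * ((y \<bullet> v) * (y \<bullet> v))) \<partial>lborel)"
    by (rule nn_integral_cmult) measurable
  also have "(\<integral>\<^sup>+y. ennreal (g (norm y) * ((y \<bullet> v) * (y \<bullet> v))) \<partial>lborel)
      = ennreal (\<integral>y. g (norm y) * ((y \<bullet> v) * (y \<bullet> v)) \<partial>lborel)"
    by (rule nn_integral_eq_integral) (auto simp: g_def intro!: radial_second_moment(1) int[unfolded g_def])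
  also have "(\<integral>y. g (norm y) * ((y \<bullet> v) * (y \<bullet> v)) \<partial>lborel)
      = (norm v)\<^sup>2 / DIM('a) * (\<integral>y. g (norm (y::'a)) * (norm y)\<^sup>2 \<partial>lborel)"
    using radial_second_moment(2)[of g v v] int by (simp add: power2_norm_eq_inner)
  also have "ennreal (pi\<^sup>2) * ennreal \<dots> = ennreal (pi\<^sup>2 * (norm v)\<^sup>2 / DIM('a)) * ennreal (\<integral>y. g (norm (y::'a)) * (norm y)\<^sup>2 \<partial>lborel)"
    by (subst ennreal_mult[symmetric], simp, simp add: g_def, subst ennreal_mult'[symmetric])
       (auto simp: g_def mult_ac)
  also have "ennreal (\<integral>y. g (norm (y::'a)) * (norm y)\<^sup>2 \<partial>lborel) = (\<integral>\<^sup>+y. ennreal (g (norm (y::'a)) * (norm y)\<^sup>2) \<partial>lborel)"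
    by (rule nn_integral_eq_integral[symmetric, OF int]) (auto simp: g_def)
  also have "\<dots> = (\<integral>\<^sup>+y. ennreal ((norm y)\<^sup>2) * indicator {y. a + (norm (y::'a))\<^sup>2 < 1} y \<partial>lborel)"
    by (intro nn_integral_cong) (auto simp: g_def indicator_def)
  finally show ?thesis .
qed

lemma mem_unit_ball_Pair: "(x, y) \<in> ball 0 1 \<longleftrightarrow> (norm x)\<^sup>2 + (norm y)\<^sup>2 < 1"
  for x :: "'a::euclidean_space" and y :: "'b::euclidean_space"
  by (simp add: norm_Pair)

lemma nn_integral_unif_ball_Pair:
  fixes f :: "'a::euclidean_space \<times> 'b::euclidean_space \<Rightarrow> ennreal"
  assumes f: "f \<in> borel_measurable borel"
  shows "(\<integral>\<^sup>+p. f p \<partial>unif_ball) =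
    (\<integral>\<^sup>+x. \<integral>\<^sup>+y. f (x, y) * indicator {y. (norm x)\<^sup>2 + (norm y)\<^sup>2 < 1} y \<partial>lborel \<partial>lborel) / emeasure lborel (ball (0::'a \<times> 'b) 1)"
proof -
  have m: "(\<lambda>p. f p * indicator (ball 0 1) p) \<in> borel_measurable (lborel \<Otimes>\<^sub>M lborel)"
    unfolding lborel_prod
    by (simp, intro borel_measurable_times_ennreal f borel_measurable_indicator) simp
  have "(\<integral>\<^sup>+p. f p \<partial>unif_ball) = (\<integral>\<^sup>+p. f p * indicator (ball 0 1) p \<partial>lborel) / emeasure lborel (ball (0::'a \<times> 'b) 1)"
    by (rule nn_integral_uniform_measure) (use f in auto)
  also have "(\<integral>\<^sup>+p. f p * indicator (ball 0 1) p \<partial>lborel) = (\<integral>\<^sup>+x. \<integral>\<^sup>+y. f (x, y) * indicator (ball 0 1) (x, y) \<partial>lborel \<partial>lborel)"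
    unfolding lborel_prod[symmetric] by (rule lborel.nn_integral_fst[symmetric, OF m])
  also have "\<dots> = (\<integral>\<^sup>+x. \<integral>\<^sup>+y. f (x, y) * indicator {y. (norm x)\<^sup>2 + (norm y)\<^sup>2 < 1} y \<partial>lborel \<partial>lborel)"
    by (intro nn_integral_cong) (simp only: indicator_def mem_unit_ball_Pair mem_Collect_eq)
  finally show ?thesis .
qed

lemma fst_snd_measurable [measurable]:
  "fst \<in> borel_measurable (borel :: ('a::euclidean_space \<times> 'b::euclidean_space) measure)"
  "snd \<in> borel_measurable (borel :: ('a::euclidean_space \<times> 'b::euclidean_space) measure)"
  by (intro borel_measurable_continuous_onI continuous_intros)+

text \<open>The bound for finitely many rotations is passed to the limit by dominated convergence,
  and then \<open>y\<close> is integrated out first. Differentiability is asked only away from 0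
  because \<open>H\<close> will be a degree-one extension from the sphere.\<close>

lemma odd_function_poincare:
  fixes H :: "'a::euclidean_space \<Rightarrow> real"
  assumes odd: "\<And>x. H (- x) = - H x"
    and lip: "\<And>x y. \<bar>H x - H y\<bar> \<le> C * norm (x - y)" and C: "C \<ge> 0"
    and diff: "\<And>x. x \<noteq> 0 \<Longrightarrow> H differentiable (at x)"
  shows "4 * (\<integral>p. (H (fst (p::'a \<times> 'a)))\<^sup>2 \<partial>unif_ball)
    \<le> pi\<^sup>2 * C\<^sup>2 / DIM('a) * (\<integral>p. (norm (fst (p::'a \<times> 'a)))\<^sup>2 \<partial>unif_ball)"
proof -
  let ?B = "unif_ball :: ('a \<times> 'a) measure"
  define G where "G = (\<lambda>m p::'a \<times> 'a.
    (real (Suc m) * (H (cos (pi / Suc m) *\<^sub>R fst p + sin (pi / Suc m) *\<^sub>R snd p) - H (fst p)))\<^sup>2)"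
  \<comment> \<open>Defined as a pointwise limit, \<open>g\<close> is measurable at once; the
    gradient vectors \<open>v\<close> are obtained only point by point.\<close>
  define g where "g = (\<lambda>p. lim (\<lambda>m. G m p))"
  have [measurable]: "H \<in> borel_measurable borel" by (rule lipschitz_imp_borel_measurable[OF lip C])
  have G_meas [measurable]: "G m \<in> borel_measurable borel" for m unfolding G_def by measurable
  have g_meas [measurable]: "g \<in> borel_measurable borel" unfolding g_def by measurable
  have lim: "\<exists>v. norm v \<le> C \<and> (\<forall>y. (\<lambda>m. G m (x, y)) \<longlonglongrightarrow> (pi * (y \<bullet> v))\<^sup>2)" if x: "x \<noteq> 0" for x
  proof -
    obtain v where v: "norm v \<le> C"
      "\<And>y. (\<lambda>m. real m * (H (cos (pi / m) *\<^sub>R x + sin (pi / m) *\<^sub>R y) - H x)) \<longlonglongrightarrow> pi * (y \<bullet> v)"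
      using rotation_difference_quotient[OF diff[OF x] lip C] by blast
    have "(\<lambda>m. G m (x, y)) \<longlonglongrightarrow> (pi * (y \<bullet> v))\<^sup>2" for y
      unfolding G_def using tendsto_power[OF LIMSEQ_Suc[OF v(2)[of y]], of 2] by simp
    with v(1) show ?thesis by blast
  qed
  have gv: "\<exists>v. norm v \<le> C \<and> (\<forall>y. g (x, y) = (pi * (y \<bullet> v))\<^sup>2)" if x: "x \<noteq> 0" for x
    using lim[OF x] limI unfolding g_def by blast
  \<comment> \<open>Domination: \<open>\<bar>cos \<theta> - 1\<bar>\<close> and
    \<open>\<bar>sin \<theta>\<bar>\<close> are at most \<open>\<theta>\<close>, so on the unit ball
    one rotation moves the first component by at most \<open>2 * \<theta>\<close>, and
    \<open>Suc m\<close> times this is \<open>2 * pi\<close>.\<close>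
  have bound: "\<bar>G m p\<bar> \<le> (C * (2 * pi))\<^sup>2" if p: "norm p < 1" for m p
  proof -
    define \<theta> where "\<theta> = pi / Suc m"
    have th: "\<theta> \<ge> 0" "real (Suc m) * \<theta> = pi" by (auto simp: \<theta>_def)
    have n1: "norm (fst p) \<le> 1" "norm (snd p) \<le> 1"
      using p norm_fst_le[of "fst p" "snd p"] norm_snd_le[of "snd p" "fst p"] by auto
    have c: "\<bar>cos \<theta> - 1\<bar> \<le> \<theta>"
    proof -
      have "1 - cos \<theta> = 2 * (sin (\<theta> / 2))\<^sup>2" using cos_double_sin[of "\<theta> / 2"] by simp
      also have "\<dots> = 2 * (\<bar>sin (\<theta> / 2)\<bar> * \<bar>sin (\<theta> / 2)\<bar>)" by (simp add: power2_eq_square abs_mult[symmetric])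
      also have "\<dots> \<le> 2 * (\<bar>\<theta> / 2\<bar> * 1)"
        by (intro mult_left_mono mult_mono abs_sin_x_le_abs_x abs_sin_le_one) auto
      finally show ?thesis using th(1) cos_le_one[of \<theta>] by simp
    qed
    have s: "\<bar>sin \<theta>\<bar> \<le> \<theta>" using abs_sin_x_le_abs_x[of \<theta>] th(1) by simp
    have "norm (cos \<theta> *\<^sub>R fst p + sin \<theta> *\<^sub>R snd p - fst p) \<le> \<bar>cos \<theta> - 1\<bar> * norm (fst p) + \<bar>sin \<theta>\<bar> * norm (snd p)"
    proof -
      have decomp: "cos \<theta> *\<^sub>R fst p + sin \<theta> *\<^sub>R snd p - fst p = (cos \<theta> - 1) *\<^sub>R fst p + sin \<theta> *\<^sub>R snd p"
        by (simp add: algebra_simps)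
      show ?thesis unfolding decomp
        by (rule order_trans[OF norm_triangle_ineq]) simp
    qed
    also have "\<dots> \<le> \<theta> * 1 + \<theta> * 1"
      using c s n1 th(1) by (intro add_mono mult_mono) auto
    also have "\<dots> = 2 * \<theta>" by simp
    finally have "norm (cos \<theta> *\<^sub>R fst p + sin \<theta> *\<^sub>R snd p - fst p) \<le> 2 * \<theta>" .
    then have "\<bar>H (cos \<theta> *\<^sub>R fst p + sin \<theta> *\<^sub>R snd p) - H (fst p)\<bar> \<le> C * (2 * \<theta>)"
      using lip C by (meson mult_left_mono order_trans)
    then have "real (Suc m) * \<bar>H (cos \<theta> *\<^sub>R fst p + sin \<theta> *\<^sub>R snd p) - H (fst p)\<bar> \<le> real (Suc m) * (C * (2 * \<theta>))"
      by (intro mult_left_mono) auto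
    also have "\<dots> = C * (2 * (real (Suc m) * \<theta>))" by simp
    finally have "\<bar>real (Suc m) * (H (cos \<theta> *\<^sub>R fst p + sin \<theta> *\<^sub>R snd p) - H (fst p))\<bar> \<le> C * (2 * pi)"
      unfolding th(2) by (simp add: abs_mult)
    moreover have "\<bar>C * (2 * pi)\<bar> = C * (2 * pi)" using C by simp
    ultimately have "G m p \<le> (C * (2 * pi))\<^sup>2"
      unfolding G_def \<theta>_def[symmetric] by (metis abs_le_square_iff)
    then show ?thesis by (simp add: G_def)
  qed
  interpret B: prob_space ?B by (rule prob_space_unif_ball)
  have AE_lim: "AE p in ?B. (\<lambda>m. G m p) \<longlonglongrightarrow> g p"
    using AE_unif_ball_fst_nonzero
  proof eventually_elim
    fix p :: "'a \<times> 'a" assume "fst p \<noteq> 0 \<and> norm p < 1"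
    then obtain v where "(\<lambda>m. G m (fst p, snd p)) \<longlonglongrightarrow> (pi * (snd p \<bullet> v))\<^sup>2" using lim by blast
    then show "(\<lambda>m. G m p) \<longlonglongrightarrow> g p" unfolding g_def by (simp add: limI)
  qed
  have AE_bd: "AE p in ?B. norm (G m p) \<le> (C * (2 * pi))\<^sup>2" for m
    by (rule AE_unif_ballI) (use bound in auto)
  have meas: "g \<in> borel_measurable ?B" "\<And>m. G m \<in> borel_measurable ?B"
    using g_meas G_meas by simp_all
  have conv: "(\<lambda>m. \<integral>p. G m p \<partial>?B) \<longlonglongrightarrow> (\<integral>p. g p \<partial>?B)"
    by (rule integral_dominated_convergence[OF meas _ AE_lim AE_bd]) simp
  have int_g: "integrable ?B g"
    by (rule integrable_dominated_convergence[OF meas _ AE_lim AE_bd]) simp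
  have le: "4 * (\<integral>p. (H (fst p))\<^sup>2 \<partial>?B) \<le> (\<integral>p. g p \<partial>?B)"
  proof (rule LIMSEQ_le_const[OF conv], intro exI allI impI)
    fix m
    show "4 * (\<integral>p. (H (fst p))\<^sup>2 \<partial>?B) \<le> (\<integral>p. G m p \<partial>?B)"
      unfolding G_def using odd_function_rotation_bound[OF odd lip C, of "Suc m"] by simp
  qed
  let ?vol = "emeasure lborel (ball (0::'a \<times> 'a) 1)"
  let ?S = "\<lambda>x::'a. \<integral>\<^sup>+y. ennreal ((norm y)\<^sup>2) * indicator {y. (norm x)\<^sup>2 + (norm (y::'a))\<^sup>2 < 1} y \<partial>lborel"
  let ?k = "pi\<^sup>2 * C\<^sup>2 / DIM('a)"
  have g0: "AE p in ?B. 0 \<le> g p"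
    using AE_unif_ball_fst_nonzero
    by eventually_elim (use gv in \<open>metis prod.collapse zero_le_power2\<close>)
  have n2: "integrable ?B (\<lambda>p. (norm (snd p))\<^sup>2)"
  proof (rule integrable_unif_ball_bounded[where B=1])
    show "\<bar>(norm (snd p))\<^sup>2\<bar> \<le> 1" if "norm p < 1" for p :: "'a \<times> 'a"
      using that norm_snd_le[of "snd p" "fst p"] by (auto simp: abs_square_le_1)
  qed measurable
  have "ennreal (\<integral>p. g p \<partial>?B) = (\<integral>\<^sup>+p. ennreal (g p) \<partial>?B)"
    by (rule nn_integral_eq_integral[symmetric, OF int_g g0])
  also have "\<dots> = (\<integral>\<^sup>+x. \<integral>\<^sup>+y. ennreal (g (x, y)) * indicator {y. (norm x)\<^sup>2 + (norm y)\<^sup>2 < 1} y \<partial>lborel \<partial>lborel) / ?vol"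
    by (rule nn_integral_unif_ball_Pair) measurable
  also have "\<dots> \<le> (\<integral>\<^sup>+x. ennreal ?k * ?S x \<partial>lborel) / ?vol"
  proof (rule divide_right_mono_ennreal, rule nn_integral_mono_AE)
    show "AE x in lborel. (\<integral>\<^sup>+y. ennreal (g (x, y)) * indicator {y. (norm x)\<^sup>2 + (norm y)\<^sup>2 < 1} y \<partial>lborel)
      \<le> ennreal ?k * ?S x"
    proof (rule AE_mp[OF AE_lborel_nonzero], intro AE_I2 impI)
      fix x :: 'a assume x: "x \<noteq> 0"
      obtain v where v: "norm v \<le> C" "\<And>y. g (x, y) = (pi * (y \<bullet> v))\<^sup>2" using gv[OF x] by blast
      have "pi\<^sup>2 * (norm v)\<^sup>2 / DIM('a) \<le> ?k"
        using v(1) by (intro divide_right_mono mult_left_mono power_mono) auto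
      then show "(\<integral>\<^sup>+y. ennreal (g (x, y)) * indicator {y. (norm x)\<^sup>2 + (norm y)\<^sup>2 < 1} y \<partial>lborel)
        \<le> ennreal ?k * ?S x"
        unfolding v(2) using x by (subst radial_square_integral) (auto intro!: mult_right_mono ennreal_leI)
    qed
  qed
  also have "\<dots> = ennreal ?k * (\<integral>\<^sup>+x. ?S x \<partial>lborel) / ?vol"
    by (subst nn_integral_cmult) (auto simp: ennreal_times_divide)
  also have "\<dots> = ennreal ?k * (\<integral>\<^sup>+p. ennreal ((norm (snd p))\<^sup>2) \<partial>?B)"
    by (subst nn_integral_unif_ball_Pair) (auto simp: ennreal_times_divide)
  also have "(\<integral>\<^sup>+p. ennreal ((norm (snd p))\<^sup>2) \<partial>?B) = ennreal (\<integral>p. (norm (snd p))\<^sup>2 \<partial>?B)"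
    by (rule nn_integral_eq_integral[OF n2]) auto
  also have "ennreal ?k * \<dots> = ennreal (?k * (\<integral>p. (norm (snd p))\<^sup>2 \<partial>?B))"
    by (rule ennreal_mult'[symmetric]) simp
  finally have "(\<integral>p. g p \<partial>?B) \<le> ?k * (\<integral>p. (norm (snd p))\<^sup>2 \<partial>?B)"
    by (subst (asm) ennreal_le_iff) auto
  \<comment> \<open>The quarter turn exchanges the two components up to sign.\<close>
  also have "(\<integral>p. (norm (snd p))\<^sup>2 \<partial>?B) = (\<integral>p. (norm (fst p))\<^sup>2 \<partial>?B)"
    using integral_unif_ball_rot[of 0 1 "\<lambda>p::'a \<times> 'a. (norm (fst p))\<^sup>2"] by (simp add: rot_def)
  finally show ?thesis using le by linarith
qed

section \<open>Extension of odd Lipschitz functions from the sphere to the space\<close>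

lemma radial_projection_nonexpansive:
  fixes x y :: "'a::euclidean_space"
  assumes "x \<noteq> 0" "norm x \<le> norm y"
  shows "norm x * norm (sgn x - sgn y) \<le> norm (x - y)"
proof -
  define a b where "a = norm x" and "b = norm y"
  have ab: "0 < a" "a \<le> b" using assms by (auto simp: a_def b_def)
  have y: "y \<noteq> 0" using assms by auto
  have x_eq: "x = a *\<^sub>R sgn x" and y_eq: "y = b *\<^sub>R sgn y" using assms(1) y by (auto simp: a_def b_def sgn_div_norm)
  have nn: "sgn x \<bullet> sgn x = 1" "sgn y \<bullet> sgn y = 1"
    using assms(1) y by (auto simp: norm_sgn power2_norm_eq_inner[symmetric])
  define c where "c = sgn x \<bullet> sgn y"
  have c1: "c \<le> 1" unfolding c_def using norm_cauchy_schwarz[of "sgn x" "sgn y"] assms(1) y by (simp add: norm_sgn)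
  have "(norm x * norm (sgn x - sgn y))\<^sup>2 = a\<^sup>2 * (2 - 2 * c)"
    unfolding power_mult_distrib power2_norm_eq_inner[of "sgn x - sgn y"] a_def[symmetric]
    by (simp add: inner_diff_left inner_diff_right nn inner_commute[of "sgn y" "sgn x"] c_def[symmetric])
  \<comment> \<open>The right side minus the left side is (b - a) (a + b - 2 a c), which is
    nonnegative as the cosine \<open>c\<close> is at most 1.\<close>
  also have "\<dots> \<le> a\<^sup>2 - 2 * a * b * c + b\<^sup>2"
  proof -
    have "2 * a * c * (b - a) \<le> 2 * a * 1 * (b - a)"
      using ab c1 by (intro mult_right_mono mult_left_mono) auto
    moreover have "2 * a * (b - a) \<le> (b + a) * (b - a)" using ab by (intro mult_right_mono) auto
    ultimately show ?thesis by (simp add: power2_eq_square algebra_simps)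
  qed
  also have "\<dots> = (norm (x - y))\<^sup>2"
    unfolding power2_norm_eq_inner
    by (subst (1 2) x_eq, subst (1 2) y_eq)
       (simp add: inner_diff_left inner_diff_right nn inner_commute[of "sgn y" "sgn x"] c_def[symmetric] power2_eq_square algebra_simps)
  finally show ?thesis by (rule power2_le_imp_le) simp
qed

lemma norm_sgn_eq_1: "norm (sgn x) = 1" if "x \<noteq> 0" for x :: "'a::real_normed_vector"
  using that by (simp add: norm_sgn)

context
  fixes h :: "'a::euclidean_space \<Rightarrow> real" and L :: real
  assumes odd: "\<And>e. norm e = 1 \<Longrightarrow> h (- e) = - h e"
    and lip: "\<And>e e'. norm e = 1 \<Longrightarrow> norm e' = 1 \<Longrightarrow> \<bar>h e - h e'\<bar> \<le> L * norm (e - e')"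
    and L: "L \<ge> 0"
begin

text \<open>Antipodal points lie at distance 2 and carry opposite values.\<close>

lemma odd_sphere_bound: "\<bar>h e\<bar> \<le> L" if "norm e = 1"
proof -
  have "\<bar>h e - h (- e)\<bar> \<le> L * norm (e - (- e))" using that by (intro lip) auto
  also have "e - (- e) = 2 *\<^sub>R e" by (simp add: scaleR_2)
  finally show ?thesis using that by (simp add: odd)
qed

text \<open>The extension has degree one because a nonconstant extension of degree zero is
  discontinuous at the origin. The increment splits into an angular part, controlled by projecting
  to the smaller radius, and a radial part, controlled by the bound \<open>L\<close> on
  \<open>h\<close>; each contributes one \<open>L\<close>.\<close>

lemma homogeneous_extension_lipschitz:
  "\<bar>norm x * h (sgn x) - norm y * h (sgn y)\<bar> \<le> 2 * L * norm (x - y)"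
proof -
  have *: "\<bar>norm x * h (sgn x) - norm y * h (sgn y)\<bar> \<le> 2 * L * norm (x - y)" if le: "norm x \<le> norm y" for x y
  proof (cases "x = 0")
    case True
    show ?thesis
    proof (cases "y = 0")
      case False
      then have "\<bar>h (sgn y)\<bar> \<le> L" by (intro odd_sphere_bound norm_sgn_eq_1)
      then have "norm y * \<bar>h (sgn y)\<bar> \<le> norm y * (2 * L)" using L by (intro mult_left_mono) auto
      then show ?thesis using True by (simp add: abs_mult mult_ac)
    qed (use True in simp)
  next
    case False
    then have y: "y \<noteq> 0" using le by auto
    have "norm x * h (sgn x) - norm y * h (sgn y) = norm x * (h (sgn x) - h (sgn y)) + (norm x - norm y) * h (sgn y)"
      by (simp add: algebra_simps)
    then have "\<bar>norm x * h (sgn x) - norm y * h (sgn y)\<bar> \<le> norm x * \<bar>h (sgn x) - h (sgn y)\<bar> + \<bar>norm x - norm y\<bar> * \<bar>h (sgn y)\<bar>"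
      by (metis abs_mult abs_norm_cancel abs_triangle_ineq)
    also have "\<dots> \<le> norm x * (L * norm (sgn x - sgn y)) + norm (x - y) * L"
      using False y by (intro add_mono mult_mono lip odd_sphere_bound norm_sgn_eq_1 norm_triangle_ineq3) auto
    also have "\<dots> = L * (norm x * norm (sgn x - sgn y)) + norm (x - y) * L" by simp
    also have "\<dots> \<le> L * norm (x - y) + norm (x - y) * L"
      using L radial_projection_nonexpansive[OF False le] by (intro add_right_mono mult_left_mono) auto
    finally show ?thesis by (simp add: algebra_simps)
  qed
  show ?thesis
    using *[of x y] *[of y x] by (cases "norm x \<le> norm y") (auto simp: abs_minus_commute norm_minus_commute)
qed

end

section \<open>The uniform distribution on the sphere: moments, symmetry and variance of odd
  functions\<close>

lemma sets_uniform_sphere [measurable_cong, simp]: "sets uniform_sphere = sets borel"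
  by (simp add: uniform_sphere_def)

lemma space_uniform_sphere [simp]: "space uniform_sphere = UNIV"
  by (simp add: uniform_sphere_def)

lemma prob_space_uniform_sphere: "prob_space (uniform_sphere :: 'a::euclidean_space measure)"
proof -
  interpret prob_space "unif_ball :: 'a measure" by (rule prob_space_unif_ball)
  show ?thesis unfolding uniform_sphere_def by (rule prob_space_distr) simp
qed

lemma AE_uniform_sphere: "AE e in (uniform_sphere :: 'a::euclidean_space measure). norm e = 1"
  unfolding uniform_sphere_def
proof (subst AE_distr_iff)
  show "AE x in (unif_ball :: 'a measure). norm (sgn x) = 1"
    by (rule AE_unif_ballI) (use AE_lborel_nonzero in eventually_elim, auto simp: norm_sgn)
qed auto

lemma nn_integral_uniform_sphere:
  fixes F :: "'a::euclidean_space \<Rightarrow> ennreal"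
  assumes [measurable]: "F \<in> borel_measurable borel"
  shows "(\<integral>\<^sup>+e. F e \<partial>uniform_sphere)
    = (\<integral>\<^sup>+x. F (sgn x) * indicator (ball 0 1) x \<partial>lborel) / emeasure lborel (ball (0::'a) 1)"
  unfolding uniform_sphere_def
  by (subst nn_integral_distr, simp, simp, rule nn_integral_uniform_measure) auto

lemma uniform_sphere_second_moment:
  fixes u v :: "'a::euclidean_space"
  shows "(\<integral>e. (e \<bullet> u) * (e \<bullet> v) \<partial>uniform_sphere) = (u \<bullet> v) / DIM('a)"
proof -
  let ?V = "measure lborel (ball (0::'a) 1)"
  \<comment> \<open>This weight undoes the normalisation in \<open>sgn\<close>. At 0 division by
    zero makes it 0, so \<open>g (norm y) * (norm y)\<^sup>2\<close> agrees with the indicator of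
    the ball only almost everywhere.\<close>
  define g where "g = (\<lambda>t::real. (if t < 1 then 1 else 0) / t\<^sup>2)"
  have [measurable]: "g \<in> borel_measurable borel" unfolding g_def by measurable
  have AEg: "AE y in lborel. indicator (ball 0 1) y = g (norm y) * (norm (y::'a))\<^sup>2"
    using AE_lborel_nonzero by eventually_elim (auto simp: g_def indicator_def)
  have int: "integrable lborel (\<lambda>y::'a. g (norm y) * (norm y)\<^sup>2)"
    by (rule integrable_cong_AE_imp[OF integrable_indicator_unit_ball]) (use AEg in \<open>auto simp: eq_commute\<close>)
  have "(\<integral>e. (e \<bullet> u) * (e \<bullet> v) \<partial>uniform_sphere) = (\<integral>x. (sgn x \<bullet> u) * (sgn x \<bullet> v) \<partial>unif_ball)"
    unfolding uniform_sphere_def by (subst integral_distr) auto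
  also have "\<dots> = (\<integral>x. indicator (ball 0 1) x * ((sgn x \<bullet> u) * (sgn x \<bullet> v)) \<partial>lborel) / ?V"
    by (rule integral_uniform_measure) (use emeasure_unit_ball in auto)
  also have "(\<integral>x. indicator (ball 0 1) x * ((sgn x \<bullet> u) * (sgn x \<bullet> v)) \<partial>lborel)
      = (\<integral>x. g (norm x) * ((x \<bullet> u) * (x \<bullet> v)) \<partial>lborel)"
    by (intro Bochner_Integration.integral_cong refl) (auto simp: g_def indicator_def sgn_div_norm power2_eq_square divide_simps)
  also have "\<dots> = (u \<bullet> v) / DIM('a) * (\<integral>y. g (norm (y::'a)) * (norm y)\<^sup>2 \<partial>lborel)"
    using int by (rule radial_second_moment(2)[rotated]) measurable
  also have "(\<integral>y. g (norm (y::'a)) * (norm y)\<^sup>2 \<partial>lborel) = (\<integral>y. indicator (ball (0::'a) 1) y \<partial>lborel)"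
    using AEg by (intro integral_cong_AE) (auto intro!: borel_measurable_indicator)
  also have "\<dots> = ?V" by simp
  finally show ?thesis by simp
qed

lemma distr_uniform_sphere_uminus: "distr uniform_sphere borel uminus = (uniform_sphere :: 'a::euclidean_space measure)"
proof -
  have "distr lborel borel (\<lambda>x::'a. \<Sum>b\<in>Basis. ((-1) * (x \<bullet> b)) *\<^sub>R b) = lborel"
    by (rule lborel_distr_sign_change) simp
  then have "distr lborel borel (uminus :: 'a \<Rightarrow> 'a) = lborel"
    by (simp add: sum_negf euclidean_representation)
  then have B: "distr unif_ball borel (uminus :: 'a \<Rightarrow> 'a) = unif_ball"
    by (rule distr_unif_ball) auto
  have "distr uniform_sphere borel uminus = distr (unif_ball :: 'a measure) borel (uminus \<circ> sgn)"
    unfolding uniform_sphere_def by (rule distr_distr) auto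
  also have "uminus \<circ> sgn = sgn \<circ> (uminus :: 'a \<Rightarrow> 'a)" by (auto simp: sgn_minus fun_eq_iff)
  also have "distr (unif_ball :: 'a measure) borel (sgn \<circ> uminus) = distr (distr unif_ball borel uminus) borel sgn"
    by (rule distr_distr[symmetric]) auto
  finally show ?thesis unfolding B uniform_sphere_def .
qed

text \<open>The first component of a uniform pair has a density that depends on its norm alone.
  Hence its radius and direction factor, and the direction is uniform on the sphere.\<close>

lemma nn_integral_unif_ball_homogeneous:
  fixes F :: "'a::euclidean_space \<Rightarrow> ennreal"
  assumes [measurable]: "F \<in> borel_measurable borel" and fin: "(\<integral>\<^sup>+e. F e \<partial>uniform_sphere) < \<infinity>"
  shows "(\<integral>\<^sup>+p. ennreal ((norm (fst (p::'a \<times> 'a)))\<^sup>2) * F (sgn (fst p)) \<partial>unif_ball)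
    = (\<integral>\<^sup>+p. ennreal ((norm (fst (p::'a \<times> 'a)))\<^sup>2) \<partial>unif_ball) * (\<integral>\<^sup>+e. F e \<partial>uniform_sphere)"
proof -
  let ?B = "unif_ball :: ('a \<times> 'a) measure"
  let ?V = "emeasure lborel (ball (0::'a \<times> 'a) 1)" and ?v = "emeasure lborel (ball (0::'a) 1)"
  \<comment> \<open>\<open>w t\<close> is \<open>t\<^sup>2\<close> times the volume of the fibre
    over a point of norm \<open>t\<close>.\<close>
  define w where "w = (\<lambda>t::real. ennreal (t\<^sup>2) * (\<integral>\<^sup>+y. indicator {y. t\<^sup>2 + (norm (y::'a))\<^sup>2 < 1} y \<partial>lborel))"
  have [measurable]: "w \<in> borel_measurable borel"
    unfolding w_def indicator_def by measurable
  have slice: "(\<integral>\<^sup>+p. ennreal ((norm (fst p))\<^sup>2) * G (sgn (fst p)) \<partial>?B)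
      = (\<integral>\<^sup>+x. w (norm x) * G (sgn x) \<partial>lborel) / ?V" if [measurable]: "G \<in> borel_measurable borel" for G
  proof -
    have "(\<integral>\<^sup>+y. ennreal ((norm x)\<^sup>2) * G (sgn x) * indicator {y. (norm x)\<^sup>2 + (norm (y::'a))\<^sup>2 < 1} y \<partial>lborel)
      = w (norm x) * G (sgn x)" for x :: 'a
      unfolding w_def by (subst nn_integral_cmult) (auto simp: mult_ac)
    then show ?thesis by (subst nn_integral_unif_ball_Pair) auto
  qed
  have v: "?v \<noteq> 0" "?v \<noteq> \<top>" using emeasure_unit_ball[where 'a='a] by auto
  have fin': "(\<integral>\<^sup>+x. F (sgn x) * indicator (ball 0 1) x \<partial>lborel) < \<infinity>"
    using fin v unfolding nn_integral_uniform_sphere[OF assms(1)]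
    by (auto simp: ennreal_divide_eq_top_iff less_top[symmetric])
  have "(\<integral>\<^sup>+x. w (norm x) * F (sgn x) \<partial>lborel) = (\<integral>\<^sup>+x. w (norm x) * F (sgn x) \<partial>lborel) * ?v / ?v"
    using v by (simp add: ennreal_mult_divide_eq)
  also have "\<dots> = (\<integral>\<^sup>+x. w (norm (x::'a)) \<partial>lborel) * (\<integral>\<^sup>+e. F e \<partial>uniform_sphere)"
    unfolding nn_integral_polar[OF assms(1) \<open>w \<in> _\<close> fin'] nn_integral_uniform_sphere[OF assms(1)]
    by (simp add: ennreal_times_divide)
  finally show ?thesis
    using slice[of F] slice[of "\<lambda>_. 1"] by (simp add: ennreal_times_divide mult_ac)
qed

text \<open>The Poincare inequality for the degree-one extension \<open>H\<close> is carried back to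
  the sphere: both of its sides contain the mean of \<open>(norm (fst p))\<^sup>2\<close> as a
  factor, which is positive and cancels.\<close>

lemma uniform_sphere_odd_variance:
  fixes h :: "'a::euclidean_space \<Rightarrow> real"
  assumes odd: "\<And>e. norm e = 1 \<Longrightarrow> h (- e) = - h e"
    and lip: "\<And>e e'. norm e = 1 \<Longrightarrow> norm e' = 1 \<Longrightarrow> \<bar>h e - h e'\<bar> \<le> L * norm (e - e')"
    and L: "L \<ge> 0" and diff: "\<And>e. norm e = 1 \<Longrightarrow> h differentiable (at e)"
    and [measurable]: "h \<in> borel_measurable borel"
  shows "(\<integral>\<^sup>+e. ennreal ((h e)\<^sup>2) \<partial>uniform_sphere) \<le> ennreal (16 * L\<^sup>2 / DIM('a))" (is "?E \<le> _")
proof -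
  let ?B = "unif_ball :: ('a \<times> 'a) measure"
  define H where "H = (\<lambda>x. norm x * h (sgn x))"
  let ?I = "\<integral>p. (norm (fst p))\<^sup>2 \<partial>?B"
  interpret S: prob_space "uniform_sphere :: 'a measure" by (rule prob_space_uniform_sphere)
  have Hlip: "\<bar>H x - H y\<bar> \<le> 2 * L * norm (x - y)" for x y
    unfolding H_def using odd lip L by (rule homogeneous_extension_lipschitz)
  have Hodd: "H (- x) = - H x" for x
    by (cases "x = 0") (auto simp: H_def sgn_minus odd norm_sgn_eq_1)
  have Hdiff: "H differentiable (at x)" if "x \<noteq> 0" for x
  proof -
    have "sgn differentiable (at x)"
      unfolding sgn_div_norm using that
      by (intro differentiable_scaleR differentiable_inverse differentiable_ident differentiable_norm_at) auto
    moreover have "h differentiable (at (sgn x))" using that by (intro diff norm_sgn_eq_1)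
    ultimately have "(h \<circ> sgn) differentiable (at x)"
      by (rule differentiable_chain_at)
    then show ?thesis
      unfolding H_def using that by (intro differentiable_mult differentiable_norm_at) (auto simp: comp_def)
  qed
  have poin: "4 * (\<integral>p. (H (fst p))\<^sup>2 \<partial>?B) \<le> pi\<^sup>2 * (2 * L)\<^sup>2 / DIM('a) * ?I"
    by (rule odd_function_poincare) (use Hodd Hlip L Hdiff in auto)
  have hb: "(h e)\<^sup>2 \<le> L\<^sup>2" if "norm e = 1" for e
    using odd_sphere_bound[of h L e] odd lip L that abs_le_square_iff[of "h e" L] by simp
  have bnd: "AE e in uniform_sphere. ennreal ((h e)\<^sup>2) \<le> ennreal (L\<^sup>2)"
    using AE_uniform_sphere by eventually_elim (rule ennreal_leI, rule hb)
  have "?E \<le> (\<integral>\<^sup>+e. ennreal (L\<^sup>2) \<partial>(uniform_sphere :: 'a measure))"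
    by (rule nn_integral_mono_AE[OF bnd])
  also have "\<dots> = ennreal (L\<^sup>2)" using S.emeasure_space_1 by simp
  finally have fin: "?E < \<infinity>" by (auto intro: le_less_trans)
  have [measurable]: "H \<in> borel_measurable borel" unfolding H_def by measurable
  have fn: "norm (fst p) \<le> 1" if "norm p < 1" for p :: "'a \<times> 'a"
    using that norm_fst_le[of "fst p" "snd p"] by simp
  have iN: "integrable ?B (\<lambda>p. (norm (fst p))\<^sup>2)"
    by (rule integrable_unif_ball_bounded[where B=1]) (use fn in \<open>auto simp: abs_square_le_1\<close>)
  have Hb: "\<bar>H (fst p)\<bar> \<le> 2 * L" if "norm p < 1" for p :: "'a \<times> 'a"
  proof -
    have "\<bar>H (fst p)\<bar> \<le> 2 * L * norm (fst p)" using Hlip[of "fst p" 0] by (simp add: H_def)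
    also have "\<dots> \<le> 2 * L * 1" using fn[OF that] L by (intro mult_left_mono) auto
    finally show ?thesis by simp
  qed
  have iH: "integrable ?B (\<lambda>p. (H (fst p))\<^sup>2)"
  proof (rule integrable_unif_ball_bounded[where B="(2 * L)\<^sup>2"])
    show "\<bar>(H (fst p))\<^sup>2\<bar> \<le> (2 * L)\<^sup>2" if "norm p < 1" for p :: "'a \<times> 'a"
      using Hb[OF that] L abs_le_square_iff[of "H (fst p)" "2 * L"] by simp
  qed measurable
  define E where "E = enn2real ?E"
  have E: "?E = ennreal E" using fin by (simp add: E_def less_top)
  have E0: "E \<ge> 0" by (simp add: E_def)
  have "ennreal (\<integral>p. (H (fst p))\<^sup>2 \<partial>?B) = (\<integral>\<^sup>+p. ennreal ((H (fst p))\<^sup>2) \<partial>?B)"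
    by (rule nn_integral_eq_integral[symmetric, OF iH]) simp
  also have "\<dots> = (\<integral>\<^sup>+p. ennreal ((norm (fst p))\<^sup>2) * ennreal ((h (sgn (fst p)))\<^sup>2) \<partial>?B)"
    by (intro nn_integral_cong) (simp add: H_def power_mult_distrib ennreal_mult)
  also have "\<dots> = (\<integral>\<^sup>+p. ennreal ((norm (fst p))\<^sup>2) \<partial>?B) * ?E"
    by (rule nn_integral_unif_ball_homogeneous[OF _ fin]) measurable
  also have "(\<integral>\<^sup>+p. ennreal ((norm (fst p))\<^sup>2) \<partial>?B) = ennreal ?I"
    by (rule nn_integral_eq_integral[OF iN]) simp
  also have "ennreal ?I * ?E = ennreal (?I * E)"
    unfolding E by (rule ennreal_mult[symmetric]) (use E0 in auto)
  finally have HE: "(\<integral>p. (H (fst p))\<^sup>2 \<partial>?B) = ?I * E"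
    using E0 by (subst (asm) ennreal_inj) (auto intro!: mult_nonneg_nonneg Bochner_Integration.integral_nonneg)
  have I0: "?I > 0"
  proof -
    interpret B: prob_space ?B by (rule prob_space_unif_ball)
    have "?I \<noteq> 0"
    proof
      assume "?I = 0"
      then have "AE p in ?B. (norm (fst p))\<^sup>2 = 0"
        by (subst (asm) integral_nonneg_eq_0_iff_AE[OF iN]) auto
      with AE_unif_ball_fst_nonzero have "AE p in ?B. False"
        by eventually_elim auto
      then show False using B.AE_False by simp
    qed
    moreover have "?I \<ge> 0" by simp
    ultimately show ?thesis by linarith
  qed
  have "4 * (?I * E) \<le> pi\<^sup>2 * (2 * L)\<^sup>2 / DIM('a) * ?I" using poin unfolding HE .
  then have "?I * (4 * E) \<le> ?I * (pi\<^sup>2 * (2 * L)\<^sup>2 / DIM('a))" by (simp add: mult_ac)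
  then have "4 * E \<le> pi\<^sup>2 * (2 * L)\<^sup>2 / DIM('a)" by (rule mult_left_le_imp_le[OF _ I0])
  \<comment> \<open>With \<open>pi\<close> replaced by 4, the bound on \<open>4 * E\<close> is 16
    times \<open>4 * L\<^sup>2\<close> over the dimension; this is the 16 of the claim.\<close>
  also have "\<dots> \<le> 4\<^sup>2 * (2 * L)\<^sup>2 / DIM('a)"
    using pi_less_4 pi_ge_zero by (intro divide_right_mono mult_right_mono power_mono) auto
  finally have "E \<le> 16 * L\<^sup>2 / DIM('a)" by (simp add: power_mult_distrib)
  then show ?thesis unfolding E by (rule ennreal_leI)
qed

section \<open>Taylor polynomials and smoothing kernels\<close>

lemma finite_multi_indices: "finite (multi_indices l :: ('a::euclidean_space \<Rightarrow> nat) set)"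
proof (rule finite_subset)
  show "multi_indices l \<subseteq> {m :: 'a \<Rightarrow> nat. \<forall>i. (i \<in> Basis \<longrightarrow> m i \<in> {..l}) \<and> (i \<notin> Basis \<longrightarrow> m i = 0)}"
  proof
    fix m :: "'a \<Rightarrow> nat" assume m: "m \<in> multi_indices l"
    have "m i \<le> l" if "i \<in> Basis" for i
      using m member_le_sum[of i Basis m] that by (simp add: multi_indices_def)
    with m show "m \<in> {m. \<forall>i. (i \<in> Basis \<longrightarrow> m i \<in> {..l}) \<and> (i \<notin> Basis \<longrightarrow> m i = 0)}"
      by (auto simp: multi_indices_def)
  qed
  show "finite {m :: 'a \<Rightarrow> nat. \<forall>i. (i \<in> Basis \<longrightarrow> m i \<in> {..l}) \<and> (i \<notin> Basis \<longrightarrow> m i = 0)}"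
    by (rule finite_set_of_finite_funs) auto
qed

definition unit_index :: "'a::euclidean_space \<Rightarrow> 'a \<Rightarrow> nat" where
  "unit_index i = (\<lambda>j. if j = i then 1 else 0)"

text \<open>These are the multi-indices that survive the moment conditions of the kernel.\<close>

lemma multi_indices_order_1:
  assumes "l \<ge> 1"
  shows "{m \<in> multi_indices l. (\<Sum>i\<in>Basis. m i) = 1} = unit_index ` (Basis :: 'a::euclidean_space set)"
proof (intro subset_antisym subsetI)
  fix m :: "'a \<Rightarrow> nat" assume "m \<in> {m \<in> multi_indices l. (\<Sum>i\<in>Basis. m i) = 1}"
  then have m: "\<And>i. i \<notin> Basis \<Longrightarrow> m i = 0" "(\<Sum>i\<in>Basis. m i) = 1" by (auto simp: multi_indices_def)
  then obtain i where i: "i \<in> Basis" "m i = 1" "\<forall>j\<in>Basis. i \<noteq> j \<longrightarrow> m j = 0"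
    using sum_eq_1_iff[of "Basis :: 'a set" m] by auto
  have "m j = unit_index i j" for j
    using m(1)[of j] i by (cases "j = i"; cases "j \<in> Basis") (auto simp: unit_index_def)
  then have "m = unit_index i" by blast
  with i(1) show "m \<in> unit_index ` Basis" by blast
next
  fix m :: "'a \<Rightarrow> nat" assume "m \<in> unit_index ` Basis"
  then obtain i where "i \<in> Basis" "m = unit_index i" by blast
  then show "m \<in> {m \<in> multi_indices l. (\<Sum>i\<in>Basis. m i) = 1}"
    using assms by (auto simp: multi_indices_def unit_index_def)
qed

text \<open>The chosen enumeration has no influence: every other coordinate contributes a zeroth
  iterate, the identity.\<close>

lemma multi_deriv_unit_index:
  fixes f :: "'a::euclidean_space \<Rightarrow> real"
  assumes i: "i \<in> Basis"
  shows "multi_deriv (unit_index i) f = partial_deriv i f"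
proof -
  have ne: "foldr (\<lambda>j. partial_deriv j ^^ unit_index i j) xs f = f" if "i \<notin> set xs" for xs
    using that by (induction xs) (auto simp: unit_index_def)
  have *: "foldr (\<lambda>j. partial_deriv j ^^ unit_index i j) xs f = partial_deriv i f" if "distinct xs" "i \<in> set xs" for xs
    using that
  proof (induction xs)
    case (Cons a xs)
    show ?case
    proof (cases "a = i")
      case True
      then have "foldr (\<lambda>j. partial_deriv j ^^ unit_index i j) xs f = f" using Cons.prems ne by auto
      then show ?thesis using True by (simp add: unit_index_def)
    next
      case False
      then show ?thesis using Cons by (simp add: unit_index_def)
    qed
  qed simp
  have "\<exists>bs. distinct bs \<and> set bs = (Basis :: 'a set)" using finite_distinct_list[OF finite_Basis] by blast
  then have "distinct (basis_enum :: 'a list) \<and> set basis_enum = (Basis :: 'a set)"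
    unfolding basis_enum_def by (rule someI_ex)
  then show ?thesis unfolding multi_deriv_def using * i by blast
qed

lemma partial_deriv_eq:
  assumes "(f has_derivative D) (at z)"
  shows "partial_deriv i f z = D i"
  unfolding partial_deriv_def by (rule DERIV_imp_deriv[OF has_derivative_along_line[OF assms]])

text \<open>Along a ray the exponent of \<open>s\<close> is the order of the multi-index, so
  integration against the kernel meets only its moments up to order \<open>l\<close>.\<close>

lemma taylor_poly_ray:
  "taylor_poly l f z (z + s *\<^sub>R e) =
    (\<Sum>m\<in>multi_indices l. 1 / (\<Prod>i\<in>Basis. fact (m i)) * multi_deriv m f z * (\<Prod>i\<in>Basis. (e \<bullet> i) ^ m i) * s ^ (\<Sum>i\<in>Basis. m i))"
  unfolding taylor_poly_def
  by (intro sum.cong refl) (simp add: power_mult_distrib prod.distrib power_sum mult_ac)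

section \<open>The uniform law on the interval and the moments of the kernel\<close>

lemma sets_uniform_interval [measurable_cong, simp]: "sets uniform_interval = sets borel"
  by (simp add: uniform_interval_def)

lemma space_uniform_interval [simp]: "space uniform_interval = UNIV"
  by (simp add: uniform_interval_def)

lemma prob_space_uniform_interval: "prob_space uniform_interval"
  unfolding uniform_interval_def by (rule prob_space_uniform_measure) auto

lemma AE_uniform_interval: "AE r in uniform_interval. \<bar>r\<bar> < 1"
  unfolding uniform_interval_def
proof (rule AE_uniform_measureI)
  have "AE r in lborel. r \<noteq> 1 \<and> r \<noteq> (-1 :: real)"
    by (intro AE_conjI AE_lborel_singleton)
  then show "AE r in lborel. r \<in> {-1..1} \<longrightarrow> \<bar>r\<bar> < (1::real)" by eventually_elim auto
qed simp

lemma integral_uniform_interval: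
  fixes f :: "real \<Rightarrow> real"
  assumes "f \<in> borel_measurable borel"
  shows "(LBINT u:{-1..1}. f u) = 2 * (\<integral>u. f u \<partial>uniform_interval)"
  unfolding set_lebesgue_integral_def uniform_interval_def using assms
  by (subst integral_uniform_measure) auto

locale smoothing =
  fixes \<beta> :: real and K :: "real \<Rightarrow> real"
  assumes kernel: "smoothing_kernel \<beta> K" and \<beta>: "\<beta> > 2"
begin

sublocale U: prob_space uniform_interval by (rule prob_space_uniform_interval)

lemma K_meas [measurable]: "K \<in> borel_measurable borel"
  using kernel by (simp add: smoothing_kernel_def)

lemma K_sq_int: "integrable uniform_interval (\<lambda>u. (K u)\<^sup>2)"
  using kernel by (simp add: smoothing_kernel_def)

lemma kappa_eq: "kernel_kappa K = 2 * (\<integral>u. (K u)\<^sup>2 \<partial>uniform_interval)"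
  unfolding kernel_kappa_def by (rule integral_uniform_interval) measurable

lemma kappa_beta_eq: "kernel_kappa_beta \<beta> K = 2 * (\<integral>u. \<bar>u\<bar> powr \<beta> * \<bar>K u\<bar> \<partial>uniform_interval)"
  unfolding kernel_kappa_beta_def by (rule integral_uniform_interval) measurable

lemma K_beta_int: "integrable uniform_interval (\<lambda>u. \<bar>u\<bar> powr \<beta> * \<bar>K u\<bar>)"
  using kernel by (simp add: smoothing_kernel_def)

lemma K_int: "integrable uniform_interval K"
proof (rule Bochner_Integration.integrable_bound)
  show "integrable uniform_interval (\<lambda>u. 1 + (K u)\<^sup>2)" using K_sq_int by simp
  have "\<bar>t\<bar> \<le> 1 + t\<^sup>2" for t :: real
  proof -
    have "0 \<le> (\<bar>t\<bar> - 1)\<^sup>2" by simp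
    then have "2 * \<bar>t\<bar> \<le> 1 + t\<^sup>2" by (simp add: power2_diff)
    then show ?thesis by simp
  qed
  then show "AE u in uniform_interval. norm (K u) \<le> norm (1 + (K u)\<^sup>2)"
    by (intro AE_I2) (metis abs_ge_self order_trans real_norm_def)
qed measurable

lemma moment_int: "integrable uniform_interval (\<lambda>u. u ^ j * K u)"
proof (rule Bochner_Integration.integrable_bound[OF K_int])
  show "AE u in uniform_interval. norm (u ^ j * K u) \<le> norm (K u)"
    using AE_uniform_interval
  proof eventually_elim
    fix u :: real assume "\<bar>u\<bar> < 1"
    then have "\<bar>u\<bar> ^ j * \<bar>K u\<bar> \<le> 1 * \<bar>K u\<bar>" by (intro mult_right_mono power_le_one) auto
    then show "norm (u ^ j * K u) \<le> norm (K u)" by (simp add: abs_mult power_abs)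
  qed
qed measurable

lemma smoothness_order_ge: "smoothness_order \<beta> \<ge> 2"
proof -
  have "\<lceil>\<beta>\<rceil> > 2" using \<beta> by (simp add: less_ceiling_iff)
  then show ?thesis unfolding smoothness_order_def by linarith
qed

lemma moment: "(\<integral>u. u ^ j * K u \<partial>uniform_interval) = (if j = 1 then 1 else 0)" if "j \<le> smoothness_order \<beta>"
proof -
  have "j = 0 \<or> j = 1 \<or> j \<in> {2..smoothness_order \<beta>}" using that by auto
  then show ?thesis using kernel by (elim disjE) (auto simp: smoothing_kernel_def)
qed

text \<open>The moments of order 0 and of orders from 2 up vanish and the first is 1; the surviving
  partial derivatives recombine to \<open>D e\<close> by linearity.\<close>

lemma kernel_taylor_poly:
  assumes D: "(\<phi> has_derivative D) (at z)"
  shows "integrable uniform_interval (\<lambda>r. taylor_poly (smoothness_order \<beta>) \<phi> z (z + (t * r) *\<^sub>R e) * K r)"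
    and "(\<integral>r. taylor_poly (smoothness_order \<beta>) \<phi> z (z + (t * r) *\<^sub>R e) * K r \<partial>uniform_interval) = t * D e"
proof -
  let ?l = "smoothness_order \<beta>"
  define a where "a = (\<lambda>m. 1 / (\<Prod>i\<in>Basis. fact (m i)) * multi_deriv m \<phi> z * (\<Prod>i\<in>Basis. (e \<bullet> i) ^ m i))"
  have eq: "taylor_poly ?l \<phi> z (z + (t * r) *\<^sub>R e) * K r
      = (\<Sum>m\<in>multi_indices ?l. a m * t ^ (\<Sum>i\<in>Basis. m i) * (r ^ (\<Sum>i\<in>Basis. m i) * K r))" for r
    unfolding taylor_poly_ray a_def sum_distrib_right
    by (intro sum.cong refl) (simp add: power_mult_distrib mult_ac)
  show "integrable uniform_interval (\<lambda>r. taylor_poly ?l \<phi> z (z + (t * r) *\<^sub>R e) * K r)"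
    unfolding eq by (intro Bochner_Integration.integrable_sum integrable_mult_right moment_int)
  have "(\<integral>r. taylor_poly ?l \<phi> z (z + (t * r) *\<^sub>R e) * K r \<partial>uniform_interval)
      = (\<Sum>m\<in>multi_indices ?l. a m * t ^ (\<Sum>i\<in>Basis. m i) * (\<integral>r. r ^ (\<Sum>i\<in>Basis. m i) * K r \<partial>uniform_interval))"
    unfolding eq by (subst Bochner_Integration.integral_sum) (auto intro!: moment_int)
  also have "\<dots> = (\<Sum>m\<in>multi_indices ?l. if (\<Sum>i\<in>Basis. m i) = 1 then a m * t else 0)"
    by (intro sum.cong refl) (subst moment, auto simp: multi_indices_def)
  also have "\<dots> = (\<Sum>m\<in>{m \<in> multi_indices ?l. (\<Sum>i\<in>Basis. m i) = 1}. a m * t)"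
    by (rule sum.inter_filter[symmetric, OF finite_multi_indices])
  also have "\<dots> = (\<Sum>m\<in>unit_index ` Basis. a m * t)"
    using smoothness_order_ge by (subst multi_indices_order_1) auto
  also have "\<dots> = (\<Sum>i\<in>Basis. a (unit_index i) * t)"
    by (subst sum.reindex) (auto simp: inj_on_def unit_index_def fun_eq_iff split: if_splits)
  also have "\<dots> = (\<Sum>i\<in>Basis. t * (e \<bullet> i) * D i)"
  proof (intro sum.cong refl)
    fix i :: 'a assume i: "i \<in> Basis"
    have "(\<Prod>j\<in>Basis. fact (unit_index i j)) = (1 :: real)"
      by (intro prod.neutral) (auto simp: unit_index_def)
    moreover have "(\<Prod>j\<in>Basis. (e \<bullet> j) ^ unit_index i j) = e \<bullet> i"
      using i by (simp add: unit_index_def if_distrib[of "power _"] prod.delta cong: if_cong)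
    ultimately show "a (unit_index i) * t = t * (e \<bullet> i) * D i"
      unfolding a_def multi_deriv_unit_index[OF i] partial_deriv_eq[OF D] by simp
  qed
  also have "\<dots> = t * D (\<Sum>i\<in>Basis. (e \<bullet> i) *\<^sub>R i)"
    using has_derivative_linear[OF D] by (simp add: linear_sum linear_scale sum_distrib_left mult_ac)
  finally show "(\<integral>r. taylor_poly ?l \<phi> z (z + (t * r) *\<^sub>R e) * K r \<partial>uniform_interval) = t * D e"
    by (simp add: euclidean_representation)
qed

text \<open>The Hoelder bound is asked only for \<open>\<bar>r\<bar> < 1\<close> because
  neighbourhoods are open; the endpoints form a null set. The final \<open>/ 2\<close> converts the
  Lebesgue measure in \<open>kernel_kappa_beta\<close> to the uniform law.\<close>

lemma kernel_holder:
  fixes \<phi> :: "'a::euclidean_space \<Rightarrow> real"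
  assumes D: "(\<phi> has_derivative D) (at z)" and [measurable]: "\<phi> \<in> borel_measurable borel"
    and t: "t > 0" and e: "norm e = 1"
    and hold: "\<And>r. \<bar>r\<bar> < 1 \<Longrightarrow>
      \<bar>\<phi> (z + (t * r) *\<^sub>R e) - taylor_poly (smoothness_order \<beta>) \<phi> z (z + (t * r) *\<^sub>R e)\<bar> \<le> L * norm ((t * r) *\<^sub>R e) powr \<beta>"
  shows "integrable uniform_interval (\<lambda>r. \<phi> (z + (t * r) *\<^sub>R e) * K r)"
    and "\<bar>(\<integral>r. \<phi> (z + (t * r) *\<^sub>R e) * K r \<partial>uniform_interval) - t * D e\<bar> \<le> L * t powr \<beta> * kernel_kappa_beta \<beta> K / 2"
proof -
  let ?P = "\<lambda>r. taylor_poly (smoothness_order \<beta>) \<phi> z (z + (t * r) *\<^sub>R e)"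
  let ?\<rho> = "\<lambda>r. (\<phi> (z + (t * r) *\<^sub>R e) - ?P r) * K r"
  note P = kernel_taylor_poly[OF D, of t e]
  have [measurable]: "?P \<in> borel_measurable borel" unfolding taylor_poly_ray by measurable
  have ae: "AE r in uniform_interval. norm (?\<rho> r) \<le> L * t powr \<beta> * (\<bar>r\<bar> powr \<beta> * \<bar>K r\<bar>)"
    using AE_uniform_interval
  proof eventually_elim
    fix r :: real assume "\<bar>r\<bar> < 1"
    from hold[OF this] have "\<bar>\<phi> (z + (t * r) *\<^sub>R e) - ?P r\<bar> \<le> L * (t powr \<beta> * \<bar>r\<bar> powr \<beta>)"
      using t e by (simp add: abs_mult powr_mult)
    then have "\<bar>\<phi> (z + (t * r) *\<^sub>R e) - ?P r\<bar> * \<bar>K r\<bar> \<le> L * (t powr \<beta> * \<bar>r\<bar> powr \<beta>) * \<bar>K r\<bar>"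
      by (rule mult_right_mono) simp
    then show "norm (?\<rho> r) \<le> L * t powr \<beta> * (\<bar>r\<bar> powr \<beta> * \<bar>K r\<bar>)" by (simp add: abs_mult mult_ac)
  qed
  have Ib: "integrable uniform_interval (\<lambda>r. L * t powr \<beta> * (\<bar>r\<bar> powr \<beta> * \<bar>K r\<bar>))"
    by (intro integrable_mult_right K_beta_int)
  have I\<rho>: "integrable uniform_interval ?\<rho>"
  proof (rule Bochner_Integration.integrable_bound[OF Ib])
    show "AE r in uniform_interval. norm (?\<rho> r) \<le> norm (L * t powr \<beta> * (\<bar>r\<bar> powr \<beta> * \<bar>K r\<bar>))"
      using ae by eventually_elim auto
  qed measurable
  have split: "\<phi> (z + (t * r) *\<^sub>R e) * K r = ?P r * K r + ?\<rho> r" for r by (simp add: algebra_simps)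
  show "integrable uniform_interval (\<lambda>r. \<phi> (z + (t * r) *\<^sub>R e) * K r)"
    unfolding split using P(1) I\<rho> by (rule Bochner_Integration.integrable_add)
  have "(\<integral>r. \<phi> (z + (t * r) *\<^sub>R e) * K r \<partial>uniform_interval) = t * D e + (\<integral>r. ?\<rho> r \<partial>uniform_interval)"
    unfolding split P(2)[symmetric] by (rule Bochner_Integration.integral_add[OF P(1) I\<rho>])
  moreover have "\<bar>\<integral>r. ?\<rho> r \<partial>uniform_interval\<bar> \<le> (\<integral>r. L * t powr \<beta> * (\<bar>r\<bar> powr \<beta> * \<bar>K r\<bar>) \<partial>uniform_interval)"
  proof -
    have "\<bar>\<integral>r. ?\<rho> r \<partial>uniform_interval\<bar> \<le> (\<integral>r. norm (?\<rho> r) \<partial>uniform_interval)"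
      using integral_norm_bound[of uniform_interval ?\<rho>] by simp
    also have "\<dots> \<le> (\<integral>r. L * t powr \<beta> * (\<bar>r\<bar> powr \<beta> * \<bar>K r\<bar>) \<partial>uniform_interval)"
      by (rule integral_mono_AE[OF integrable_norm[OF I\<rho>] Ib ae])
    finally show ?thesis .
  qed
  moreover have "(\<integral>r. L * t powr \<beta> * (\<bar>r\<bar> powr \<beta> * \<bar>K r\<bar>) \<partial>uniform_interval) = L * t powr \<beta> * kernel_kappa_beta \<beta> K / 2"
    unfolding kappa_beta_eq by simp
  ultimately show "\<bar>(\<integral>r. \<phi> (z + (t * r) *\<^sub>R e) * K r \<partial>uniform_interval) - t * D e\<bar> \<le> L * t powr \<beta> * kernel_kappa_beta \<beta> K / 2"
    by linarith
qed

end

section \<open>Bias and second moment of the gradient estimate\<close>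

text \<open>The first absolute moment is at most the root of the second because a variance is
  nonnegative. This is why the bias grows like the root of n: the estimate carries a prefactor n,
  and the root in the denominator takes back half of the exponent.\<close>

lemma uniform_sphere_abs_moment:
  fixes v :: "'a::euclidean_space"
  shows "integrable uniform_sphere (\<lambda>e. \<bar>e \<bullet> v\<bar>)"
    and "(\<integral>e. \<bar>e \<bullet> v\<bar> \<partial>uniform_sphere) \<le> norm v / sqrt DIM('a)"
proof -
  interpret S: prob_space "uniform_sphere :: 'a measure" by (rule prob_space_uniform_sphere)
  have b: "AE e in uniform_sphere. \<bar>e \<bullet> v\<bar> \<le> norm v"
    using AE_uniform_sphere by eventually_elim (metis Cauchy_Schwarz_ineq2 mult_1)
  show i1: "integrable uniform_sphere (\<lambda>e. \<bar>e \<bullet> v\<bar>)"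
    by (rule S.integrable_const_bound[where B="norm v"]) (use b in auto)
  have i2: "integrable uniform_sphere (\<lambda>e. \<bar>e \<bullet> v\<bar>\<^sup>2)"
  proof (rule S.integrable_const_bound[where B="(norm v)\<^sup>2"])
    show "AE e in uniform_sphere. norm (\<bar>e \<bullet> v\<bar>\<^sup>2) \<le> (norm v)\<^sup>2"
      using b by eventually_elim (simp add: abs_le_square_iff[symmetric])
  qed measurable
  have "(\<integral>e. \<bar>e \<bullet> v\<bar> \<partial>uniform_sphere)\<^sup>2 \<le> (\<integral>e. \<bar>e \<bullet> v\<bar>\<^sup>2 \<partial>uniform_sphere)"
    using S.variance_eq[OF i1 i2] S.variance_positive[of "\<lambda>e. \<bar>e \<bullet> v\<bar>"] by simp
  also have "\<dots> = (norm v)\<^sup>2 / DIM('a)"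
    using uniform_sphere_second_moment[of v v] by (simp add: power2_eq_square power2_norm_eq_inner[symmetric])
  also have "\<dots> = (norm v / sqrt DIM('a))\<^sup>2" by (simp add: power_divide)
  finally show "(\<integral>e. \<bar>e \<bullet> v\<bar> \<partial>uniform_sphere) \<le> norm v / sqrt DIM('a)"
    by (rule power2_le_imp_le) simp
qed

text \<open>Isotropy of the sphere cancels the prefactor and returns the linear part exactly, so
  only the Taylor remainder is estimated. A lower bound suffices, since the inner product serves as
  an upper bound for the gap.\<close>

lemma (in smoothing) gradient_estimate_bias:
  fixes \<phi> :: "'a::euclidean_space \<Rightarrow> real"
  assumes D: "(\<phi> has_derivative D) (at z)" and [measurable]: "\<phi> \<in> borel_measurable borel"
    and t: "t > 0"
    and hold: "\<And>r e. \<bar>r\<bar> < 1 \<Longrightarrow> norm e = 1 \<Longrightarrow>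
      \<bar>\<phi> (z + (t * r) *\<^sub>R e) - taylor_poly (smoothness_order \<beta>) \<phi> z (z + (t * r) *\<^sub>R e)\<bar> \<le> L * norm ((t * r) *\<^sub>R e) powr \<beta>"
    and L: "L \<ge> 0"
  shows "DIM('a) / (2 * t) * (\<integral>e. (\<integral>r. (\<phi> (z + (t * r) *\<^sub>R e) - \<phi> (z - (t * r) *\<^sub>R e)) * K r \<partial>uniform_interval) * (e \<bullet> v) \<partial>uniform_sphere)
    \<ge> D v - sqrt DIM('a) * L * t powr (\<beta> - 1) * kernel_kappa_beta \<beta> K / 2 * norm v"
    (is "?n / _ * (\<integral>e. ?q e * _ \<partial>_) \<ge> _")
proof -
  interpret S: prob_space "uniform_sphere :: 'a measure" by (rule prob_space_uniform_sphere)
  define d where "d = (\<Sum>b\<in>Basis. D b *\<^sub>R b)"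
  have linD: "linear D" using D has_derivative_linear by blast
  have Dd: "D y = y \<bullet> d" for y
    unfolding d_def by (rule linear_functional_inner[OF linD])
  let ?B = "L * t powr \<beta> * kernel_kappa_beta \<beta> K"
  \<comment> \<open>The kernel bound is applied along \<open>e\<close> and along \<open>- e\<close>;
    the two halves add up to \<open>?B\<close>.\<close>
  have q: "\<bar>?q e - 2 * t * D e\<bar> \<le> ?B" if e: "norm e = 1" for e
  proof -
    note p = kernel_holder[OF D assms(2) t e hold[OF _ e]]
    have m: "norm (- e) = 1" using e by simp
    note n = kernel_holder[OF D assms(2) t m hold[OF _ m]]
    have "?q e = (\<integral>r. \<phi> (z + (t * r) *\<^sub>R e) * K r - \<phi> (z + (t * r) *\<^sub>R (- e)) * K r \<partial>uniform_interval)"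
      by (simp add: algebra_simps)
    also have "\<dots> = (\<integral>r. \<phi> (z + (t * r) *\<^sub>R e) * K r \<partial>uniform_interval) - (\<integral>r. \<phi> (z + (t * r) *\<^sub>R (- e)) * K r \<partial>uniform_interval)"
      by (rule Bochner_Integration.integral_diff[OF p(1) n(1)])
    finally have q_eq: "?q e = (\<integral>r. \<phi> (z + (t * r) *\<^sub>R e) * K r \<partial>uniform_interval) - (\<integral>r. \<phi> (z + (t * r) *\<^sub>R (- e)) * K r \<partial>uniform_interval)" .
    have "t * D (- e) = - (t * D e)" "2 * t * D e = 2 * (t * D e)"
      using linear_neg[OF linD, of e] by simp_all
    then show ?thesis unfolding q_eq using p(2) n(2) by linarith
  qed
  have [measurable]: "?q \<in> borel_measurable borel"
    by (rule U.borel_measurable_lebesgue_integral) measurable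
  have B0: "?B \<ge> 0" using L by (simp add: kappa_beta_eq)
  have Dle: "\<bar>D e\<bar> \<le> norm d" if "norm e = 1" for e
    unfolding Dd using Cauchy_Schwarz_ineq2[of e d] that by simp
  have Iq: "integrable uniform_sphere (\<lambda>e. ?q e * (e \<bullet> v))"
  proof (rule S.integrable_const_bound[where B="(?B + 2 * t * norm d) * norm v"])
    show "AE e in uniform_sphere. norm (?q e * (e \<bullet> v)) \<le> (?B + 2 * t * norm d) * norm v"
      using AE_uniform_sphere
    proof eventually_elim
      fix e :: 'a assume e: "norm e = 1"
      have "\<bar>2 * t * D e\<bar> \<le> 2 * t * norm d" using Dle[OF e] t by (simp add: abs_mult)
      then have "\<bar>?q e\<bar> \<le> ?B + 2 * t * norm d" using q[OF e] by linarith
      moreover have "\<bar>e \<bullet> v\<bar> \<le> norm v" using Cauchy_Schwarz_ineq2[of e v] e by simp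
      ultimately show "norm (?q e * (e \<bullet> v)) \<le> (?B + 2 * t * norm d) * norm v"
        unfolding real_norm_def abs_mult using B0 t by (intro mult_mono) auto
    qed
  qed measurable
  have ID: "integrable uniform_sphere (\<lambda>e. 2 * t * ((e \<bullet> d) * (e \<bullet> v)))"
  proof (rule S.integrable_const_bound[where B="2 * t * (norm d * norm v)"])
    show "AE e in uniform_sphere. norm (2 * t * ((e \<bullet> d) * (e \<bullet> v))) \<le> 2 * t * (norm d * norm v)"
      using AE_uniform_sphere
    proof eventually_elim
      fix e :: 'a assume e: "norm e = 1"
      have "\<bar>e \<bullet> d\<bar> * \<bar>e \<bullet> v\<bar> \<le> norm d * norm v"
        using Cauchy_Schwarz_ineq2[of e d] Cauchy_Schwarz_ineq2[of e v] e by (intro mult_mono) auto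
      then show "norm (2 * t * ((e \<bullet> d) * (e \<bullet> v))) \<le> 2 * t * (norm d * norm v)"
        using t by (simp add: abs_mult)
    qed
  qed measurable
  have IB: "integrable uniform_sphere (\<lambda>e. ?B * \<bar>e \<bullet> v\<bar>)"
    by (intro integrable_mult_right uniform_sphere_abs_moment)
  have "(\<integral>e. 2 * t * ((e \<bullet> d) * (e \<bullet> v)) - ?B * \<bar>e \<bullet> v\<bar> \<partial>uniform_sphere) \<le> (\<integral>e. ?q e * (e \<bullet> v) \<partial>uniform_sphere)"
  proof (rule integral_mono_AE[OF _ Iq])
    show "integrable uniform_sphere (\<lambda>e. 2 * t * ((e \<bullet> d) * (e \<bullet> v)) - ?B * \<bar>e \<bullet> v\<bar>)"
      by (rule Bochner_Integration.integrable_diff[OF ID IB])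
    show "AE e in uniform_sphere. 2 * t * ((e \<bullet> d) * (e \<bullet> v)) - ?B * \<bar>e \<bullet> v\<bar> \<le> ?q e * (e \<bullet> v)"
      using AE_uniform_sphere
    proof eventually_elim
      fix e :: 'a assume e: "norm e = 1"
      have "\<bar>(?q e - 2 * t * D e) * (e \<bullet> v)\<bar> \<le> ?B * \<bar>e \<bullet> v\<bar>"
        unfolding abs_mult by (rule mult_right_mono[OF q[OF e]]) simp
      then have "- (?B * \<bar>e \<bullet> v\<bar>) \<le> (?q e - 2 * t * D e) * (e \<bullet> v)" by (simp add: abs_le_iff)
      then show "2 * t * ((e \<bullet> d) * (e \<bullet> v)) - ?B * \<bar>e \<bullet> v\<bar> \<le> ?q e * (e \<bullet> v)"
        unfolding Dd left_diff_distrib mult.assoc by linarith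
    qed
  qed
  moreover have "(\<integral>e. 2 * t * ((e \<bullet> d) * (e \<bullet> v)) - ?B * \<bar>e \<bullet> v\<bar> \<partial>uniform_sphere)
    = 2 * t * ((d \<bullet> v) / ?n) - ?B * (\<integral>e. \<bar>e \<bullet> v\<bar> \<partial>uniform_sphere)"
    by (subst Bochner_Integration.integral_diff[OF ID IB]) (simp add: uniform_sphere_second_moment)
  moreover have "?B * (\<integral>e. \<bar>e \<bullet> v\<bar> \<partial>uniform_sphere) \<le> ?B * (norm v / sqrt ?n)"
    by (rule mult_left_mono[OF uniform_sphere_abs_moment(2) B0])
  ultimately have "2 * t * ((d \<bullet> v) / ?n) - ?B * (norm v / sqrt ?n) \<le> (\<integral>e. ?q e * (e \<bullet> v) \<partial>uniform_sphere)"
    by linarith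
  then have "?n / (2 * t) * (2 * t * ((d \<bullet> v) / ?n) - ?B * (norm v / sqrt ?n)) \<le> ?n / (2 * t) * (\<integral>e. ?q e * (e \<bullet> v) \<partial>uniform_sphere)"
    using t by (intro mult_left_mono) auto
  also have "?n / (2 * t) * (2 * t * ((d \<bullet> v) / ?n) - ?B * (norm v / sqrt ?n))
    = D v - sqrt ?n * L * t powr (\<beta> - 1) * kernel_kappa_beta \<beta> K / 2 * norm v"
  proof -
    have s: "?n / sqrt ?n = sqrt ?n" by (rule real_div_sqrt) simp
    have p: "t powr \<beta> / t = t powr (\<beta> - 1)" using t by (simp add: powr_diff)
    have "?n / (2 * t) * (2 * t * ((d \<bullet> v) / ?n) - ?B * (norm v / sqrt ?n))
      = d \<bullet> v - (?n / sqrt ?n) * L * (t powr \<beta> / t) * kernel_kappa_beta \<beta> K / 2 * norm v"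
      using t by (simp add: field_simps)
    then show ?thesis unfolding s p Dd by (simp add: inner_commute)
  qed
  finally show ?thesis .
qed

lemma nn_integral_uniform_sphere_uminus:
  fixes f :: "'a::euclidean_space \<Rightarrow> ennreal"
  assumes [measurable]: "f \<in> borel_measurable borel"
  shows "(\<integral>\<^sup>+e. f (- e) \<partial>uniform_sphere) = (\<integral>\<^sup>+e. f e \<partial>uniform_sphere)"
  using nn_integral_distr[of uminus uniform_sphere borel f] distr_uniform_sphere_uminus[where 'a='a] by simp

text \<open>The reflection \<open>e \<mapsto> - e\<close> removes the cross term between the symmetric difference and the noise.\<close>

lemma symmetric_difference_second_moment:
  fixes \<phi> :: "'a::euclidean_space \<Rightarrow> real"
  assumes lip: "\<And>e e'. norm e = 1 \<Longrightarrow> norm e' = 1 \<Longrightarrow> \<bar>\<phi> (z + s *\<^sub>R e) - \<phi> (z + s *\<^sub>R e')\<bar> \<le> M * norm (s *\<^sub>R e - s *\<^sub>R e')"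
    and M: "M \<ge> 0" and diff: "\<And>z. \<phi> differentiable (at z)" and [measurable]: "\<phi> \<in> borel_measurable borel"
  shows "(\<integral>\<^sup>+e. ennreal ((\<phi> (z + s *\<^sub>R e) - \<phi> (z - s *\<^sub>R e) + \<delta>)\<^sup>2) \<partial>uniform_sphere) \<le> ennreal (64 * M\<^sup>2 * s\<^sup>2 / DIM('a) + \<delta>\<^sup>2)"
proof -
  define h where "h = (\<lambda>e. \<phi> (z + s *\<^sub>R e) - \<phi> (z - s *\<^sub>R e))"
  interpret S: prob_space "uniform_sphere :: 'a measure" by (rule prob_space_uniform_sphere)
  have [measurable]: "h \<in> borel_measurable borel" unfolding h_def by measurable
  have odd: "h (- e) = - h e" for e by (simp add: h_def)
  \<comment> \<open>Both evaluation points move with the direction, which doubles the constant;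
    squared, this gives the factor 4 that turns the 16 of the variance bound into 64.\<close>
  have hlip: "\<bar>h e - h e'\<bar> \<le> 2 * M * \<bar>s\<bar> * norm (e - e')" if e: "norm e = 1" "norm e' = 1" for e e'
  proof -
    have n: "norm (s *\<^sub>R e - s *\<^sub>R e') = \<bar>s\<bar> * norm (e - e')"
      by (simp flip: scaleR_diff_right)
    have n': "norm (s *\<^sub>R (- e) - s *\<^sub>R (- e')) = \<bar>s\<bar> * norm (e - e')"
      unfolding scaleR_diff_right[symmetric] by (simp add: norm_minus_commute)
    show ?thesis
      using lip[OF e] lip[of "- e" "- e'"] e unfolding n n' h_def by simp
  qed
  have hdiff: "h differentiable (at e)" for e
  proof -
    have "(\<lambda>e. \<phi> (z + s *\<^sub>R e)) differentiable (at e)" "(\<lambda>e. \<phi> (z - s *\<^sub>R e)) differentiable (at e)"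
      by (rule differentiable_chain_at[unfolded comp_def, of _ _ \<phi>];
          intro diff differentiable_add differentiable_diff differentiable_const differentiable_scaleR differentiable_ident)+
    then show ?thesis unfolding h_def by (rule differentiable_diff)
  qed
  have V: "(\<integral>\<^sup>+e. ennreal ((h e)\<^sup>2) \<partial>uniform_sphere) \<le> ennreal (16 * (2 * M * \<bar>s\<bar>)\<^sup>2 / DIM('a))"
    by (rule uniform_sphere_odd_variance) (use odd hlip hdiff M in auto)
  have "(\<integral>\<^sup>+e. ennreal ((h e + \<delta>)\<^sup>2) \<partial>uniform_sphere) + (\<integral>\<^sup>+e. ennreal ((h (- e) + \<delta>)\<^sup>2) \<partial>uniform_sphere)
     = (\<integral>\<^sup>+e. ennreal ((h e + \<delta>)\<^sup>2) + ennreal ((h (- e) + \<delta>)\<^sup>2) \<partial>uniform_sphere)"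
    by (rule nn_integral_add[symmetric]) auto
  also have "\<dots> = (\<integral>\<^sup>+e. 2 * (ennreal ((h e)\<^sup>2) + ennreal (\<delta>\<^sup>2)) \<partial>uniform_sphere)"
  proof (intro nn_integral_cong)
    fix e :: 'a
    have "ennreal ((h e + \<delta>)\<^sup>2) + ennreal ((h (- e) + \<delta>)\<^sup>2) = ennreal (2 * ((h e)\<^sup>2 + \<delta>\<^sup>2))"
      unfolding odd by (subst ennreal_plus[symmetric], simp, simp, rule arg_cong[where f=ennreal])
        (simp add: power2_eq_square algebra_simps)
    also have "\<dots> = 2 * (ennreal ((h e)\<^sup>2) + ennreal (\<delta>\<^sup>2))"
      by (subst ennreal_mult) auto
    finally show "ennreal ((h e + \<delta>)\<^sup>2) + ennreal ((h (- e) + \<delta>)\<^sup>2) = 2 * (ennreal ((h e)\<^sup>2) + ennreal (\<delta>\<^sup>2))" .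
  qed
  also have "\<dots> = 2 * ((\<integral>\<^sup>+e. ennreal ((h e)\<^sup>2) \<partial>uniform_sphere) + ennreal (\<delta>\<^sup>2))"
    by (simp add: nn_integral_cmult nn_integral_add S.emeasure_space_1[simplified])
  also have "(\<integral>\<^sup>+e. ennreal ((h (- e) + \<delta>)\<^sup>2) \<partial>uniform_sphere) = (\<integral>\<^sup>+e. ennreal ((h e + \<delta>)\<^sup>2) \<partial>uniform_sphere)"
    by (rule nn_integral_uniform_sphere_uminus) measurable
  finally have "2 * (\<integral>\<^sup>+e. ennreal ((h e + \<delta>)\<^sup>2) \<partial>uniform_sphere) = 2 * ((\<integral>\<^sup>+e. ennreal ((h e)\<^sup>2) \<partial>uniform_sphere) + ennreal (\<delta>\<^sup>2))"
    by (simp add: mult_2)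
  then have "(\<integral>\<^sup>+e. ennreal ((h e + \<delta>)\<^sup>2) \<partial>uniform_sphere) = (\<integral>\<^sup>+e. ennreal ((h e)\<^sup>2) \<partial>uniform_sphere) + ennreal (\<delta>\<^sup>2)"
    by (subst (asm) ennreal_mult_cancel_left) auto
  also have "\<dots> \<le> ennreal (16 * (2 * M * \<bar>s\<bar>)\<^sup>2 / DIM('a)) + ennreal (\<delta>\<^sup>2)"
    by (rule add_right_mono[OF V])
  also have "\<dots> = ennreal (64 * M\<^sup>2 * s\<^sup>2 / DIM('a) + \<delta>\<^sup>2)"
    by (subst ennreal_plus[symmetric]) (auto simp: power_mult_distrib)
  finally show ?thesis unfolding h_def .
qed

text \<open>\<open>V\<close> is only known to be measurable for the algebra generated by
  \<open>V0\<close>; its events are then among those of \<open>V0\<close> and inherit the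
  independence. So the iterate need not be written as an explicit function of the past.\<close>

lemma indep_rv_joint_distr:
  assumes P: "prob_space P" and ind: "indep_rv P S W T V0"
    and V: "V \<in> measurable (vimage_algebra (space P) V0 T) S'"
  shows "distr P (S \<Otimes>\<^sub>M S') (\<lambda>\<omega>. (W \<omega>, V \<omega>)) = distr P S W \<Otimes>\<^sub>M distr P S' V"
proof -
  interpret prob_space P by (rule P)
  have W [measurable]: "W \<in> measurable P S" and V0: "V0 \<in> measurable P T"
    and I: "indep_set (sets (vimage_algebra (space P) W S)) (sets (vimage_algebra (space P) V0 T))"
    using ind by (auto simp: indep_rv_def)
  have VP [measurable]: "V \<in> measurable P S'"
  proof -
    have "sets (vimage_algebra (space P) V0 T) \<subseteq> sets P"
      using V0 by (auto simp: sets_vimage_algebra2 measurable_def)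
    then show ?thesis
      using V measurable_mono[of S' S' "vimage_algebra (space P) V0 T" P] by auto
  qed
  interpret A: prob_space "distr P S W" by (rule prob_space_distr) measurable
  interpret B: prob_space "distr P S' V" by (rule prob_space_distr) measurable
  show ?thesis
  proof (rule pair_measure_eqI[symmetric])
    fix X Y assume "X \<in> sets (distr P S W)" "Y \<in> sets (distr P S' V)"
    then have X [measurable]: "X \<in> sets S" and Y [measurable]: "Y \<in> sets S'" by auto
    have 1: "W -` X \<inter> space P \<in> sets (vimage_algebra (space P) W S)"
      using X by (rule in_vimage_algebra)
    have 2: "V -` Y \<inter> space P \<in> sets (vimage_algebra (space P) V0 T)"
      using measurable_sets[OF V Y] by simp
    have "emeasure (distr P (S \<Otimes>\<^sub>M S') (\<lambda>\<omega>. (W \<omega>, V \<omega>))) (X \<times> Y) = emeasure P ((W -` X \<inter> space P) \<inter> (V -` Y \<inter> space P))"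
      by (subst emeasure_distr) (auto intro!: arg_cong[where f="emeasure P"])
    also have "\<dots> = emeasure P (W -` X \<inter> space P) * emeasure P (V -` Y \<inter> space P)"
      using indep_setD[OF I 1 2] by (simp add: emeasure_eq_measure ennreal_mult)
    also have "\<dots> = emeasure (distr P S W) X * emeasure (distr P S' V) Y"
      by (simp add: emeasure_distr)
    finally show "emeasure (distr P S W) X * emeasure (distr P S' V) Y = emeasure (distr P (S \<Otimes>\<^sub>M S') (\<lambda>\<omega>. (W \<omega>, V \<omega>))) (X \<times> Y)"
      by simp
  qed (auto simp: A.sigma_finite_measure_axioms B.sigma_finite_measure_axioms)
qed

section \<open>The stochastic projected gradient iteration\<close>

definition flip_snd :: "'a::real_vector \<times> 'b::real_vector \<Rightarrow> 'a \<times> 'b" where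
  "flip_snd p = (fst p, - snd p)"

lemma norm_flip_snd [simp]: "norm (flip_snd (p :: 'a::real_normed_vector \<times> 'b::real_normed_vector)) = norm p"
  by (cases p) (simp add: flip_snd_def norm_Pair)

text \<open>By self-adjointness the sign change of the ascent component moves from the random
  direction to the difference of points, and the direction meets the plain derivative of the
  objective.\<close>

lemma inner_flip_snd: "flip_snd p \<bullet> q = p \<bullet> flip_snd (q :: 'a::real_inner \<times> 'b::real_inner)"
  by (simp add: flip_snd_def inner_prod_def)

lemma flip_snd_measurable [measurable]:
  "flip_snd \<in> borel_measurable (borel :: ('a::euclidean_space \<times> 'b::euclidean_space) measure)"
  unfolding flip_snd_def by (intro borel_measurable_continuous_onI continuous_intros)

lemma zo_gradient_eq:
  fixes z :: "'a::euclidean_space \<times> 'b::euclidean_space"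
  shows "zo_gradient \<phi> K t z e r a b =
    (DIM('a \<times> 'b) / (2 * t) * ((\<phi> (z + (t * r) *\<^sub>R e) - \<phi> (z - (t * r) *\<^sub>R e) + (a - b)) * K r)) *\<^sub>R flip_snd e"
  unfolding zo_gradient_def Let_def flip_snd_def by (simp only: add_diff_add mult.assoc)

lemma zo_gradient_measurable [measurable (raw)]:
  fixes \<phi> :: "'a::euclidean_space \<times> 'b::euclidean_space \<Rightarrow> real"
  assumes [measurable]: "\<phi> \<in> borel_measurable borel" "K \<in> borel_measurable borel"
    "z \<in> borel_measurable A" "e \<in> borel_measurable A" "r \<in> borel_measurable A" "a \<in> borel_measurable A" "b \<in> borel_measurable A"
  shows "(\<lambda>\<omega>. zo_gradient \<phi> K t (z \<omega>) (e \<omega>) (r \<omega>) (a \<omega>) (b \<omega>)) \<in> borel_measurable A"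
  unfolding zo_gradient_eq by measurable

text \<open>Of the radii only \<open>0 < \<tau> k \<and> \<tau> k \<le> \<tau> 1\<close> is assumed,
  which keeps the evaluation points in the two neighbourhoods; the explicit formula enters in
  \<open>step_error_sum\<close>.\<close>

locale zo_method = prob_space P + smoothing \<beta> K
  for P :: "'w measure" and \<beta> :: real and K :: "real \<Rightarrow> real" +
  fixes X :: "'a::euclidean_space set" and Y :: "'b::euclidean_space set"
    and \<phi> :: "'a \<times> 'b \<Rightarrow> real" and \<mu> L \<epsilon>\<^sub>0 M \<sigma> :: real and \<tau> \<gamma> :: "nat \<Rightarrow> real" and N :: nat
    and e z :: "nat \<Rightarrow> 'w \<Rightarrow> 'a \<times> 'b" and r \<xi>p \<xi>m :: "nat \<Rightarrow> 'w \<Rightarrow> real" and z\<^sub>1 :: "'a \<times> 'b"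
  assumes X: "compact X" "convex X" and Y: "compact Y" "convex Y"
    and \<mu>: "\<mu> > 0" and L: "L > 0"
    and \<tau>: "\<And>k. k \<in> {1..N} \<Longrightarrow> 0 < \<tau> k \<and> \<tau> k \<le> \<tau> 1"
    and \<gamma>: "\<And>k. k \<in> {1..N} \<Longrightarrow> \<gamma> k = 2 / (\<mu> * real k)"
    and \<epsilon>\<^sub>0: "\<tau> 1 \<le> \<epsilon>\<^sub>0"
    and \<phi>: "\<phi> \<in> saddle_holder_class \<epsilon>\<^sub>0 X Y \<mu> \<beta> L"
    and lipschitz: "M-lipschitz_on (neighbourhood (\<tau> 1) (X \<times> Y)) \<phi>"
    and draws: "uniform_draws P N e r"
    and noise: "noise_model P N \<sigma> e r \<xi>p \<xi>m"
    and z\<^sub>1: "z\<^sub>1 \<in> X \<times> Y"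
    and iterates: "zo_iterates P N \<phi> (X \<times> Y) K \<tau> \<gamma> e r \<xi>p \<xi>m z\<^sub>1 z"
begin

abbreviation "Z \<equiv> X \<times> Y"

definition g where "g k \<omega> = zo_gradient \<phi> K (\<tau> k) (z k \<omega>) (e k \<omega>) (r k \<omega>) (\<xi>p k \<omega>) (\<xi>m k \<omega>)"

lemma Z: "compact Z" "convex Z" "closed Z" "Z \<noteq> {}"
  using X Y z\<^sub>1 by (auto intro: compact_Times convex_Times compact_imp_closed)

lemma phi_diff: "\<phi> differentiable (at p)"
proof -
  have "times_differentiable (smoothness_order \<beta>) \<phi>"
    using \<phi> by (simp add: saddle_holder_class_def holder_class_def)
  moreover obtain l where "smoothness_order \<beta> = Suc l" using smoothness_order_ge by (cases "smoothness_order \<beta>") auto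
  ultimately show ?thesis by (cases p) auto
qed

lemma phi_meas [measurable]: "\<phi> \<in> borel_measurable borel"
  using phi_diff by (intro borel_measurable_continuous_onI continuous_at_imp_continuous_on ballI differentiable_imp_continuous_within)

lemma M: "M \<ge> 0" using lipschitz lipschitz_on_nonneg by blast

lemma phi_holder:
  assumes "p \<in> Z" "k \<in> {1..N}" "\<bar>s\<bar> < 1" "norm v = 1"
  shows "\<bar>\<phi> (p + (\<tau> k * s) *\<^sub>R v) - taylor_poly (smoothness_order \<beta>) \<phi> p (p + (\<tau> k * s) *\<^sub>R v)\<bar>
    \<le> L * norm ((\<tau> k * s) *\<^sub>R v) powr \<beta>"
proof -
  have "\<tau> k * \<bar>s\<bar> < \<tau> k * 1" using \<tau>[OF assms(2)] assms(3) by (intro mult_strict_left_mono) auto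
  moreover have "norm ((\<tau> k * s) *\<^sub>R v) = \<tau> k * \<bar>s\<bar>" using \<tau>[OF assms(2)] assms(4) by (simp add: abs_mult)
  ultimately have lt: "norm ((\<tau> k * s) *\<^sub>R v) < \<epsilon>\<^sub>0" using \<tau>[OF assms(2)] \<epsilon>\<^sub>0 by linarith
  have "p + (\<tau> k * s) *\<^sub>R v \<in> neighbourhood \<epsilon>\<^sub>0 Z"
    unfolding neighbourhood_def using assms(1) lt by (intro UN_I[of p]) (auto simp: dist_norm)
  moreover have "p \<in> neighbourhood \<epsilon>\<^sub>0 Z"
    unfolding neighbourhood_def using assms(1) \<tau>[OF assms(2)] \<epsilon>\<^sub>0 by (intro UN_I[of p]) auto
  ultimately have "\<bar>\<phi> (p + (\<tau> k * s) *\<^sub>R v) - taylor_poly (smoothness_order \<beta>) \<phi> p (p + (\<tau> k * s) *\<^sub>R v)\<bar>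
    \<le> L * norm ((p + (\<tau> k * s) *\<^sub>R v) - p) powr \<beta>"
    using \<phi> unfolding saddle_holder_class_def holder_class_def by blast
  then show ?thesis by simp
qed

lemma phi_lipschitz:
  assumes "p \<in> Z" "k \<in> {1..N}" "\<bar>s\<bar> < 1" "norm v = 1" "norm w = 1"
  shows "\<bar>\<phi> (p + (\<tau> k * s) *\<^sub>R v) - \<phi> (p + (\<tau> k * s) *\<^sub>R w)\<bar> \<le> M * norm ((\<tau> k * s) *\<^sub>R v - (\<tau> k * s) *\<^sub>R w)"
proof -
  have "p + (\<tau> k * s) *\<^sub>R u \<in> neighbourhood (\<tau> 1) Z" if "norm u = 1" for u
  proof -
    have "\<tau> k * \<bar>s\<bar> < \<tau> k * 1" using \<tau>[OF assms(2)] assms(3) by (intro mult_strict_left_mono) auto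
    moreover have "norm ((\<tau> k * s) *\<^sub>R u) = \<tau> k * \<bar>s\<bar>" using \<tau>[OF assms(2)] that by (simp add: abs_mult)
    ultimately have "norm ((\<tau> k * s) *\<^sub>R u) < \<tau> 1" using \<tau>[OF assms(2)] by linarith
    then show ?thesis unfolding neighbourhood_def using assms(1) by (intro UN_I[of p]) (auto simp: dist_norm)
  qed
  from lipschitz_onD[OF lipschitz this[OF assms(4)] this[OF assms(5)]] show ?thesis
    by (simp add: dist_norm)
qed

lemma GDERIV_eq:
  assumes "GDERIV f x :> d" "(f has_derivative D) (at x)"
  shows "D v = d \<bullet> v"
proof -
  have "(f has_derivative (\<lambda>h. h \<bullet> d)) (at x)" using assms(1) by (simp add: gderiv_def)
  then have "D = (\<lambda>h. h \<bullet> d)" using assms(2) has_derivative_unique by blast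
  then show ?thesis by (simp add: inner_commute)
qed

text \<open>The class provides some gradient of each partial function; uniqueness of the derivative
  identifies it with \<open>D\<close> restricted to one factor. Adding the two tangent inequalities
  at \<open>p\<close> cancels the terms \<open>\<phi> p\<close>.\<close>

lemma gap_le_gradient:
  assumes p: "p \<in> Z" and u: "u \<in> Z" and D: "(\<phi> has_derivative D) (at p)"
  shows "\<phi> (fst p, snd u) - \<phi> (fst u, snd p) + \<mu> / 2 * (norm (p - u))\<^sup>2 \<le> D (flip_snd (p - u))"
proof -
  obtain x y where pp: "p = (x, y)" by (cases p)
  obtain x' y' where uu: "u = (x', y')" by (cases u)
  have xy: "x \<in> X" "y \<in> Y" "x' \<in> X" "y' \<in> Y" using p u pp uu by auto
  have linD: "linear D" using D has_derivative_linear by blast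
  have "((\<lambda>x. \<phi> (x, y)) has_derivative (\<lambda>v. D (v, 0))) (at x)"
    by (rule has_derivative_compose[where f="\<lambda>x. (x, y)" and g=\<phi>])
       (auto intro!: derivative_eq_intros D[unfolded pp])
  moreover obtain gx where "\<forall>u\<in>X. GDERIV (\<lambda>x. \<phi> (x, y)) u :> gx u"
    "\<forall>u\<in>X. \<forall>v\<in>X. \<phi> (v, y) \<ge> \<phi> (u, y) + gx u \<bullet> (v - u) + \<mu> / 2 * (norm (v - u))\<^sup>2"
    using \<phi> xy unfolding saddle_holder_class_def strongly_convex_on_def by blast
  ultimately have 1: "\<phi> (x', y) \<ge> \<phi> (x, y) + D (x' - x, 0) + \<mu> / 2 * (norm (x' - x))\<^sup>2"
    using xy GDERIV_eq by metis
  have "((\<lambda>y. - \<phi> (x, y)) has_derivative (\<lambda>v. - D (0, v))) (at y)"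
    by (rule has_derivative_minus, rule has_derivative_compose[where f="\<lambda>y. (x, y)" and g=\<phi>])
       (auto intro!: derivative_eq_intros D[unfolded pp])
  moreover obtain gy where "\<forall>u\<in>Y. GDERIV (\<lambda>y. - \<phi> (x, y)) u :> gy u"
    "\<forall>u\<in>Y. \<forall>v\<in>Y. - \<phi> (x, v) \<ge> - \<phi> (x, u) + gy u \<bullet> (v - u) + \<mu> / 2 * (norm (v - u))\<^sup>2"
    using \<phi> xy unfolding saddle_holder_class_def strongly_concave_on_def strongly_convex_on_def by blast
  ultimately have 2: "- \<phi> (x, y') \<ge> - \<phi> (x, y) - D (0, y' - y) + \<mu> / 2 * (norm (y' - y))\<^sup>2"
    using xy GDERIV_eq[of "\<lambda>y. - \<phi> (x, y)" y _ "\<lambda>v. - D (0, v)"] by (metis add_uminus_conv_diff)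
  have "D (flip_snd (p - u)) = D (- (x' - x, 0) + (0, y' - y))" by (simp add: flip_snd_def pp uu)
  also have "\<dots> = - D (x' - x, 0) + D (0, y' - y)"
    using linear_add[OF linD, of "- (x' - x, 0)" "(0, y' - y)"] linear_neg[OF linD, of "(x' - x, 0)"] by simp
  finally have 3: "D (flip_snd (p - u)) = - D (x' - x, 0) + D (0, y' - y)" .
  have 4: "(norm (p - u))\<^sup>2 = (norm (x' - x))\<^sup>2 + (norm (y' - y))\<^sup>2"
    by (simp add: pp uu norm_Pair norm_minus_commute)
  have "\<mu> / 2 * (norm (p - u))\<^sup>2 = \<mu> / 2 * (norm (x' - x))\<^sup>2 + \<mu> / 2 * (norm (y' - y))\<^sup>2"
    unfolding 4 by (rule distrib_left)
  moreover have "fst p = x" "snd p = y" "fst u = x'" "snd u = y'" by (simp_all add: pp uu)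
  ultimately show ?thesis unfolding 3 using 1 2 by (simp only:)
qed

lemma rv [measurable]:
  assumes "k \<in> {1..N}"
  shows "e k \<in> borel_measurable P" "r k \<in> borel_measurable P" "\<xi>p k \<in> borel_measurable P" "\<xi>m k \<in> borel_measurable P"
  using draws noise assms by (auto simp: uniform_draws_def noise_model_def)

lemma z_Suc: "z (Suc k) \<omega> = closest_point Z (z k \<omega> - \<gamma> k *\<^sub>R g k \<omega>)" if "k \<in> {1..N}" "\<omega> \<in> space P"
  using iterates that by (auto simp: zo_iterates_def g_def)

lemma z_1: "z 1 \<omega> = z\<^sub>1" if "\<omega> \<in> space P"
  using iterates that by (auto simp: zo_iterates_def)

lemma z_in: "z k \<omega> \<in> Z" if "k \<in> {1..Suc N}" "\<omega> \<in> space P"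
proof (cases "k = 1")
  case True then show ?thesis using z\<^sub>1 z_1 that by simp
next
  case False
  obtain j where j: "k = Suc j" using \<open>k \<in> {1..Suc N}\<close> by (cases k) auto
  then have "j \<in> {1..N}" using \<open>k \<in> {1..Suc N}\<close> False by auto
  then show ?thesis using j z_Suc[of j \<omega>] that closest_point_in_set[OF Z(3,4)] by simp
qed

lemma closest_point_measurable [measurable]: "closest_point Z \<in> borel_measurable borel"
  using continuous_on_closest_point[OF Z(2,3,4)] by (rule borel_measurable_continuous_onI)

text \<open>Stated for an arbitrary algebra \<open>A\<close> on the sample space, so that one
  argument serves both measurability in \<open>P\<close> and adaptedness to the past.\<close>

lemma z_Suc_measurable:
  assumes "k \<in> {1..N}" "space A = space P"
    and [measurable]: "z k \<in> borel_measurable A" "e k \<in> borel_measurable A" "r k \<in> borel_measurable A"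
      "\<xi>p k \<in> borel_measurable A" "\<xi>m k \<in> borel_measurable A"
  shows "z (Suc k) \<in> borel_measurable A"
proof -
  have "(\<lambda>\<omega>. closest_point Z (z k \<omega> - \<gamma> k *\<^sub>R g k \<omega>)) \<in> borel_measurable A"
    unfolding g_def by measurable
  then show ?thesis
    by (subst measurable_cong[where g="\<lambda>\<omega>. closest_point Z (z k \<omega> - \<gamma> k *\<^sub>R g k \<omega>)"]) (use z_Suc assms(1,2) in auto)
qed

lemma z_1_measurable: "z 1 \<in> borel_measurable A" if "space A = space P"
  by (subst measurable_cong[where g="\<lambda>\<omega>. z\<^sub>1"]) (use z_1 that in auto)

lemma z_measurable [measurable]: "z k \<in> borel_measurable P" if "k \<in> {1..Suc N}"
proof -
  have "1 \<le> k" using that by simp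
  then show ?thesis using that
  proof (induction k rule: nat_induct_at_least)
    case base show ?case by (rule z_1_measurable[OF refl])
  next
    case (Suc k) then show ?case by (intro z_Suc_measurable) (auto intro: rv)
  qed
qed

lemma g_measurable [measurable]: "g k \<in> borel_measurable P" if "k \<in> {1..N}"
proof -
  have "z k \<in> borel_measurable P" using that by (intro z_measurable) simp
  then show ?thesis unfolding g_def using rv[OF that] by (intro zo_gradient_measurable phi_meas K_meas)
qed

section \<open>Adaptedness to the past and the joint law of draw and state\<close>

definition history where
  "history k \<omega> = (\<lambda>j\<in>{1..<k}. (e j \<omega>, r j \<omega>, \<xi>p j \<omega>, \<xi>m j \<omega>), (\<xi>p k \<omega>, \<xi>m k \<omega>))"

definition history_algebra where
  "history_algebra k = vimage_algebra (space P) (history k) ((\<Pi>\<^sub>M j\<in>{1..<k}. borel) \<Otimes>\<^sub>M borel)"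

text \<open>What step \<open>k\<close> uses besides its fresh draw. The current noises are included
  because they may depend on the past and so on the iterate.\<close>

definition state where "state k \<omega> = (z k \<omega>, \<xi>p k \<omega>, \<xi>m k \<omega>)"

lemma borel_measurable_PairD:
  fixes f :: "'x \<Rightarrow> 'c::euclidean_space" and h :: "'x \<Rightarrow> 'd::euclidean_space"
  assumes "(\<lambda>\<omega>. (f \<omega>, h \<omega>)) \<in> borel_measurable A"
  shows "f \<in> borel_measurable A" "h \<in> borel_measurable A"
  using measurable_compose[OF assms fst_snd_measurable(1)] measurable_compose[OF assms fst_snd_measurable(2)] by simp_all

text \<open>Draws end at \<open>k - 1\<close> while noises run up to \<open>k\<close>: the current
  draw must stay outside the history, the current noise may enter it.\<close>

lemma history_components:
  assumes k: "k \<in> {1..N}"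
  shows "j \<in> {1..<k} \<Longrightarrow> e j \<in> borel_measurable (history_algebra k)"
    "j \<in> {1..<k} \<Longrightarrow> r j \<in> borel_measurable (history_algebra k)"
    "j \<in> {1..k} \<Longrightarrow> \<xi>p j \<in> borel_measurable (history_algebra k)"
    "j \<in> {1..k} \<Longrightarrow> \<xi>m j \<in> borel_measurable (history_algebra k)"
proof -
  let ?T = "(\<Pi>\<^sub>M j\<in>{1..<k}. borel :: (('a \<times> 'b) \<times> real \<times> real \<times> real) measure) \<Otimes>\<^sub>M (borel :: (real \<times> real) measure)"
  have "indep_rv P borel (\<lambda>\<omega>. (e k \<omega>, r k \<omega>)) ?T (history k)"
    using noise k unfolding noise_model_def history_def by blast
  then have "history k \<in> measurable P ?T" by (simp add: indep_rv_def)
  then have H: "history k \<in> measurable (history_algebra k) ?T"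
    unfolding history_algebra_def by (intro measurable_vimage_algebra1) (auto simp: measurable_def)
  have past: "(\<lambda>\<omega>. (e j \<omega>, r j \<omega>, \<xi>p j \<omega>, \<xi>m j \<omega>)) \<in> borel_measurable (history_algebra k)" if j: "j \<in> {1..<k}" for j
  proof -
    have "(\<lambda>\<omega>. fst (history k \<omega>) j) \<in> borel_measurable (history_algebra k)"
      using measurable_compose[OF measurable_compose[OF H measurable_fst] measurable_component_singleton[OF j]] by simp
    then show ?thesis using j by (simp add: history_def)
  qed
  have now: "(\<lambda>\<omega>. (\<xi>p k \<omega>, \<xi>m k \<omega>)) \<in> borel_measurable (history_algebra k)"
    using measurable_compose[OF H measurable_snd] by (simp add: history_def)
  note D = borel_measurable_PairD
  show "e j \<in> borel_measurable (history_algebra k)" "r j \<in> borel_measurable (history_algebra k)" if "j \<in> {1..<k}"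
    by (rule D(1)[OF past[OF that]], rule D(1)[OF D(2)[OF past[OF that]]])
  have pm: "\<xi>p j \<in> borel_measurable (history_algebra k)" "\<xi>m j \<in> borel_measurable (history_algebra k)" if "j \<in> {1..<k}" for j
    by (rule D(1)[OF D(2)[OF D(2)[OF past[OF that]]]], rule D(2)[OF D(2)[OF D(2)[OF past[OF that]]]])
  show "\<xi>p j \<in> borel_measurable (history_algebra k)" if "j \<in> {1..k}" using pm(1) D(1)[OF now] that by (cases "j = k") auto
  show "\<xi>m j \<in> borel_measurable (history_algebra k)" if "j \<in> {1..k}" using pm(2) D(2)[OF now] that by (cases "j = k") auto
qed

text \<open>The induction over the iterates runs inside the one algebra of step \<open>k\<close>, so
  algebras of different steps are never compared.\<close>

lemma state_adapted:
  assumes k: "k \<in> {1..N}"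
  shows "state k \<in> borel_measurable (history_algebra k)"
proof -
  have sp: "space (history_algebra k) = space P" by (simp add: history_algebra_def)
  have "z j \<in> borel_measurable (history_algebra k)" if "1 \<le> j" "j \<le> k" for j
    using that
  proof (induction j rule: nat_induct_at_least)
    case base show ?case by (rule z_1_measurable[OF sp])
  next
    case (Suc j)
    then show ?case using k history_components[OF k, of j] by (intro z_Suc_measurable sp) auto
  qed
  then have "z k \<in> borel_measurable (history_algebra k)" using k by simp
  then show ?thesis
    unfolding state_def using k history_components(3,4)[OF k, of k] by (intro borel_measurable_Pair) auto
qed

text \<open>This replaces conditional expectations: an expectation in step \<open>k\<close> becomes
  an iterated integral over the draw and the law of the state, and in the inner integral the state
  is a constant.\<close>

lemma joint_law:
  assumes k: "k \<in> {1..N}"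
  shows "distr P (borel \<Otimes>\<^sub>M borel) (\<lambda>\<omega>. ((e k \<omega>, r k \<omega>), state k \<omega>))
    = (uniform_sphere \<Otimes>\<^sub>M uniform_interval) \<Otimes>\<^sub>M distr P borel (state k)"
proof -
  have i: "indep_rv P borel (e k) borel (r k)" and
    j: "indep_rv P borel (\<lambda>\<omega>. (e k \<omega>, r k \<omega>)) ((\<Pi>\<^sub>M j\<in>{1..<k}. borel) \<Otimes>\<^sub>M borel) (history k)"
    using noise k unfolding noise_model_def history_def by blast+
  have rk: "r k \<in> borel_measurable P" using rv(2)[OF k] .
  have "distr P (borel \<Otimes>\<^sub>M borel) (\<lambda>\<omega>. (e k \<omega>, r k \<omega>)) = distr P borel (e k) \<Otimes>\<^sub>M distr P borel (r k)"
    by (rule indep_rv_joint_distr[OF prob_space_axioms i]) (rule measurable_vimage_algebra1, simp)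
  also have "\<dots> = uniform_sphere \<Otimes>\<^sub>M uniform_interval"
    using draws k by (simp add: uniform_draws_def)
  finally have "distr P borel (\<lambda>\<omega>. (e k \<omega>, r k \<omega>)) = uniform_sphere \<Otimes>\<^sub>M uniform_interval"
    by (simp add: borel_prod)
  then show ?thesis
    using indep_rv_joint_distr[OF prob_space_axioms j state_adapted[OF k, unfolded history_algebra_def]] by simp
qed

end

section \<open>Second moment and mean of the gradient estimate given the state\<close>

context zo_method
begin

abbreviation \<kappa> where "\<kappa> \<equiv> kernel_kappa K"
abbreviation \<kappa>\<^sub>\<beta> where "\<kappa>\<^sub>\<beta> \<equiv> kernel_kappa_beta \<beta> K"

text \<open>First term: n^2 / (4 tau^2) from the squared prefactor, 64 M^2 tau^2 / n from the sphere
  and kappa / 2 from the kernel. Second term: the same prefactor and kappa / 2, with the mean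
  squared noise difference bounded by \<open>4 * \<sigma>\<^sup>2\<close>.\<close>

definition second_moment_bound where "second_moment_bound k = 8 * real DIM('a \<times> 'b) * \<kappa> * M\<^sup>2 + (real DIM('a \<times> 'b))\<^sup>2 * \<kappa> * \<sigma>\<^sup>2 / (2 * (\<tau> k)\<^sup>2)"
definition bias_bound where "bias_bound k = sqrt (real DIM('a \<times> 'b)) * L * \<tau> k powr (\<beta> - 1) * \<kappa>\<^sub>\<beta> / 2"

abbreviation draw_law where
  "draw_law \<equiv> uniform_sphere \<Otimes>\<^sub>M uniform_interval :: (('a \<times> 'b) \<times> real) measure"

lemma kappa_nonneg: "\<kappa> \<ge> 0" by (simp add: kappa_eq)

lemma pair_sigma_finite_SU: "pair_sigma_finite (uniform_sphere :: ('a \<times> 'b) measure) uniform_interval"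
  by (intro pair_sigma_finite.intro prob_space_imp_sigma_finite prob_space_uniform_sphere prob_space_uniform_interval)

lemma prob_space_SU: "prob_space draw_law"
  by (intro prob_space_pair prob_space_uniform_sphere prob_space_uniform_interval)

lemma sets_SU [measurable_cong]: "sets draw_law = sets borel"
  by (metis borel_prod sets_pair_measure_cong sets_uniform_interval sets_uniform_sphere)

text \<open>The direction is integrated first, for fixed \<open>r\<close>: the integrand is then the
  square of an odd function on the sphere plus a constant, as the variance bound requires. What
  remains is the mean of the squared kernel, which is \<open>\<kappa> / 2\<close>.\<close>

lemma gradient_second_moment_state:
  assumes k: "k \<in> {1..N}" and p: "p \<in> Z"
  shows "(\<integral>\<^sup>+w. ennreal ((norm (zo_gradient \<phi> K (\<tau> k) p (fst w) (snd w) a b'))\<^sup>2) \<partial>draw_law)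
    \<le> ennreal ((real DIM('a \<times> 'b) / (2 * \<tau> k))\<^sup>2 * (64 * M\<^sup>2 * (\<tau> k)\<^sup>2 / real DIM('a \<times> 'b) + (a - b')\<^sup>2) * (\<kappa> / 2))"
    (is "?lhs \<le> _")
proof -
  interpret SU: pair_sigma_finite "uniform_sphere :: ('a \<times> 'b) measure" uniform_interval by (rule pair_sigma_finite_SU)
  define c where "c = (real DIM('a \<times> 'b) / (2 * \<tau> k))\<^sup>2"
  define d where "d = 64 * M\<^sup>2 * (\<tau> k)\<^sup>2 / real DIM('a \<times> 'b) + (a - b')\<^sup>2"
  have d0: "d \<ge> 0" and c0: "c \<ge> 0" by (auto simp: d_def c_def)
  let ?g2 = "\<lambda>e r. (norm (zo_gradient \<phi> K (\<tau> k) p e r a b'))\<^sup>2"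
  let ?h = "\<lambda>e r. \<phi> (p + (\<tau> k * r) *\<^sub>R e) - \<phi> (p - (\<tau> k * r) *\<^sub>R e) + (a - b')"
  have F [measurable]: "(\<lambda>w. ennreal ((norm (zo_gradient \<phi> K (\<tau> k) p (fst w) (snd w) a b'))\<^sup>2))
      \<in> borel_measurable draw_law"
    by measurable
  have "?lhs
      = (\<integral>\<^sup>+r. \<integral>\<^sup>+e. ennreal (?g2 e r) \<partial>uniform_sphere \<partial>uniform_interval)"
    using SU.nn_integral_snd[OF F] by simp
  also have "\<dots> \<le> (\<integral>\<^sup>+r. ennreal (c * d * (K r)\<^sup>2) \<partial>uniform_interval)"
  proof (rule nn_integral_mono_AE, use AE_uniform_interval in eventually_elim)
    fix r :: real assume r: "\<bar>r\<bar> < 1"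
    have "(\<integral>\<^sup>+e. ennreal (?g2 e r) \<partial>uniform_sphere)
        = (\<integral>\<^sup>+e. ennreal (c * (K r)\<^sup>2) * ennreal ((?h e r)\<^sup>2) \<partial>uniform_sphere)"
    proof (rule nn_integral_cong_AE, use AE_uniform_sphere in eventually_elim)
      fix e :: "'a \<times> 'b" assume "norm e = 1"
      then have "?g2 e r = (real DIM('a \<times> 'b) / (2 * \<tau> k) * (?h e r * K r))\<^sup>2"
        unfolding zo_gradient_eq by (simp only: norm_scaleR norm_flip_snd mult_1_right real_norm_def power2_abs)
      also have "\<dots> = c * (K r)\<^sup>2 * (?h e r)\<^sup>2" unfolding c_def by (simp only: power_mult_distrib mult_ac)
      finally show "ennreal (?g2 e r) = ennreal (c * (K r)\<^sup>2) * ennreal ((?h e r)\<^sup>2)"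
        using c0 by (simp add: ennreal_mult)
    qed
    also have "\<dots> = ennreal (c * (K r)\<^sup>2) * (\<integral>\<^sup>+e. ennreal ((?h e r)\<^sup>2) \<partial>uniform_sphere)"
      by (rule nn_integral_cmult) measurable
    also have "\<dots> \<le> ennreal (c * (K r)\<^sup>2) * ennreal d"
    proof (rule mult_left_mono)
      have "(\<integral>\<^sup>+e. ennreal ((?h e r)\<^sup>2) \<partial>uniform_sphere) \<le> ennreal (64 * M\<^sup>2 * (\<tau> k * r)\<^sup>2 / real DIM('a \<times> 'b) + (a - b')\<^sup>2)"
        by (rule symmetric_difference_second_moment[OF phi_lipschitz[OF p k r] M phi_diff phi_meas])
      also have "\<dots> \<le> ennreal d"
      proof (rule ennreal_leI)
        have "r\<^sup>2 \<le> 1" using r by (simp add: abs_square_le_1)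
        then have "M\<^sup>2 * (\<tau> k)\<^sup>2 * r\<^sup>2 \<le> M\<^sup>2 * (\<tau> k)\<^sup>2 * 1" by (intro mult_left_mono) auto
        then have "64 * M\<^sup>2 * (\<tau> k * r)\<^sup>2 / real DIM('a \<times> 'b) \<le> 64 * M\<^sup>2 * (\<tau> k)\<^sup>2 / real DIM('a \<times> 'b)"
          by (intro divide_right_mono) (auto simp: power_mult_distrib)
        then show "64 * M\<^sup>2 * (\<tau> k * r)\<^sup>2 / real DIM('a \<times> 'b) + (a - b')\<^sup>2 \<le> d" unfolding d_def by linarith
      qed
      finally show "(\<integral>\<^sup>+e. ennreal ((?h e r)\<^sup>2) \<partial>uniform_sphere) \<le> ennreal d" .
    qed simp
    also have "\<dots> = ennreal (c * d * (K r)\<^sup>2)"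
      using c0 d0 by (simp add: ennreal_mult[symmetric] mult_ac)
    finally show "(\<integral>\<^sup>+e. ennreal (?g2 e r) \<partial>uniform_sphere) \<le> ennreal (c * d * (K r)\<^sup>2)" .
  qed
  also have "\<dots> = ennreal (\<integral>r. c * d * (K r)\<^sup>2 \<partial>uniform_interval)"
    using c0 d0 by (intro nn_integral_eq_integral integrable_mult_right K_sq_int) auto
  also have "(\<integral>r. c * d * (K r)\<^sup>2 \<partial>uniform_interval) = c * d * (\<kappa> / 2)" by (simp add: kappa_eq)
  finally show ?thesis unfolding c_def d_def .
qed

lemma prob_space_state: "k \<in> {1..N} \<Longrightarrow> prob_space (distr P borel (state k))"
  using rv z_measurable[of k] unfolding state_def by (intro prob_space_distr borel_measurable_Pair) auto

lemma state_measurable [measurable]: "k \<in> {1..N} \<Longrightarrow> state k \<in> borel_measurable P"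
  using rv z_measurable[of k] unfolding state_def by (intro borel_measurable_Pair) auto

lemma AE_state: 
  assumes "k \<in> {1..N}"
  shows "AE s in distr P borel (state k). fst s \<in> Z"
proof (subst AE_distr_iff)
  have [measurable]: "Z \<in> sets borel" using Z by (intro borel_closed)
  show "{x \<in> space borel. fst x \<in> Z} \<in> sets (borel :: (('a \<times> 'b) \<times> real \<times> real) measure)"
    by measurable
  show "AE \<omega> in P. fst (state k \<omega>) \<in> Z"
    using assms z_in[of k] by (intro AE_I2) (simp add: state_def)
qed (rule state_measurable[OF assms])

definition G :: "nat \<Rightarrow> ('a \<times> 'b) \<times> real \<Rightarrow> ('a \<times> 'b) \<times> real \<times> real \<Rightarrow> 'a \<times> 'b" where
  "G k w s = zo_gradient \<phi> K (\<tau> k) (fst s) (fst w) (snd w) (fst (snd s)) (snd (snd s))"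

lemma G_measurable: "(\<lambda>(w, s). G k w s) \<in> borel_measurable (borel \<Otimes>\<^sub>M borel)"
  unfolding G_def case_prod_beta by measurable

lemma g_eq_G: "g k \<omega> = G k (e k \<omega>, r k \<omega>) (state k \<omega>)"
  by (simp add: g_def G_def state_def)

lemma pair_sigma_finite_state:
  "k \<in> {1..N} \<Longrightarrow> pair_sigma_finite draw_law (distr P borel (state k))"
  by (intro pair_sigma_finite.intro prob_space_imp_sigma_finite prob_space_SU prob_space_state)

lemma draw_state_measurable:
  assumes "k \<in> {1..N}"
  shows "(\<lambda>\<omega>. ((e k \<omega>, r k \<omega>), state k \<omega>)) \<in> measurable P (borel \<Otimes>\<^sub>M borel)"
  using rv[OF assms] state_measurable[OF assms] by measurable

lemma gradient_second_moment:
  assumes k: "k \<in> {1..N}"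
  shows "(\<integral>\<^sup>+\<omega>. ennreal ((norm (g k \<omega>))\<^sup>2) \<partial>P) \<le> ennreal (second_moment_bound k)"
proof -
  let ?Q = "distr P borel (state k)" and ?D = draw_law
  interpret DQ: pair_sigma_finite ?D ?Q by (rule pair_sigma_finite_state[OF k])
  let ?F = "\<lambda>(w, s). ennreal ((norm (G k w s))\<^sup>2)"
  have F: "?F \<in> borel_measurable (borel \<Otimes>\<^sub>M borel)"
    using G_measurable[of k] by (auto simp: case_prod_beta intro!: measurable_compose[OF borel_measurable_power[OF borel_measurable_norm]])
  then have F': "?F \<in> borel_measurable (?D \<Otimes>\<^sub>M ?Q)"
    by (subst measurable_cong_sets[OF sets_pair_measure_cong[OF sets_SU sets_distr] refl])
  define A where "A = (real DIM('a \<times> 'b) / (2 * \<tau> k))\<^sup>2 * (64 * M\<^sup>2 * (\<tau> k)\<^sup>2 / real DIM('a \<times> 'b)) * (\<kappa> / 2)"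
  define B where "B = (real DIM('a \<times> 'b) / (2 * \<tau> k))\<^sup>2 * \<kappa>"
  define m where "m = real DIM('a \<times> 'b)"
  have m: "m > 0" unfolding m_def by (simp only: of_nat_0_less_iff DIM_positive)
  have A0: "A \<ge> 0" and B0: "B \<ge> 0" using kappa_nonneg by (auto simp: A_def B_def)
  have t: "\<tau> k > 0" using \<tau>[OF k] by simp
  have "(\<integral>\<^sup>+\<omega>. ennreal ((norm (g k \<omega>))\<^sup>2) \<partial>P) = (\<integral>\<^sup>+q. ?F q \<partial>distr P (borel \<Otimes>\<^sub>M borel) (\<lambda>\<omega>. ((e k \<omega>, r k \<omega>), state k \<omega>)))"
    by (subst nn_integral_distr[OF draw_state_measurable[OF k]]) (use F in simp, simp add: g_eq_G)
  also have "\<dots> = (\<integral>\<^sup>+s. \<integral>\<^sup>+w. ?F (w, s) \<partial>?D \<partial>?Q)"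
    unfolding joint_law[OF k] by (rule DQ.nn_integral_snd[OF F', symmetric])
  also have "\<dots> \<le> (\<integral>\<^sup>+s. ennreal (A + B * ((fst (snd s))\<^sup>2 + (snd (snd s))\<^sup>2)) \<partial>?Q)"
  proof (rule nn_integral_mono_AE, use AE_state[OF k] in eventually_elim)
    fix s :: "('a \<times> 'b) \<times> real \<times> real" assume s: "fst s \<in> Z"
    define x y where "x = fst (snd s)" and "y = snd (snd s)"
    have "(\<integral>\<^sup>+w. ?F (w, s) \<partial>?D) \<le> ennreal ((real DIM('a \<times> 'b) / (2 * \<tau> k))\<^sup>2 * (64 * M\<^sup>2 * (\<tau> k)\<^sup>2 / real DIM('a \<times> 'b) + (x - y)\<^sup>2) * (\<kappa> / 2))"
      using gradient_second_moment_state[OF k s, of x y] by (simp add: G_def x_def y_def)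
    also have "\<dots> \<le> ennreal (A + B * (x\<^sup>2 + y\<^sup>2))"
    proof (rule ennreal_leI)
      \<comment> \<open>The two noises may be correlated and biased, so their cross term is bounded
        instead of dropped.\<close>
      have "(x - y)\<^sup>2 \<le> 2 * (x\<^sup>2 + y\<^sup>2)"
        using zero_le_power2[of "x + y"] by (simp add: power2_eq_square algebra_simps)
      then have "(real DIM('a \<times> 'b) / (2 * \<tau> k))\<^sup>2 * (64 * M\<^sup>2 * (\<tau> k)\<^sup>2 / real DIM('a \<times> 'b) + (x - y)\<^sup>2) * (\<kappa> / 2)
        \<le> (real DIM('a \<times> 'b) / (2 * \<tau> k))\<^sup>2 * (64 * M\<^sup>2 * (\<tau> k)\<^sup>2 / real DIM('a \<times> 'b) + 2 * (x\<^sup>2 + y\<^sup>2)) * (\<kappa> / 2)"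
        using kappa_nonneg by (intro mult_right_mono mult_left_mono add_left_mono) auto
      also have "\<dots> = A + B * (x\<^sup>2 + y\<^sup>2)" unfolding A_def B_def m_def[symmetric] using m by (simp add: field_simps)
      finally show "(real DIM('a \<times> 'b) / (2 * \<tau> k))\<^sup>2 * (64 * M\<^sup>2 * (\<tau> k)\<^sup>2 / real DIM('a \<times> 'b) + (x - y)\<^sup>2) * (\<kappa> / 2) \<le> A + B * (x\<^sup>2 + y\<^sup>2)" .
    qed
    finally show "(\<integral>\<^sup>+w. ?F (w, s) \<partial>?D) \<le> ennreal (A + B * ((fst (snd s))\<^sup>2 + (snd (snd s))\<^sup>2))"
      by (simp add: x_def y_def)
  qed
  also have "\<dots> = (\<integral>\<^sup>+\<omega>. ennreal (A + B * ((\<xi>p k \<omega>)\<^sup>2 + (\<xi>m k \<omega>)\<^sup>2)) \<partial>P)"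
    by (subst nn_integral_distr[OF state_measurable[OF k]]) (measurable, simp add: state_def)
  also have "\<dots> \<le> ennreal (A + B * (2 * \<sigma>\<^sup>2))"
  proof -
    have i: "integrable P (\<lambda>\<omega>. (\<xi>p k \<omega>)\<^sup>2)" "integrable P (\<lambda>\<omega>. (\<xi>m k \<omega>)\<^sup>2)"
      and le: "(\<integral>\<omega>. (\<xi>p k \<omega>)\<^sup>2 \<partial>P) \<le> \<sigma>\<^sup>2" "(\<integral>\<omega>. (\<xi>m k \<omega>)\<^sup>2 \<partial>P) \<le> \<sigma>\<^sup>2"
      using noise k by (auto simp: noise_model_def)
    have "(\<integral>\<^sup>+\<omega>. ennreal (A + B * ((\<xi>p k \<omega>)\<^sup>2 + (\<xi>m k \<omega>)\<^sup>2)) \<partial>P) = ennreal (\<integral>\<omega>. A + B * ((\<xi>p k \<omega>)\<^sup>2 + (\<xi>m k \<omega>)\<^sup>2) \<partial>P)"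
      using i A0 B0 by (intro nn_integral_eq_integral) auto
    also have "(\<integral>\<omega>. A + B * ((\<xi>p k \<omega>)\<^sup>2 + (\<xi>m k \<omega>)\<^sup>2) \<partial>P) = A + B * ((\<integral>\<omega>. (\<xi>p k \<omega>)\<^sup>2 \<partial>P) + (\<integral>\<omega>. (\<xi>m k \<omega>)\<^sup>2 \<partial>P))"
      using i by (simp add: prob_space)
    also have "ennreal \<dots> \<le> ennreal (A + B * (2 * \<sigma>\<^sup>2))"
      using le B0 by (intro ennreal_leI add_left_mono mult_left_mono) auto
    finally show ?thesis .
  qed
  also have "A + B * (2 * \<sigma>\<^sup>2) = second_moment_bound k"
    unfolding A_def B_def second_moment_bound_def m_def[symmetric] using t m by (simp add: field_simps power2_eq_square)
  finally show ?thesis .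
qed

text \<open>Integrability is a hypothesis here because Fubini later grants it only for almost every
  state.\<close>

lemma gradient_inner_state:
  assumes k: "k \<in> {1..N}" and p: "p \<in> Z" and u: "u \<in> Z"
    and int: "integrable draw_law (\<lambda>w. zo_gradient \<phi> K (\<tau> k) p (fst w) (snd w) a b' \<bullet> (p - u))"
  shows "(\<integral>w. zo_gradient \<phi> K (\<tau> k) p (fst w) (snd w) a b' \<bullet> (p - u) \<partial>draw_law)
    \<ge> \<phi> (fst p, snd u) - \<phi> (fst u, snd p) + \<mu> / 4 * (norm (p - u))\<^sup>2 - (bias_bound k)\<^sup>2 / \<mu>"
    (is "?lhs \<ge> _")
proof -
  interpret SU: pair_sigma_finite "uniform_sphere :: ('a \<times> 'b) measure" uniform_interval by (rule pair_sigma_finite_SU)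
  obtain D where D: "(\<phi> has_derivative D) (at p)" using phi_diff[of p] unfolding differentiable_def by blast
  have t: "\<tau> k > 0" using \<tau>[OF k] by simp
  define v where "v = flip_snd (p - u)"
  let ?gv = "\<lambda>e r. zo_gradient \<phi> K (\<tau> k) p e r a b' \<bullet> (p - u)"
  let ?hK = "\<lambda>e r. (\<phi> (p + (\<tau> k * r) *\<^sub>R e) - \<phi> (p - (\<tau> k * r) *\<^sub>R e)) * K r"
  let ?q = "\<lambda>e. \<integral>r. ?hK e r \<partial>uniform_interval"
  have [measurable]: "?q \<in> borel_measurable borel"
    by (rule U.borel_measurable_lebesgue_integral) measurable
  have "?lhs
     = (\<integral>e. \<integral>r. ?gv e r \<partial>uniform_interval \<partial>uniform_sphere)"
    using SU.integral_fst'[OF int] by simp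
  also have "\<dots> = (\<integral>e. real DIM('a \<times> 'b) / (2 * \<tau> k) * (?q e * (e \<bullet> v)) \<partial>uniform_sphere)"
  proof (rule integral_cong_AE)
    show "(\<lambda>e. \<integral>r. ?gv e r \<partial>uniform_interval) \<in> borel_measurable uniform_sphere"
      by (rule U.borel_measurable_lebesgue_integral) measurable
    show "AE e in uniform_sphere. (\<integral>r. ?gv e r \<partial>uniform_interval)
        = real DIM('a \<times> 'b) / (2 * \<tau> k) * (?q e * (e \<bullet> v))"
      using AE_uniform_sphere
    proof eventually_elim
      fix e :: "'a \<times> 'b" assume e: "norm e = 1"
      then have e': "norm (- e) = 1" by simp
      have hp: "integrable uniform_interval (\<lambda>r. \<phi> (p + (\<tau> k * r) *\<^sub>R e) * K r)"
        by (rule kernel_holder(1)[OF D phi_meas t e phi_holder[OF p k _ e]])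
      have hm: "integrable uniform_interval (\<lambda>r. \<phi> (p - (\<tau> k * r) *\<^sub>R e) * K r)"
        using kernel_holder(1)[OF D phi_meas t e' phi_holder[OF p k _ e']] by simp
      have hI: "integrable uniform_interval (\<lambda>r. ?hK e r)"
        unfolding left_diff_distrib by (rule Bochner_Integration.integrable_diff[OF hp hm])
      have K0: "(\<integral>r. K r \<partial>uniform_interval) = 0" using moment[of 0] by simp
      have "(\<integral>r. ?gv e r \<partial>uniform_interval)
        = (\<integral>r. real DIM('a \<times> 'b) / (2 * \<tau> k) * (e \<bullet> v) * (?hK e r + (a - b') * K r) \<partial>uniform_interval)"
        unfolding zo_gradient_eq inner_scaleR_left inner_flip_snd v_def[symmetric]
        by (intro Bochner_Integration.integral_cong refl) (simp only: distrib_right distrib_left mult_ac)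
      also have "\<dots> = real DIM('a \<times> 'b) / (2 * \<tau> k) * (e \<bullet> v) * (?q e + (a - b') * (\<integral>r. K r \<partial>uniform_interval))"
        using hI K_int by (simp add: Bochner_Integration.integral_add)
      finally show "(\<integral>r. ?gv e r \<partial>uniform_interval) = real DIM('a \<times> 'b) / (2 * \<tau> k) * (?q e * (e \<bullet> v))"
        unfolding K0 by simp
    qed
  qed measurable
  also have "\<dots> = real DIM('a \<times> 'b) / (2 * \<tau> k) * (\<integral>e. ?q e * (e \<bullet> v) \<partial>uniform_sphere)" by simp
  also have "\<dots> \<ge> D v - bias_bound k * norm v"
    using gradient_estimate_bias[OF D phi_meas t phi_holder[OF p k] less_imp_le[OF L], of v] unfolding bias_bound_def by simp
  finally have 1: "D v - bias_bound k * norm (p - u) \<le> ?lhs"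
    by (simp add: v_def)
  have 2: "\<phi> (fst p, snd u) - \<phi> (fst u, snd p) + \<mu> / 2 * (norm (p - u))\<^sup>2 \<le> D v"
    unfolding v_def by (rule gap_le_gradient[OF p u D])
  \<comment> \<open>Half of the strong convexity term pays for the bias; the other
    \<open>\<mu> / 4\<close> is kept for the telescoping of distances.\<close>
  have 3: "bias_bound k * norm (p - u) \<le> \<mu> / 4 * (norm (p - u))\<^sup>2 + (bias_bound k)\<^sup>2 / \<mu>"
  proof -
    have "0 \<le> (\<mu> / 2 * norm (p - u) - bias_bound k)\<^sup>2 / \<mu>" using \<mu> by simp
    also have "\<dots> = \<mu> / 4 * (norm (p - u))\<^sup>2 + (bias_bound k)\<^sup>2 / \<mu> - bias_bound k * norm (p - u)"
      using \<mu> by (simp add: power2_eq_square field_simps)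
    finally show ?thesis by simp
  qed
  have "\<mu> / 2 * (norm (p - u))\<^sup>2 = \<mu> / 4 * (norm (p - u))\<^sup>2 + \<mu> / 4 * (norm (p - u))\<^sup>2" by simp
  with 1 2 3 show ?thesis by linarith
qed

end

section \<open>The expected saddle gap\<close>

context zo_method
begin

lemma bounded_Z: "\<exists>B. \<forall>p\<in>Z. \<forall>u\<in>Z. norm (p - u) \<le> B"
proof -
  obtain B where B: "\<forall>p\<in>Z. norm p \<le> B" using Z(1) compact_imp_bounded bounded_iff by blast
  then have "norm (p - u) \<le> B + B" if "p \<in> Z" "u \<in> Z" for p u
  proof -
    have "norm p \<le> B" "norm u \<le> B" using B that by blast+
    then show ?thesis using norm_triangle_ineq4[of p u] by linarith
  qed
  then show ?thesis by blast
qed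

lemma phi_continuous: "continuous_on UNIV \<phi>"
  using phi_diff by (intro continuous_at_imp_continuous_on ballI differentiable_imp_continuous_within)

lemma bounded_phi: "\<exists>B. \<forall>p\<in>Z. \<bar>\<phi> p\<bar> \<le> B"
proof -
  have "compact (\<phi> ` Z)" using Z(1) continuous_on_subset[OF phi_continuous] by (intro compact_continuous_image) auto
  then show ?thesis using compact_imp_bounded bounded_iff by (metis image_eqI real_norm_def)
qed

definition gap :: "'a \<times> 'b \<Rightarrow> 'a \<times> 'b \<Rightarrow> real" where
  "gap u p = \<phi> (fst p, snd u) - \<phi> (fst u, snd p)"

lemma gap_measurable [measurable]: "gap u \<in> borel_measurable borel"
proof -
  have "continuous_on UNIV (\<lambda>p. \<phi> (fst p, snd u))" "continuous_on UNIV (\<lambda>p. \<phi> (fst u, snd p))"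
    by (intro continuous_on_compose2[OF phi_continuous] continuous_intros; simp)+
  then show ?thesis
    unfolding gap_def by (intro borel_measurable_continuous_onI continuous_intros)
qed

lemma integrable_on_Z:
  assumes f: "f \<in> borel_measurable borel" "\<And>p. p \<in> Z \<Longrightarrow> \<bar>f p\<bar> \<le> B"
    and w: "w \<in> borel_measurable P" "\<And>\<omega>. \<omega> \<in> space P \<Longrightarrow> w \<omega> \<in> Z"
  shows "integrable P (\<lambda>\<omega>. f (w \<omega>) :: real)"
  by (rule integrable_const_bound[where B=B]) (use assms in auto)

lemma gap_integrable:
  assumes "u \<in> Z" "w \<in> borel_measurable P" "\<And>\<omega>. \<omega> \<in> space P \<Longrightarrow> w \<omega> \<in> Z"
  shows "integrable P (\<lambda>\<omega>. gap u (w \<omega>))"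
proof -
  obtain B where B: "\<forall>p\<in>Z. \<bar>\<phi> p\<bar> \<le> B" using bounded_phi by blast
  have "\<bar>gap u p\<bar> \<le> B + B" if p: "p \<in> Z" for p
  proof -
    have "(fst p, snd u) \<in> Z" "(fst u, snd p) \<in> Z" using p assms(1) by auto
    then have "\<bar>\<phi> (fst p, snd u)\<bar> \<le> B" "\<bar>\<phi> (fst u, snd p)\<bar> \<le> B" using B by blast+
    then show ?thesis unfolding gap_def by linarith
  qed
  then show ?thesis using assms by (intro integrable_on_Z[OF gap_measurable]) auto
qed

lemma dist_integrable:
  assumes "u \<in> Z" "k \<in> {1..Suc N}"
  shows "integrable P (\<lambda>\<omega>. (norm (z k \<omega> - u))\<^sup>2)"
proof -
  obtain B where B: "\<forall>p\<in>Z. \<forall>u\<in>Z. norm (p - u) \<le> B" using bounded_Z by blast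
  show ?thesis
  proof (rule integrable_on_Z[where f="\<lambda>p. (norm (p - u))\<^sup>2" and B="B\<^sup>2"])
    show "\<bar>(norm (p - u))\<^sup>2\<bar> \<le> B\<^sup>2" if "p \<in> Z" for p
    proof -
      have "norm (p - u) \<le> B" using B that assms(1) by blast
      then show ?thesis by (simp add: power_mono)
    qed
  qed (use assms z_in in \<open>auto intro: z_measurable\<close>)
qed

lemma gradient_integrable:
  assumes k: "k \<in> {1..N}"
  shows "integrable P (\<lambda>\<omega>. (norm (g k \<omega>))\<^sup>2)" "(\<integral>\<omega>. (norm (g k \<omega>))\<^sup>2 \<partial>P) \<le> second_moment_bound k"
proof -
  note [measurable] = g_measurable[OF k]
  show i: "integrable P (\<lambda>\<omega>. (norm (g k \<omega>))\<^sup>2)"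
    using gradient_second_moment[OF k] by (intro integrableI_nonneg) (auto simp: le_less_trans)
  have "second_moment_bound k \<ge> 0" unfolding second_moment_bound_def using kappa_nonneg by simp
  then show "(\<integral>\<omega>. (norm (g k \<omega>))\<^sup>2 \<partial>P) \<le> second_moment_bound k"
    using gradient_second_moment[OF k] nn_integral_eq_integral[OF i] by simp
qed

text \<open>Fubini for the Bochner integral needs this in advance; it follows from the second moment
  of the estimate and the boundedness of the feasible set.\<close>

lemma gradient_inner_integrable:
  assumes k: "k \<in> {1..N}" and u: "u \<in> Z"
  shows "integrable P (\<lambda>\<omega>. g k \<omega> \<bullet> (z k \<omega> - u))"
proof (rule Bochner_Integration.integrable_bound)
  have k': "k \<in> {1..Suc N}" using k by simp
  note [measurable] = g_measurable[OF k] z_measurable[OF k']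
  show "integrable P (\<lambda>\<omega>. (norm (g k \<omega>))\<^sup>2 + (norm (z k \<omega> - u))\<^sup>2)"
    using gradient_integrable(1)[OF k] dist_integrable[OF u k'] by (rule Bochner_Integration.integrable_add)
  show "(\<lambda>\<omega>. g k \<omega> \<bullet> (z k \<omega> - u)) \<in> borel_measurable P" by measurable
  have "\<bar>v \<bullet> w\<bar> \<le> (norm v)\<^sup>2 + (norm w)\<^sup>2" for v w :: "'a \<times> 'b"
  proof -
    have "0 \<le> (norm v - norm w)\<^sup>2" by simp
    then have "2 * (norm v * norm w) \<le> (norm v)\<^sup>2 + (norm w)\<^sup>2" by (simp add: power2_diff)
    moreover have "0 \<le> norm v * norm w" by simp
    ultimately show ?thesis using Cauchy_Schwarz_ineq2[of v w] by linarith
  qed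
  then show "AE \<omega> in P. norm (g k \<omega> \<bullet> (z k \<omega> - u)) \<le> norm ((norm (g k \<omega>))\<^sup>2 + (norm (z k \<omega> - u))\<^sup>2)"
    by (intro AE_I2) simp
qed

lemma gradient_inner:
  assumes k: "k \<in> {1..N}" and u: "u \<in> Z"
  shows "(\<integral>\<omega>. gap u (z k \<omega>) \<partial>P) + \<mu> / 4 * (\<integral>\<omega>. (norm (z k \<omega> - u))\<^sup>2 \<partial>P) - (bias_bound k)\<^sup>2 / \<mu>
    \<le> (\<integral>\<omega>. g k \<omega> \<bullet> (z k \<omega> - u) \<partial>P)"
proof -
  let ?Q = "distr P borel (state k)" and ?D = draw_law
  interpret DQ: pair_sigma_finite ?D ?Q by (rule pair_sigma_finite_state[OF k])
  have k': "k \<in> {1..Suc N}" using k by simp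
  let ?f = "\<lambda>w s. G k w s \<bullet> (fst s - u)"
  have m: "(\<lambda>(w, s). ?f w s) \<in> borel_measurable (borel \<Otimes>\<^sub>M borel)"
    using G_measurable[of k] unfolding case_prod_beta by measurable
  let ?T = "\<lambda>\<omega>. ((e k \<omega>, r k \<omega>), state k \<omega>)"
  have eq: "(\<lambda>(w, s). ?f w s) (?T \<omega>) = g k \<omega> \<bullet> (z k \<omega> - u)" for \<omega>
    by (simp add: g_eq_G state_def)
  have int: "integrable (?D \<Otimes>\<^sub>M ?Q) (\<lambda>(w, s). ?f w s)"
    unfolding joint_law[OF k, symmetric] integrable_distr_eq[OF draw_state_measurable[OF k] m] eq
    by (rule gradient_inner_integrable[OF k u])
  have "(\<integral>\<omega>. g k \<omega> \<bullet> (z k \<omega> - u) \<partial>P) = (\<integral>q. (\<lambda>(w, s). ?f w s) q \<partial>distr P (borel \<Otimes>\<^sub>M borel) ?T)"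
    unfolding integral_distr[OF draw_state_measurable[OF k] m] eq ..
  also have "\<dots> = (\<integral>s. \<integral>w. ?f w s \<partial>?D \<partial>?Q)"
    unfolding joint_law[OF k] by (rule DQ.integral_snd[OF int, symmetric])
  finally have E: "(\<integral>\<omega>. g k \<omega> \<bullet> (z k \<omega> - u) \<partial>P) = (\<integral>s. \<integral>w. ?f w s \<partial>?D \<partial>?Q)" .
  let ?h = "\<lambda>s::('a \<times> 'b) \<times> real \<times> real. gap u (fst s) + \<mu> / 4 * (norm (fst s - u))\<^sup>2 - (bias_bound k)\<^sup>2 / \<mu>"
  have hm: "?h \<in> borel_measurable borel" by measurable
  have i1: "integrable P (\<lambda>\<omega>. gap u (z k \<omega>))" using z_in[OF k'] z_measurable[OF k'] by (intro gap_integrable u) auto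
  note i2 = dist_integrable[OF u k']
  have hi: "integrable ?Q ?h"
    unfolding integrable_distr_eq[OF state_measurable[OF k] hm] using i1 i2 by (simp add: state_def)
  have "(\<integral>s. ?h s \<partial>?Q) \<le> (\<integral>s. \<integral>w. ?f w s \<partial>?D \<partial>?Q)"
  proof (rule integral_mono_AE[OF hi DQ.integrable_snd[OF int]])
    show "AE s in ?Q. ?h s \<le> (\<integral>w. ?f w s \<partial>?D)"
      using AE_state[OF k] DQ.AE_integrable_snd[OF int]
    proof eventually_elim
      fix s :: "('a \<times> 'b) \<times> real \<times> real" assume s: "fst s \<in> Z" and i: "integrable ?D (\<lambda>w. ?f w s)"
      show "?h s \<le> (\<integral>w. ?f w s \<partial>?D)"
        using gradient_inner_state[OF k s u i[unfolded G_def]] unfolding G_def gap_def .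
    qed
  qed
  also have "(\<integral>s. ?h s \<partial>?Q) = (\<integral>\<omega>. gap u (z k \<omega>) + \<mu> / 4 * (norm (z k \<omega> - u))\<^sup>2 - (bias_bound k)\<^sup>2 / \<mu> \<partial>P)"
    by (subst integral_distr[OF state_measurable[OF k] hm]) (simp add: state_def)
  also have "\<dots> = (\<integral>\<omega>. gap u (z k \<omega>) \<partial>P) + \<mu> / 4 * (\<integral>\<omega>. (norm (z k \<omega> - u))\<^sup>2 \<partial>P) - (bias_bound k)\<^sup>2 / \<mu>"
    using i1 i2 by (simp add: prob_space)
  finally show ?thesis unfolding E .
qed

text \<open>The stepsize \<open>2 / (\<mu> k)\<close> turns the distance terms into \<open>\<mu> / 4 * ((k - 1) * a\<^sub>k - k * a\<^sub>k\<^sub>+\<^sub>1)\<close>, which telescopes.\<close>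

lemma one_step:
  assumes k: "k \<in> {1..N}" and u: "u \<in> Z"
  shows "(\<integral>\<omega>. gap u (z k \<omega>) \<partial>P)
    \<le> \<mu> / 4 * ((real k - 1) * (\<integral>\<omega>. (norm (z k \<omega> - u))\<^sup>2 \<partial>P) - real k * (\<integral>\<omega>. (norm (z (Suc k) \<omega> - u))\<^sup>2 \<partial>P))
      + (second_moment_bound k / real k + (bias_bound k)\<^sup>2) / \<mu>"
proof -
  have k': "k \<in> {1..Suc N}" "Suc k \<in> {1..Suc N}" using k by auto
  define a a' I where "a = (\<integral>\<omega>. (norm (z k \<omega> - u))\<^sup>2 \<partial>P)" and "a' = (\<integral>\<omega>. (norm (z (Suc k) \<omega> - u))\<^sup>2 \<partial>P)"
    and "I = (\<integral>\<omega>. g k \<omega> \<bullet> (z k \<omega> - u) \<partial>P)"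
  have pw: "(norm (z (Suc k) \<omega> - u))\<^sup>2 \<le> (norm (z k \<omega> - u))\<^sup>2 - 2 * \<gamma> k * (g k \<omega> \<bullet> (z k \<omega> - u)) + (\<gamma> k)\<^sup>2 * (norm (g k \<omega>))\<^sup>2"
    if \<omega>: "\<omega> \<in> space P" for \<omega>
  proof -
    have "dist (closest_point Z (z k \<omega> - \<gamma> k *\<^sub>R g k \<omega>)) (closest_point Z u) \<le> dist (z k \<omega> - \<gamma> k *\<^sub>R g k \<omega>) u"
      by (rule closest_point_lipschitz[OF Z(2,3,4)])
    then have "norm (z (Suc k) \<omega> - u) \<le> norm (z k \<omega> - u - \<gamma> k *\<^sub>R g k \<omega>)"
      unfolding z_Suc[OF k \<omega>] closest_point_self[OF u] by (simp add: dist_norm algebra_simps)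
    then have "(norm (z (Suc k) \<omega> - u))\<^sup>2 \<le> (norm (z k \<omega> - u - \<gamma> k *\<^sub>R g k \<omega>))\<^sup>2" by (intro power_mono) auto
    also have "\<dots> = (norm (z k \<omega> - u))\<^sup>2 - 2 * \<gamma> k * (g k \<omega> \<bullet> (z k \<omega> - u)) + (\<gamma> k)\<^sup>2 * (norm (g k \<omega>))\<^sup>2"
    proof -
      have "(norm (x - c *\<^sub>R y))\<^sup>2 = (norm x)\<^sup>2 - 2 * c * (y \<bullet> x) + c\<^sup>2 * (norm y)\<^sup>2" for x y :: "'a \<times> 'b" and c
        unfolding power2_norm_eq_inner
        by (simp add: inner_diff_left inner_diff_right inner_commute power2_eq_square algebra_simps)
      then show ?thesis .
    qed
    finally show ?thesis .
  qed
  note i = dist_integrable[OF u k'(1)] gradient_inner_integrable[OF k u] gradient_integrable(1)[OF k]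
  have "a' \<le> (\<integral>\<omega>. (norm (z k \<omega> - u))\<^sup>2 - 2 * \<gamma> k * (g k \<omega> \<bullet> (z k \<omega> - u)) + (\<gamma> k)\<^sup>2 * (norm (g k \<omega>))\<^sup>2 \<partial>P)"
    unfolding a'_def
    using i by (intro integral_mono[OF dist_integrable[OF u k'(2)] _ pw]
      Bochner_Integration.integrable_add Bochner_Integration.integrable_diff integrable_mult_right)
  also have "\<dots> = a - 2 * \<gamma> k * I + (\<gamma> k)\<^sup>2 * (\<integral>\<omega>. (norm (g k \<omega>))\<^sup>2 \<partial>P)"
    using i by (simp add: a_def I_def)
  also have "\<dots> \<le> a - 2 * \<gamma> k * I + (\<gamma> k)\<^sup>2 * second_moment_bound k"
    using gradient_integrable(2)[OF k] by (intro add_left_mono mult_left_mono) auto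
  finally have 1: "a' \<le> a - 2 * \<gamma> k * I + (\<gamma> k)\<^sup>2 * second_moment_bound k" .
  have kp: "real k > 0" using k by simp
  \<comment> \<open>The factor \<open>\<mu> * real k / 4\<close> normalises the coefficient of
    \<open>I\<close> to 1 and turns \<open>(\<gamma> k)\<^sup>2\<close> into
    \<open>1 / (\<mu> * real k)\<close>.\<close>
  have "\<mu> * real k / 4 * a' \<le> \<mu> * real k / 4 * (a - 2 * \<gamma> k * I + (\<gamma> k)\<^sup>2 * second_moment_bound k)"
    using 1 \<mu> by (intro mult_left_mono) auto
  also have "\<dots> = \<mu> * real k / 4 * a - I + second_moment_bound k / real k / \<mu>"
    unfolding \<gamma>[OF k] using \<mu> kp by (simp add: field_simps power2_eq_square)
  finally have 2: "I \<le> \<mu> * real k / 4 * a - \<mu> * real k / 4 * a' + second_moment_bound k / real k / \<mu>" by linarith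
  have 3: "(\<integral>\<omega>. gap u (z k \<omega>) \<partial>P) + \<mu> / 4 * a - (bias_bound k)\<^sup>2 / \<mu> \<le> I"
    using gradient_inner[OF k u] unfolding a_def I_def .
  have "\<mu> * real k / 4 * a - \<mu> * real k / 4 * a' - \<mu> / 4 * a = \<mu> / 4 * ((real k - 1) * a - real k * a')"
    by (simp add: algebra_simps)
  moreover have "second_moment_bound k / real k / \<mu> + (bias_bound k)\<^sup>2 / \<mu> = (second_moment_bound k / real k + (bias_bound k)\<^sup>2) / \<mu>" by (simp add: add_divide_distrib)
  ultimately show ?thesis using 2 3 unfolding a_def[symmetric] a'_def[symmetric] by linarith
qed

lemma sum_gap:
  assumes u: "u \<in> Z"
  shows "(\<Sum>k=1..N. \<integral>\<omega>. gap u (z k \<omega>) \<partial>P) \<le> (\<Sum>k=1..N. second_moment_bound k / real k + (bias_bound k)\<^sup>2) / \<mu>"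
proof -
  define a where "a k = (\<integral>\<omega>. (norm (z k \<omega> - u))\<^sup>2 \<partial>P)" for k
  have "(\<Sum>k=1..N. \<integral>\<omega>. gap u (z k \<omega>) \<partial>P)
      \<le> (\<Sum>k=1..N. \<mu> / 4 * ((real k - 1) * a k - real k * a (Suc k)) + (second_moment_bound k / real k + (bias_bound k)\<^sup>2) / \<mu>)"
    unfolding a_def by (intro sum_mono one_step u)
  also have "\<dots> = \<mu> / 4 * (\<Sum>k=1..N. (real k - 1) * a k - real k * a (Suc k)) + (\<Sum>k=1..N. second_moment_bound k / real k + (bias_bound k)\<^sup>2) / \<mu>"
    unfolding sum.distrib sum_distrib_left[symmetric] sum_divide_distrib[symmetric] ..
  \<comment> \<open>At \<open>k = 1\<close> the coefficient \<open>real k - 1\<close> vanishes, so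
    the initial distance does not appear; the final distance has a negative sign and is dropped
    next.\<close>
  also have "(\<Sum>k=1..N. (real k - 1) * a k - real k * a (Suc k)) = - (real N * a (Suc N))"
    by (induction N) (auto simp: algebra_simps)
  also have "\<mu> / 4 * - (real N * a (Suc N)) \<le> 0"
    using \<mu> by (simp add: a_def mult_nonneg_nonneg)
  finally show ?thesis by simp
qed

section \<open>The averaged iterate\<close>

definition zbar where "zbar \<omega> = zo_average N z \<omega>"

lemma zbar_in: "zbar \<omega> \<in> Z" if "\<omega> \<in> space P" "N \<ge> 1"
proof -
  have "(\<Sum>k=1..N. (1 / real N) *\<^sub>R z k \<omega>) \<in> Z"
    by (rule convex_sum) (use Z(2) z_in that in auto)
  then show ?thesis by (simp add: zbar_def zo_average_def scaleR_sum_right)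
qed

lemma zbar_measurable: "zbar \<in> borel_measurable P"
proof -
  have "(\<lambda>\<omega>. (1 / real N) *\<^sub>R (\<Sum>k=1..N. z k \<omega>)) \<in> borel_measurable P"
    by (intro borel_measurable_scaleR borel_measurable_const borel_measurable_sum z_measurable) auto
  then show ?thesis unfolding zbar_def zo_average_def .
qed

text \<open>Tangent inequality at the mean \<open>?m\<close>: the linear terms sum to zero and the
  nonnegative quadratic terms are discarded.\<close>

lemma strongly_convex_jensen:
  fixes f :: "'c::euclidean_space \<Rightarrow> real"
  assumes f: "strongly_convex_on \<mu> S f" and x: "\<And>k. k \<in> {1..N} \<Longrightarrow> x k \<in> S" and N: "N \<ge> 1"
    and m: "(1 / real N) *\<^sub>R (\<Sum>k=1..N. x k) \<in> S"
  shows "real N * f ((1 / real N) *\<^sub>R (\<Sum>k=1..N. x k)) \<le> (\<Sum>k=1..N. f (x k))"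
proof -
  let ?m = "(1 / real N) *\<^sub>R (\<Sum>k=1..N. x k)"
  obtain d where d: "\<forall>u\<in>S. \<forall>v\<in>S. f v \<ge> f u + d u \<bullet> (v - u) + \<mu> / 2 * (norm (v - u))\<^sup>2"
    using f unfolding strongly_convex_on_def by blast
  have "f ?m + d ?m \<bullet> (x k - ?m) \<le> f (x k)" if k: "k \<in> {1..N}" for k
  proof -
    have "f (x k) \<ge> f ?m + d ?m \<bullet> (x k - ?m) + \<mu> / 2 * (norm (x k - ?m))\<^sup>2" using d m x[OF k] by blast
    moreover have "\<mu> / 2 * (norm (x k - ?m))\<^sup>2 \<ge> 0" using \<mu> by simp
    ultimately show ?thesis by linarith
  qed
  then have "(\<Sum>k=1..N. f ?m + d ?m \<bullet> (x k - ?m)) \<le> (\<Sum>k=1..N. f (x k))" by (rule sum_mono)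
  moreover have "(\<Sum>k=1..N. f ?m + d ?m \<bullet> (x k - ?m)) = real N * f ?m + d ?m \<bullet> ((\<Sum>k=1..N. x k) - real N *\<^sub>R ?m)"
    by (simp add: sum.distrib inner_sum_right[symmetric] sum_subtractf inner_diff_right sum_constant_scaleR)
  ultimately show ?thesis using N by simp
qed

text \<open>The gap is a convex function of the first component plus a convex function of the
  second, so averaging can only lower it.\<close>

lemma gap_average:
  assumes u: "u \<in> Z" and N: "N \<ge> 1" and \<omega>: "\<omega> \<in> space P"
  shows "real N * gap u (zbar \<omega>) \<le> (\<Sum>k=1..N. gap u (z k \<omega>))"
proof -
  obtain x' y' where uu: "u = (x', y')" and xy: "x' \<in> X" "y' \<in> Y" using u by auto
  have zi: "fst (z k \<omega>) \<in> X" "snd (z k \<omega>) \<in> Y" if "k \<in> {1..N}" for k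
    using z_in[of k \<omega>] that \<omega> by (auto simp: mem_Times_iff)
  have fb: "fst (zbar \<omega>) = (1 / real N) *\<^sub>R (\<Sum>k=1..N. fst (z k \<omega>))"
    "snd (zbar \<omega>) = (1 / real N) *\<^sub>R (\<Sum>k=1..N. snd (z k \<omega>))"
    unfolding zbar_def zo_average_def by (simp_all add: fst_sum snd_sum)
  have in_b: "fst (zbar \<omega>) \<in> X" "snd (zbar \<omega>) \<in> Y" using zbar_in[OF \<omega> N] by (auto simp: mem_Times_iff)
  have c: "strongly_convex_on \<mu> X (\<lambda>x. \<phi> (x, y'))" "strongly_convex_on \<mu> Y (\<lambda>y. - \<phi> (x', y))"
    using \<phi> xy unfolding saddle_holder_class_def strongly_concave_on_def by auto
  have 1: "real N * \<phi> (fst (zbar \<omega>), y') \<le> (\<Sum>k=1..N. \<phi> (fst (z k \<omega>), y'))"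
    unfolding fb by (rule strongly_convex_jensen[OF c(1)]) (use zi N in_b fb in auto)
  have 2: "real N * - \<phi> (x', snd (zbar \<omega>)) \<le> (\<Sum>k=1..N. - \<phi> (x', snd (z k \<omega>)))"
    unfolding fb by (rule strongly_convex_jensen[OF c(2)]) (use zi N in_b fb in auto)
  have "real N * gap u (zbar \<omega>) = real N * \<phi> (fst (zbar \<omega>), y') + real N * - \<phi> (x', snd (zbar \<omega>))"
    by (simp add: gap_def uu algebra_simps)
  also have "\<dots> \<le> (\<Sum>k=1..N. \<phi> (fst (z k \<omega>), y')) + (\<Sum>k=1..N. - \<phi> (x', snd (z k \<omega>)))"
    by (rule add_mono[OF 1 2])
  also have "\<dots> = (\<Sum>k=1..N. gap u (z k \<omega>))"
    by (simp add: gap_def uu sum_subtractf sum_negf)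
  finally show ?thesis .
qed

text \<open>The comparison point \<open>u\<close> is deterministic. This is enough because in the
  theorem the maximum and the minimum stand outside the expectation.\<close>

lemma expected_gap:
  assumes u: "u \<in> Z" and N: "N \<ge> 1"
  shows "(\<integral>\<omega>. gap u (zbar \<omega>) \<partial>P) \<le> (\<Sum>k=1..N. second_moment_bound k / real k + (bias_bound k)\<^sup>2) / \<mu> / real N"
proof -
  have i: "integrable P (\<lambda>\<omega>. gap u (z k \<omega>))" if "k \<in> {1..N}" for k
    using that z_in[of k] z_measurable[of k] by (intro gap_integrable u) auto
  have ib: "integrable P (\<lambda>\<omega>. gap u (zbar \<omega>))"
    using zbar_in N by (intro gap_integrable u zbar_measurable) auto
  have "real N * (\<integral>\<omega>. gap u (zbar \<omega>) \<partial>P) = (\<integral>\<omega>. real N * gap u (zbar \<omega>) \<partial>P)" by simp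
  also have "\<dots> \<le> (\<integral>\<omega>. (\<Sum>k=1..N. gap u (z k \<omega>)) \<partial>P)"
    using ib i by (intro integral_mono gap_average u N integrable_mult_right Bochner_Integration.integrable_sum) auto
  also have "\<dots> = (\<Sum>k=1..N. \<integral>\<omega>. gap u (z k \<omega>) \<partial>P)"
    using i by (intro Bochner_Integration.integral_sum) auto
  also have "\<dots> \<le> (\<Sum>k=1..N. second_moment_bound k / real k + (bias_bound k)\<^sup>2) / \<mu>" by (rule sum_gap[OF u])
  finally have "real N * (\<integral>\<omega>. gap u (zbar \<omega>) \<partial>P) \<le> (\<Sum>k=1..N. second_moment_bound k / real k + (bias_bound k)\<^sup>2) / \<mu>" .
  moreover have "real N > 0" using N by simp
  ultimately show ?thesis by (simp only: pos_le_divide_eq mult.commute)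
qed

end

section \<open>Choice of the parameters\<close>

text \<open>Comparison with the integral of a decreasing power, done one mean value step at a
  time.\<close>

lemma sum_powr_le:
  fixes a :: real
  assumes a: "0 < a" "a \<le> 1"
  shows "(\<Sum>k=1..N. real k powr (a - 1)) \<le> real N powr a / a"
proof (induction N)
  case (Suc N)
  have "a * real (Suc N) powr (a - 1) \<le> real (Suc N) powr a - real N powr a"
  \<comment> \<open>The power need not be differentiable at 0, so the first step is separate; it
    reads \<open>a \<le> 1\<close>, since \<open>0 powr a = 0\<close>.\<close>
  proof (cases "N = 0")
    case False
    have "\<exists>x. real N < x \<and> x < real (Suc N) \<and> real (Suc N) powr a - real N powr a = (real (Suc N) - real N) * (a * x powr (a - 1))"
    proof (rule MVT2)
      show "((\<lambda>x. x powr a) has_real_derivative a * x powr (a - 1)) (at x)" if "real N \<le> x" "x \<le> real (Suc N)" for x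
        using that False by (auto intro!: derivative_eq_intros)
    qed simp
    then obtain x where x: "real N < x" "x < real (Suc N)"
      "real (Suc N) powr a - real N powr a = (real (Suc N) - real N) * (a * x powr (a - 1))" by blast
    have "real (Suc N) powr (a - 1) \<le> x powr (a - 1)" using x a False by (intro powr_mono2') auto
    then show ?thesis using x a by simp
  qed (use a in simp)
  then have "real (Suc N) powr (a - 1) \<le> real (Suc N) powr a / a - real N powr a / a"
    using a by (simp add: field_simps)
  then show ?case using Suc by simp
qed (use a in simp)

text \<open>\<open>ln t \<le> t - 1\<close> at \<open>t = N / (N + 1)\<close> bounds each summand by
  an increment of the logarithm.\<close>

lemma sum_inverse_le:
  assumes "N \<ge> 1"
  shows "(\<Sum>k=1..N. 1 / real k) \<le> 1 + ln (real N)"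
  using assms
proof (induction N rule: nat_induct_at_least)
  case (Suc N)
  have "ln (real N / real (Suc N)) \<le> real N / real (Suc N) - 1" using Suc.hyps by (intro ln_le_minus_one) simp
  also have "\<dots> = - (1 / real (Suc N))" by (simp add: field_simps)
  finally have "1 / real (Suc N) \<le> ln (real (Suc N)) - ln (real N)" using Suc.hyps by (simp add: ln_div)
  then show ?case using Suc.IH by simp
qed simp

text \<open>It rests on \<open>y \<le> 2 powr y\<close>, which follows from the tangent of
  \<open>ln\<close> at 2 and \<open>ln 2 \<ge> 1 / 2\<close>. The bound removes a factor depending
  on \<open>\<beta>\<close> from the final constant.\<close>

lemma powr_inverse_le_2: "x powr (1 / y) \<le> 2" if "1 \<le> y" "0 < x" "x \<le> y" for x y :: real
proof -
  have "x \<le> 2 powr y"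
  proof -
    have "ln y \<le> y * ln 2"
    proof -
      have ln_half: "1 / 2 \<le> ln (2 :: real)" using ln_le_minus_one[of "1 / 2 :: real"] by (simp add: ln_div)
      have "ln (y / 2) \<le> y / 2 - 1" using that by (intro ln_le_minus_one) auto
      then have "ln y \<le> y / 2 - 1 + ln 2" using that by (simp add: ln_div)
      moreover have "(y - 1) * (1 / 2) \<le> (y - 1) * ln 2" using that ln_half by (intro mult_left_mono) auto
      then have "y / 2 - 1 / 2 \<le> y * ln 2 - ln 2"
        unfolding left_diff_distrib by simp
      ultimately show ?thesis by linarith
    qed
    then have "exp (ln y) \<le> exp (y * ln 2)" by simp
    then show ?thesis using that by (simp add: powr_def)
  qed
  then have "x powr (1 / y) \<le> (2 powr y) powr (1 / y)" using that by (intro powr_mono2) auto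
  also have "\<dots> = 2" using that by (simp add: powr_powr)
  finally show ?thesis .
qed

text \<open>With \<open>T\<close> the base of \<open>\<tau>\<^sub>k\<^bsup>2\<beta>\<^esup> = T / k\<close>, the noise term and the squared bias are both multiples of
  \<open>T powr (- 1 / \<beta>) * k powr (1 / \<beta> - 1)\<close>.\<close>

lemma step_error_sum:
  fixes n \<kappa> s B M \<beta> :: real and \<tau> :: "nat \<Rightarrow> real"
  assumes n: "n > 0" and \<kappa>: "\<kappa> > 0" and s: "s > 0" and B: "B > 0" and \<beta>: "\<beta> > 2" and N: "N \<ge> 1"
    and T: "T = 3 * \<kappa> * s\<^sup>2 * n / (2 * (\<beta> - 1) * B\<^sup>2)"
    and \<tau>: "\<And>k. k \<in> {1..N} \<Longrightarrow> \<tau> k = T powr (1 / (2 * \<beta>)) * real k powr (- 1 / (2 * \<beta>))"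
  shows "(\<Sum>k=1..N. (8 * n * \<kappa> * M\<^sup>2 + n\<^sup>2 * \<kappa> * s\<^sup>2 / (2 * (\<tau> k)\<^sup>2)) / real k + (sqrt n * \<tau> k powr (\<beta> - 1) * B / 2)\<^sup>2) / real N
    \<le> n powr (2 - 1 / \<beta>) * (3 * \<beta> * (\<kappa> * s\<^sup>2) powr ((\<beta> - 1) / \<beta>) * B powr (2 / \<beta>) / real N powr ((\<beta> - 1) / \<beta>))
      + 9 * \<kappa> * M\<^sup>2 * (n * (1 + ln (real N)) / real N)"
proof -
  have T0: "T > 0" unfolding T using n \<kappa> s B \<beta> by simp
  define q where "q = n\<^sup>2 * \<kappa> * s\<^sup>2 * T powr (- 1 / \<beta>)"
  have q0: "q \<ge> 0" using \<kappa> by (simp add: q_def)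
  have Np: "real N > 0" using N by simp
  have step: "(8 * n * \<kappa> * M\<^sup>2 + n\<^sup>2 * \<kappa> * s\<^sup>2 / (2 * (\<tau> k)\<^sup>2)) / real k + (sqrt n * \<tau> k powr (\<beta> - 1) * B / 2)\<^sup>2
    \<le> 8 * n * \<kappa> * M\<^sup>2 * (1 / real k) + q * real k powr (1 / \<beta> - 1)" if k: "k \<in> {1..N}" for k
  proof -
    have k0: "real k > 0" using k by simp
    have t0: "\<tau> k > 0" unfolding \<tau>[OF k] using T0 k0 by simp
    have tp: "\<tau> k powr x = T powr (x / (2 * \<beta>)) * real k powr (- x / (2 * \<beta>))" for x
      unfolding \<tau>[OF k] using T0 k0 by (simp add: powr_mult powr_powr)
    have sq: "(\<tau> k)\<^sup>2 = T powr (1 / \<beta>) * real k powr (- 1 / \<beta>)"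
      using tp[of 2] t0 \<beta> by (simp add: powr_numeral field_simps)
    have e1: "n\<^sup>2 * \<kappa> * s\<^sup>2 / (2 * (\<tau> k)\<^sup>2) / real k = q / 2 * real k powr (1 / \<beta> - 1)"
      unfolding sq q_def using k0 T0 by (simp add: powr_diff powr_minus field_simps)
    have "(sqrt n * \<tau> k powr (\<beta> - 1) * B / 2)\<^sup>2 = n * B\<^sup>2 / 4 * (\<tau> k powr (2 * (\<beta> - 1)))"
      using n t0 by (simp add: power_mult_distrib power_divide powr_power mult.commute)
    also have "\<tau> k powr (2 * (\<beta> - 1)) = T powr (1 - 1 / \<beta>) * real k powr (1 / \<beta> - 1)"
    proof -
      have "2 * (\<beta> - 1) / (2 * \<beta>) = 1 - 1 / \<beta>" "- (2 * (\<beta> - 1)) / (2 * \<beta>) = 1 / \<beta> - 1"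
        using \<beta> by (simp_all add: field_simps)
      then show ?thesis unfolding tp by simp
    qed
    also have "n * B\<^sup>2 / 4 * (T powr (1 - 1 / \<beta>) * real k powr (1 / \<beta> - 1))
      = (n * B\<^sup>2 / 4 * T) * T powr (- 1 / \<beta>) * real k powr (1 / \<beta> - 1)"
      using T0 by (simp add: powr_diff powr_minus field_simps)
    \<comment> \<open>The quotient \<open>T\<close> is made for this cancellation: the squared bias
      becomes a multiple of \<open>q\<close>, the unit in which the noise term is already
      measured.\<close>
    also have "n * B\<^sup>2 / 4 * T = 3 / (8 * (\<beta> - 1)) * (n\<^sup>2 * \<kappa> * s\<^sup>2)"
      unfolding T using B \<beta> by (simp add: field_simps power2_eq_square)
    also have "3 / (8 * (\<beta> - 1)) * (n\<^sup>2 * \<kappa> * s\<^sup>2) * T powr (- 1 / \<beta>) * real k powr (1 / \<beta> - 1)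
      = 3 / (8 * (\<beta> - 1)) * (q * real k powr (1 / \<beta> - 1))" by (simp add: q_def)
    \<comment> \<open>As \<open>\<beta> > 2\<close>, the coefficient is below 3 / 8; noise and bias
      together then cost at most one \<open>q\<close>.\<close>
    also have "\<dots> \<le> 1 / 2 * (q * real k powr (1 / \<beta> - 1))"
      using \<beta> q0 by (intro mult_right_mono) (auto simp: field_simps)
    finally have e2: "(sqrt n * \<tau> k powr (\<beta> - 1) * B / 2)\<^sup>2 \<le> 1 / 2 * (q * real k powr (1 / \<beta> - 1))" .
    have "(8 * n * \<kappa> * M\<^sup>2 + n\<^sup>2 * \<kappa> * s\<^sup>2 / (2 * (\<tau> k)\<^sup>2)) / real k
      = 8 * n * \<kappa> * M\<^sup>2 * (1 / real k) + q / 2 * real k powr (1 / \<beta> - 1)"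
      unfolding add_divide_distrib e1 by simp
    then show ?thesis using e2 by simp
  qed
  have "(\<Sum>k=1..N. (8 * n * \<kappa> * M\<^sup>2 + n\<^sup>2 * \<kappa> * s\<^sup>2 / (2 * (\<tau> k)\<^sup>2)) / real k + (sqrt n * \<tau> k powr (\<beta> - 1) * B / 2)\<^sup>2)
    \<le> (\<Sum>k=1..N. 8 * n * \<kappa> * M\<^sup>2 * (1 / real k) + q * real k powr (1 / \<beta> - 1))"
    by (rule sum_mono[OF step])
  also have "\<dots> = 8 * n * \<kappa> * M\<^sup>2 * (\<Sum>k=1..N. 1 / real k) + q * (\<Sum>k=1..N. real k powr (1 / \<beta> - 1))"
    unfolding sum.distrib sum_distrib_left[symmetric] ..
  \<comment> \<open>The factor \<open>\<beta>\<close> of \<open>A\<^sub>1\<close> arises here as the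
    reciprocal of the exponent \<open>1 / \<beta>\<close>; the passage from 8 to 9 is slack.\<close>
  also have "\<dots> \<le> 9 * n * \<kappa> * M\<^sup>2 * (1 + ln (real N)) + q * (real N powr (1 / \<beta>) / (1 / \<beta>))"
  proof (rule add_mono)
    show "8 * n * \<kappa> * M\<^sup>2 * (\<Sum>k=1..N. 1 / real k) \<le> 9 * n * \<kappa> * M\<^sup>2 * (1 + ln (real N))"
      using sum_inverse_le[OF N] n \<kappa> by (intro mult_mono) (auto intro!: sum_nonneg)
    show "q * (\<Sum>k=1..N. real k powr (1 / \<beta> - 1)) \<le> q * (real N powr (1 / \<beta>) / (1 / \<beta>))"
      using \<beta> q0 by (intro mult_left_mono sum_powr_le) auto
  qed
  finally have main: "(\<Sum>k=1..N. (8 * n * \<kappa> * M\<^sup>2 + n\<^sup>2 * \<kappa> * s\<^sup>2 / (2 * (\<tau> k)\<^sup>2)) / real k + (sqrt n * \<tau> k powr (\<beta> - 1) * B / 2)\<^sup>2) / real N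
    \<le> (9 * n * \<kappa> * M\<^sup>2 * (1 + ln (real N)) + q * (real N powr (1 / \<beta>) * \<beta>)) / real N"
    using Np by (intro divide_right_mono) auto
  \<comment> \<open>Expanding \<open>T powr (- 1 / \<beta>)\<close> leaves, besides powers of the
    parameters, only \<open>c powr (1 / \<beta>)\<close> with
    \<open>c = 2 * (\<beta> - 1) / 3\<close>. It is at most 2, hence below the 3 of the
    claim.\<close>
  have qle: "q \<le> 3 * (n powr (2 - 1 / \<beta>) * (\<kappa> * s\<^sup>2) powr ((\<beta> - 1) / \<beta>) * B powr (2 / \<beta>))"
  proof -
    define c where "c = 2 * (\<beta> - 1) / 3"
    have c0: "c > 0" "c \<le> \<beta>" using \<beta> by (auto simp: c_def)
    have Tc: "T = (\<kappa> * s\<^sup>2) * n / (c * B\<^sup>2)" unfolding T c_def using \<beta> B by (simp add: field_simps)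
    have "T powr (- 1 / \<beta>) = (c * B\<^sup>2 / ((\<kappa> * s\<^sup>2) * n)) powr (1 / \<beta>)"
    proof -
      have "T powr (- 1 / \<beta>) = inverse (T powr (1 / \<beta>))" using powr_minus[of T "1 / \<beta>"] by simp
      also have "\<dots> = (c * B\<^sup>2 / ((\<kappa> * s\<^sup>2) * n)) powr (1 / \<beta>)"
        unfolding Tc using c0 \<kappa> n by (subst (1 2) powr_divide) auto
      finally show ?thesis .
    qed
    also have "\<dots> = c powr (1 / \<beta>) * B powr (2 / \<beta>) / ((\<kappa> * s\<^sup>2) powr (1 / \<beta>) * n powr (1 / \<beta>))"
    proof -
      have "(B\<^sup>2) powr (1 / \<beta>) = B powr (2 / \<beta>)"
        using B powr_powr[of B 2 "1 / \<beta>"] by (simp add: powr_numeral)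
      then show ?thesis using c0 B \<kappa> s n by (simp add: powr_divide powr_mult)
    qed
    finally have Te: "T powr (- 1 / \<beta>) = c powr (1 / \<beta>) * B powr (2 / \<beta>) / ((\<kappa> * s\<^sup>2) powr (1 / \<beta>) * n powr (1 / \<beta>))" .
    have n2: "n\<^sup>2 / n powr (1 / \<beta>) = n powr (2 - 1 / \<beta>)" using n by (simp add: powr_diff powr_numeral)
    have k2: "(\<kappa> * s\<^sup>2) / (\<kappa> * s\<^sup>2) powr (1 / \<beta>) = (\<kappa> * s\<^sup>2) powr ((\<beta> - 1) / \<beta>)"
    proof -
      have "(\<beta> - 1) / \<beta> = 1 - 1 / \<beta>" using \<beta> by (simp add: field_simps)
      then show ?thesis using \<kappa> s by (simp add: powr_diff)
    qed
    have "q = c powr (1 / \<beta>) * ((n\<^sup>2 / n powr (1 / \<beta>)) * ((\<kappa> * s\<^sup>2) / (\<kappa> * s\<^sup>2) powr (1 / \<beta>)) * B powr (2 / \<beta>))"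
      unfolding q_def Te by (simp add: mult_ac)
    also have "\<dots> \<le> 3 * ((n\<^sup>2 / n powr (1 / \<beta>)) * ((\<kappa> * s\<^sup>2) / (\<kappa> * s\<^sup>2) powr (1 / \<beta>)) * B powr (2 / \<beta>))"
      using powr_inverse_le_2[of \<beta> c] c0 \<beta> \<kappa> by (intro mult_right_mono) auto
    finally show ?thesis unfolding n2 k2 .
  qed
  have Nb: "real N powr (1 / \<beta>) / real N = 1 / real N powr ((\<beta> - 1) / \<beta>)"
  proof -
    have "(\<beta> - 1) / \<beta> = 1 - 1 / \<beta>" using \<beta> by (simp add: field_simps)
    then show ?thesis using Np by (simp add: powr_diff)
  qed
  have "(9 * n * \<kappa> * M\<^sup>2 * (1 + ln (real N)) + q * (real N powr (1 / \<beta>) * \<beta>)) / real N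
    = 9 * \<kappa> * M\<^sup>2 * (n * (1 + ln (real N)) / real N) + q * \<beta> * (real N powr (1 / \<beta>) / real N)"
    by (simp add: add_divide_distrib mult_ac)
  also have "\<dots> \<le> 9 * \<kappa> * M\<^sup>2 * (n * (1 + ln (real N)) / real N)
    + 3 * (n powr (2 - 1 / \<beta>) * (\<kappa> * s\<^sup>2) powr ((\<beta> - 1) / \<beta>) * B powr (2 / \<beta>)) * \<beta> * (real N powr (1 / \<beta>) / real N)"
    using qle \<beta> by (intro add_left_mono mult_right_mono) auto
  finally show ?thesis using main unfolding Nb by (simp add: mult_ac)
qed

text \<open>\<open>K\<close> cannot vanish almost everywhere because its first moment is 1.
  Positivity of both constants makes the quotient that defines the radii positive.\<close>

lemma (in smoothing) kernel_constants_pos: "kernel_kappa K > 0" "kernel_kappa_beta \<beta> K > 0"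
proof -
  have pos: "(\<integral>u. f u \<partial>uniform_interval) > 0"
    if f: "integrable uniform_interval f" "\<And>u. 0 \<le> f u" "\<And>u. f u = 0 \<Longrightarrow> u * K u = 0" for f :: "real \<Rightarrow> real"
  proof -
    have "(\<integral>u. f u \<partial>uniform_interval) \<noteq> 0"
    proof
      assume "(\<integral>u. f u \<partial>uniform_interval) = 0"
      then have "AE u in uniform_interval. f u = 0"
        by (subst (asm) integral_nonneg_eq_0_iff_AE[OF f(1)]) (use f(2) in auto)
      then have "AE u in uniform_interval. u * K u = 0" by eventually_elim (rule f(3))
      then have "(\<integral>u. u * K u \<partial>uniform_interval) = 0" by (rule integral_eq_zero_AE)
      then show False using kernel by (simp add: smoothing_kernel_def)
    qed
    moreover have "(\<integral>u. f u \<partial>uniform_interval) \<ge> 0" using f(2) by simp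
    ultimately show ?thesis by linarith
  qed
  show "kernel_kappa K > 0" unfolding kappa_eq using pos[OF K_sq_int] by simp
  show "kernel_kappa_beta \<beta> K > 0" unfolding kappa_beta_eq using pos[OF K_beta_int] by auto
qed

text \<open>The Lipschitz constant is the same for all outcomes and therefore survives
  integration.\<close>

lemma (in prob_space) expectation_continuous_on:
  fixes f :: "'c::real_normed_vector \<Rightarrow> 'a \<Rightarrow> real"
  assumes int: "\<And>x. x \<in> S \<Longrightarrow> integrable M (f x)" and C: "C \<ge> 0"
    and lip: "\<And>x y \<omega>. x \<in> S \<Longrightarrow> y \<in> S \<Longrightarrow> \<omega> \<in> space M \<Longrightarrow> \<bar>f x \<omega> - f y \<omega>\<bar> \<le> C * norm (x - y)"
  shows "continuous_on S (\<lambda>x. \<integral>\<omega>. f x \<omega> \<partial>M)"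
proof (rule lipschitz_on_continuous_on[of C], rule lipschitz_onI[OF _ C])
  fix x y assume xy: "x \<in> S" "y \<in> S"
  have "\<bar>\<integral>\<omega>. f x \<omega> - f y \<omega> \<partial>M\<bar> \<le> C * norm (x - y)"
  proof (rule order_trans[OF integral_abs_bound], rule integral_le_const)
    show "integrable M (\<lambda>\<omega>. \<bar>f x \<omega> - f y \<omega>\<bar>)" using int xy by simp
    show "AE \<omega> in M. \<bar>f x \<omega> - f y \<omega>\<bar> \<le> C * norm (x - y)" by (rule AE_I2) (rule lip[OF xy])
  qed
  then show "dist (\<integral>\<omega>. f x \<omega> \<partial>M) (\<integral>\<omega>. f y \<omega> \<partial>M) \<le> C * dist x y"
    using int xy by (simp add: dist_norm)
qed

context zo_method
begin

text \<open>The expectations are Lipschitz in the free variable, with the constant \<open>M\<close>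
  for every outcome, so they attain their extrema on the compact factors.\<close>

lemma saddle_values_attained:
  assumes N: "N \<ge> 1"
  shows "\<exists>y\<^sub>0. is_arg_max (\<lambda>y. \<integral>\<omega>. \<phi> (fst (zbar \<omega>), y) \<partial>P) (\<lambda>y. y \<in> Y) y\<^sub>0"
    and "\<exists>x\<^sub>0. is_arg_min (\<lambda>x. \<integral>\<omega>. \<phi> (x, snd (zbar \<omega>)) \<partial>P) (\<lambda>x. x \<in> X) x\<^sub>0"
    and "x \<in> X \<Longrightarrow> integrable P (\<lambda>\<omega>. \<phi> (x, snd (zbar \<omega>)))"
    and "y \<in> Y \<Longrightarrow> integrable P (\<lambda>\<omega>. \<phi> (fst (zbar \<omega>), y))"
proof -
  let ?F = "\<lambda>y. \<integral>\<omega>. \<phi> (fst (zbar \<omega>), y) \<partial>P" and ?G = "\<lambda>x. \<integral>\<omega>. \<phi> (x, snd (zbar \<omega>)) \<partial>P"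
  obtain B where B: "\<forall>p\<in>Z. \<bar>\<phi> p\<bar> \<le> B" using bounded_phi by blast
  note [measurable] = zbar_measurable
  have zb: "fst (zbar \<omega>) \<in> X" "snd (zbar \<omega>) \<in> Y" if "\<omega> \<in> space P" for \<omega>
    using zbar_in[OF that N] by (auto simp: mem_Times_iff)
  have ix: "integrable P (\<lambda>\<omega>. \<phi> (x, snd (zbar \<omega>)))" if "x \<in> X" for x
  proof (rule integrable_const_bound[where B=B])
    show "AE \<omega> in P. norm (\<phi> (x, snd (zbar \<omega>))) \<le> B"
      by (intro AE_I2) (use B that zb in auto)
  qed measurable
  have iy: "integrable P (\<lambda>\<omega>. \<phi> (fst (zbar \<omega>), y))" if "y \<in> Y" for y
  proof (rule integrable_const_bound[where B=B])
    show "AE \<omega> in P. norm (\<phi> (fst (zbar \<omega>), y)) \<le> B"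
      by (intro AE_I2) (use B that zb in auto)
  qed measurable
  show "x \<in> X \<Longrightarrow> integrable P (\<lambda>\<omega>. \<phi> (x, snd (zbar \<omega>)))" by (rule ix)
  show "y \<in> Y \<Longrightarrow> integrable P (\<lambda>\<omega>. \<phi> (fst (zbar \<omega>), y))" by (rule iy)
  have t1: "\<tau> 1 > 0" using \<tau>[of 1] N by simp
  have lip: "\<bar>\<phi> p - \<phi> p'\<bar> \<le> M * norm (p - p')" if "p \<in> Z" "p' \<in> Z" for p p'
  proof -
    have "p \<in> neighbourhood (\<tau> 1) Z" "p' \<in> neighbourhood (\<tau> 1) Z"
      using that t1 unfolding neighbourhood_def by force+
    from lipschitz_onD[OF lipschitz this] show ?thesis by (simp add: dist_norm)
  qed
  have "continuous_on Y ?F"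
  proof (rule expectation_continuous_on[OF iy M])
    fix y y' \<omega> assume "y \<in> Y" "y' \<in> Y" "\<omega> \<in> space P"
    then show "\<bar>\<phi> (fst (zbar \<omega>), y) - \<phi> (fst (zbar \<omega>), y')\<bar> \<le> M * norm (y - y')"
      using lip[of "(fst (zbar \<omega>), y)" "(fst (zbar \<omega>), y')"] zb by (simp add: norm_Pair)
  qed
  then show "\<exists>y\<^sub>0. is_arg_max ?F (\<lambda>y. y \<in> Y) y\<^sub>0"
    using continuous_attains_sup[OF Y(1), of ?F] Z(4)
    by (auto simp: is_arg_max_linorder)
  have "continuous_on X ?G"
  proof (rule expectation_continuous_on[OF ix M])
    fix x x' \<omega> assume "x \<in> X" "x' \<in> X" "\<omega> \<in> space P"
    then show "\<bar>\<phi> (x, snd (zbar \<omega>)) - \<phi> (x', snd (zbar \<omega>))\<bar> \<le> M * norm (x - x')"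
      using lip[of "(x, snd (zbar \<omega>))" "(x', snd (zbar \<omega>))"] zb by (simp add: norm_Pair)
  qed
  then show "\<exists>x\<^sub>0. is_arg_min ?G (\<lambda>x. x \<in> X) x\<^sub>0"
    using continuous_attains_inf[OF X(1), of ?G] Z(4)
    by (auto simp: is_arg_min_linorder)
qed

end

theorem theorem6:
  fixes X :: "'a::euclidean_space set" and Y :: "'b::euclidean_space set"
    and \<phi> :: "'a \<times> 'b \<Rightarrow> real" and K :: "real \<Rightarrow> real"
    and \<mu> \<beta> L \<epsilon>\<^sub>0 M \<sigma> :: real and \<tau> \<gamma> :: "nat \<Rightarrow> real" and N n :: nat
    and P :: "'w measure" and e z :: "nat \<Rightarrow> 'w \<Rightarrow> 'a \<times> 'b" and r \<xi>p \<xi>m :: "nat \<Rightarrow> 'w \<Rightarrow> real"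
    and z\<^sub>1 :: "'a \<times> 'b" and x\<^sub>s :: 'a and y\<^sub>s :: 'b
    and \<kappa>\<^sub>\<beta> \<kappa> A\<^sub>1 A\<^sub>2 :: real and zbar :: "'w \<Rightarrow> 'a \<times> 'b"
  assumes n: "n = DIM('a) + DIM('b)"
    and X: "compact X" "convex X"
    and Y: "compact Y" "convex Y"
    and params: "\<mu> > 0" "L > 0" "\<beta> > 2" "\<sigma> > 0" "N \<ge> 1"
    and kernel: "smoothing_kernel \<beta> K"
    and \<kappa>\<^sub>\<beta>: "\<kappa>\<^sub>\<beta> = kernel_kappa_beta \<beta> K"
    and \<kappa>: "\<kappa> = kernel_kappa K"
    and \<tau>: "\<And>k. k \<in> {1..N} \<Longrightarrow>
      \<tau> k = (3 * \<kappa> * \<sigma>\<^sup>2 * real n / (2 * (\<beta> - 1) * (\<kappa>\<^sub>\<beta> * L)\<^sup>2)) powr (1 / (2 * \<beta>))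
              * real k powr (- 1 / (2 * \<beta>))"
    and \<gamma>: "\<And>k. k \<in> {1..N} \<Longrightarrow> \<gamma> k = 2 / (\<mu> * real k)"
    and \<epsilon>\<^sub>0: "\<epsilon>\<^sub>0 > 0" "\<tau> 1 \<le> \<epsilon>\<^sub>0"
    and \<phi>: "\<phi> \<in> saddle_holder_class \<epsilon>\<^sub>0 X Y \<mu> \<beta> L"
    and lipschitz: "M-lipschitz_on (neighbourhood (\<tau> 1) (X \<times> Y)) \<phi>"
    and saddle: "saddle_point \<phi> X Y x\<^sub>s y\<^sub>s"
    and P: "prob_space P"
    and draws: "uniform_draws P N e r"
    and noise: "noise_model P N \<sigma> e r \<xi>p \<xi>m"
    and z\<^sub>1: "z\<^sub>1 \<in> X \<times> Y"
    and iterates: "zo_iterates P N \<phi> (X \<times> Y) K \<tau> \<gamma> e r \<xi>p \<xi>m z\<^sub>1 z"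
    and zbar: "\<And>\<omega>. zbar \<omega> = zo_average N z \<omega>"
    and A\<^sub>1: "A\<^sub>1 = 3 * \<beta> * (\<kappa> * \<sigma>\<^sup>2) powr ((\<beta> - 1) / \<beta>) * (\<kappa>\<^sub>\<beta> * L) powr (2 / \<beta>)"
    and A\<^sub>2: "A\<^sub>2 = 9 * \<kappa> * M\<^sup>2"
  shows "\<exists>ymax xmin.
      is_arg_max (\<lambda>y. \<integral>\<omega>. \<phi> (fst (zbar \<omega>), y) \<partial>P) (\<lambda>y. y \<in> Y) ymax \<and>
      is_arg_min (\<lambda>x. \<integral>\<omega>. \<phi> (x, snd (zbar \<omega>)) \<partial>P) (\<lambda>x. x \<in> X) xmin \<and>
      (\<integral>\<omega>. \<phi> (fst (zbar \<omega>), y\<^sub>s) - \<phi> (x\<^sub>s, snd (zbar \<omega>)) \<partial>P)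
        \<le> (\<integral>\<omega>. \<phi> (fst (zbar \<omega>), ymax) \<partial>P) - (\<integral>\<omega>. \<phi> (xmin, snd (zbar \<omega>)) \<partial>P) \<and>
      (\<integral>\<omega>. \<phi> (fst (zbar \<omega>), ymax) \<partial>P) - (\<integral>\<omega>. \<phi> (xmin, snd (zbar \<omega>)) \<partial>P)
        \<le> 1 / \<mu> * (real n powr (2 - 1 / \<beta>) * (A\<^sub>1 / real N powr ((\<beta> - 1) / \<beta>))
                     + A\<^sub>2 * (real n * (1 + ln (real N)) / real N))"
proof -
  let ?F = "\<lambda>y. \<integral>\<omega>. \<phi> (fst (zbar \<omega>), y) \<partial>P" and ?G = "\<lambda>x. \<integral>\<omega>. \<phi> (x, snd (zbar \<omega>)) \<partial>P"
  interpret P: prob_space P by (rule P)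
  interpret S: smoothing \<beta> K by unfold_locales (use kernel params in auto)
  have \<kappa>0: "\<kappa> > 0" and \<kappa>\<beta>0: "\<kappa>\<^sub>\<beta> > 0" unfolding \<kappa> \<kappa>\<^sub>\<beta> using S.kernel_constants_pos by auto
  define T where "T = 3 * \<kappa> * \<sigma>\<^sup>2 * real n / (2 * (\<beta> - 1) * (\<kappa>\<^sub>\<beta> * L)\<^sup>2)"
  have n0: "real n > 0" unfolding n by (simp add: add_pos_pos)
  have T0: "T > 0" unfolding T_def using \<kappa>0 \<kappa>\<beta>0 params n0 by simp
  have \<tau>T: "\<tau> k = T powr (1 / (2 * \<beta>)) * real k powr (- 1 / (2 * \<beta>))" if "k \<in> {1..N}" for k
    using \<tau>[OF that] unfolding T_def .
  \<comment> \<open>The exponent of \<open>k\<close> is negative, so the first radius is the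
    largest.\<close>
  have \<tau>pos: "0 < \<tau> k \<and> \<tau> k \<le> \<tau> 1" if k: "k \<in> {1..N}" for k
  proof -
    have "real k powr (- 1 / (2 * \<beta>)) \<le> 1 powr (- 1 / (2 * \<beta>))"
      using k params by (intro powr_mono2') (auto simp: field_simps)
    then have "T powr (1 / (2 * \<beta>)) * real k powr (- 1 / (2 * \<beta>)) \<le> T powr (1 / (2 * \<beta>)) * 1 powr (- 1 / (2 * \<beta>))"
      by (intro mult_left_mono) auto
    then show ?thesis using \<tau>T[OF k] \<tau>T[of 1] T0 k params(5) by simp
  qed
  interpret zo: zo_method P \<beta> K X Y \<phi> \<mu> L \<epsilon>\<^sub>0 M \<sigma> \<tau> \<gamma> N e z r \<xi>p \<xi>m z\<^sub>1
    using X Y params \<tau>pos \<gamma> \<epsilon>\<^sub>0(2) \<phi> lipschitz draws noise z\<^sub>1 iterates by unfold_locales auto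
  have zb: "zo.zbar = zbar" unfolding zo.zbar_def[abs_def] zbar ..
  note att = zo.saddle_values_attained[OF params(5), unfolded zb]
  obtain ymax where ymax: "is_arg_max ?F (\<lambda>y. y \<in> Y) ymax" using att(1) by blast
  obtain xmin where xmin: "is_arg_min ?G (\<lambda>x. x \<in> X) xmin" using att(2) by blast
  have m: "ymax \<in> Y" "xmin \<in> X" using ymax xmin by (auto simp: is_arg_max_def is_arg_min_def)
  have s: "x\<^sub>s \<in> X" "y\<^sub>s \<in> Y" using saddle by (auto simp: saddle_point_def)
  have "(\<integral>\<omega>. \<phi> (fst (zbar \<omega>), y\<^sub>s) - \<phi> (x\<^sub>s, snd (zbar \<omega>)) \<partial>P)
      = ?F y\<^sub>s - ?G x\<^sub>s"
    by (rule Bochner_Integration.integral_diff[OF att(4)[OF s(2)] att(3)[OF s(1)]])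
  also have "\<dots> \<le> ?F ymax - ?G xmin"
    using ymax xmin s by (intro diff_mono) (auto simp: is_arg_max_linorder is_arg_min_linorder)
  finally have 1: "(\<integral>\<omega>. \<phi> (fst (zbar \<omega>), y\<^sub>s) - \<phi> (x\<^sub>s, snd (zbar \<omega>)) \<partial>P)
      \<le> ?F ymax - ?G xmin" .
  have nd: "real DIM('a \<times> 'b) = real n" by (simp add: n)
  \<comment> \<open>The extremal points form one deterministic comparison point, in crossed roles:
    \<open>ymax\<close> is paired with the first component of the average, \<open>xmin\<close> with
    the second.\<close>
  have "?F ymax - ?G xmin = (\<integral>\<omega>. zo.gap (xmin, ymax) (zbar \<omega>) \<partial>P)"
    unfolding zo.gap_def fst_conv snd_conv
    by (rule Bochner_Integration.integral_diff[OF att(4)[OF m(1)] att(3)[OF m(2)], symmetric])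
  also have "\<dots> \<le> (\<Sum>k=1..N. zo.second_moment_bound k / real k + (zo.bias_bound k)\<^sup>2) / \<mu> / real N"
    using zo.expected_gap[of "(xmin, ymax)"] m params(5) unfolding zb by simp
  \<comment> \<open>Kernel and Hoelder constant occur only in the product
    \<open>\<kappa>\<^sub>\<beta> * L\<close>, which is the \<open>B\<close> of
    \<open>step_error_sum\<close>.\<close>
  also have "\<dots> = 1 / \<mu> * ((\<Sum>k=1..N. (8 * real n * \<kappa> * M\<^sup>2 + (real n)\<^sup>2 * \<kappa> * \<sigma>\<^sup>2 / (2 * (\<tau> k)\<^sup>2)) / real k
      + (sqrt (real n) * \<tau> k powr (\<beta> - 1) * (\<kappa>\<^sub>\<beta> * L) / 2)\<^sup>2) / real N)"
    unfolding zo.second_moment_bound_def zo.bias_bound_def nd \<kappa> \<kappa>\<^sub>\<beta> by (simp add: mult_ac)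
  also have "\<dots> \<le> 1 / \<mu> * (real n powr (2 - 1 / \<beta>) * (3 * \<beta> * (\<kappa> * \<sigma>\<^sup>2) powr ((\<beta> - 1) / \<beta>) * (\<kappa>\<^sub>\<beta> * L) powr (2 / \<beta>) / real N powr ((\<beta> - 1) / \<beta>))
      + 9 * \<kappa> * M\<^sup>2 * (real n * (1 + ln (real N)) / real N))"
    using params \<kappa>0 \<kappa>\<beta>0 n0 by (intro mult_left_mono step_error_sum[OF _ _ _ _ _ _ T_def \<tau>T]) auto
  finally show ?thesis using ymax xmin 1 unfolding A\<^sub>1 A\<^sub>2 by blast
qed

end
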